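(* Let $(a,b,c)$ be any permutation of $(2,1,0)$. Then the sequence of unit vectors $(e_n)$ is a symmetric basis for each of the three Banach spaces $\Delta_c(\mathcal C)$, $\Delta_b(\ker\Delta_c)$ and $\Delta_a(\ker\Delta_b\cap\ker\Delta_c)$. Similarly, $\langle\Delta_a,\Delta_b\rangle(\ker\Delta_c)$ and $\langle\Delta_a,\Delta_b\rangle(\mathcal C)$ admit a symmetric two-dimensional decomposition, and $\langle\Delta_a,\Delta_b,\Delta_c\rangle(\mathcal C)$ admits a symmetric three-dimensional decomposition. All of these spaces (for all permutations $(a,b,c)$) admit a Schauder basis.
   Context: All spaces are complex. For the couple $(X_0,X_1)=(\ell_\infty,\ell_1)$ put $\Sigma=\ell_\infty+\ell_1$. The Calderón space $\mathcal C$ of the couple is the Banach space of bounded continuous functions $F:\{z\in\mathbb C:0\le \mathrm{Re}\,z\le 1\}\to\Sigma$, analytic on the open strip, such that for $j=0,1$ the map $t\mapsto F(j+it)$ is continuous from $\mathbb R$ into $X_j$ and tends to $0$ as $|t|\to\infty$, with norm $\|F\|=\max_{j=0,1}\sup_{t}\|F(j+it)\|_{X_j}$. For $k=0,1,2$ let $\Delta_k:\mathcal C\to\Sigma$, $\Delta_k(F)=F^{(k)}(1/2)/k!$. For distinct indices put $\langle\Delta_a,\Delta_b\rangle(F)=(\Delta_aF,\Delta_bF)$ and $\langle\Delta_a,\Delta_b,\Delta_c\rangle(F)=(\Delta_aF,\Delta_bF,\Delta_cF)$. If $T$ is one of these maps and $K$ is a closed subspace of $\mathcal C$, then $T(K)$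 carries the quotient norm $\|x\|=\inf\{\|F\|:F\in K,\ TF=x\}$ and is a Banach space. A $k$-dimensional decomposition of a Banach space is a Schauder decomposition $(E_n)$ with $\dim E_n=k$ for all $n$; it is symmetric if, for a suitable identification of all the $E_n$ with one fixed $k$-dimensional space, the operators sending $\sum_n v_n$ ($v_n\in E_n$) to $\sum_n \varepsilon_n v'_{n}$, where $v'_n\in E_{\pi(n)}$ is the vector corresponding to $v_n$, are well defined and uniformly bounded over all permutations $\pi$ of $\mathbb N$ and all signs $\varepsilon_n=\pm1$. For $k=1$ this is the notion of symmetric basis. *)

theory Defs
  imports "HOL-Analysis.Analysis" "HOL-Library.Function_Algebras"
begin

class complex_vector = ab_group_add +
  fixes scaleC :: "complex \<Rightarrow> 'a \<Rightarrow> 'a"  (infixr "*\<^sub>C" 75)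
  assumes scaleC_add_right: "c *\<^sub>C (x + y) = c *\<^sub>C x + c *\<^sub>C y"
    and scaleC_add_left: "(c + d) *\<^sub>C x = c *\<^sub>C x + d *\<^sub>C x"
    and scaleC_scaleC: "c *\<^sub>C (d *\<^sub>C x) = (c * d) *\<^sub>C x"
    and scaleC_one: "1 *\<^sub>C x = x"

instantiation complex :: complex_vector
begin
definition scaleC_complex :: "complex \<Rightarrow> complex \<Rightarrow> complex"
  where "scaleC_complex c x = c * x"
instance
  by standard (simp_all add: scaleC_complex_def algebra_simps)
end

instantiation "fun" :: (type, complex_vector) complex_vector
begin
definition scaleC_fun :: "complex \<Rightarrow> ('a \<Rightarrow> 'b) \<Rightarrow> 'a \<Rightarrow> 'b"
  where "scaleC_fun c f = (\<lambda>i. c *\<^sub>C f i)"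
instance
  by standard (simp_all add: scaleC_fun_def fun_eq_iff scaleC_add_right scaleC_add_left
      scaleC_scaleC scaleC_one)
end

instantiation prod :: (complex_vector, complex_vector) complex_vector
begin
definition scaleC_prod :: "complex \<Rightarrow> 'a \<times> 'b \<Rightarrow> 'a \<times> 'b"
  where "scaleC_prod c p = (c *\<^sub>C fst p, c *\<^sub>C snd p)"
instance
  by standard (simp_all add: scaleC_prod_def scaleC_add_right scaleC_add_left
      scaleC_scaleC scaleC_one prod_eq_iff)
end

lemma vector_space_scaleC: "vector_space (scaleC :: complex \<Rightarrow> 'a \<Rightarrow> 'a::complex_vector)"
  by standard (simp_all add: scaleC_add_right scaleC_add_left scaleC_scaleC scaleC_one)

abbreviation csubspace :: "'v::complex_vector set \<Rightarrow> bool"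
  where "csubspace \<equiv> module.subspace scaleC"

(* The library's dim is 0 for infinite-dimensional spaces; below it is only compared
   with positive numbers. *)
abbreviation cdim :: "'v::complex_vector set \<Rightarrow> nat"
  where "cdim \<equiv> vector_space.dim scaleC"

record 'v nspace =
  pts :: "'v set"
  nrm :: "'v \<Rightarrow> real"

definition tends :: "'v::complex_vector nspace \<Rightarrow> ('i \<Rightarrow> 'v) \<Rightarrow> 'v \<Rightarrow> 'i filter \<Rightarrow> bool"
  where "tends S f l \<F> \<longleftrightarrow> ((\<lambda>i. nrm S (f i - l)) \<longlongrightarrow> 0) \<F>"

definition banach_space :: "'v::complex_vector nspace \<Rightarrow> bool"
  where "banach_space S \<longleftrightarrow>
    csubspace (pts S) \<and>
    (\<forall>x\<in>pts S. 0 \<le> nrm S x \<and> (nrm S x = 0 \<longleftrightarrow> x = 0)) \<and>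
    (\<forall>x\<in>pts S. \<forall>c. nrm S (c *\<^sub>C x) = cmod c * nrm S x) \<and>
    (\<forall>x\<in>pts S. \<forall>y\<in>pts S. nrm S (x + y) \<le> nrm S x + nrm S y) \<and>
    (\<forall>s. (\<forall>n::nat. s n \<in> pts S) \<and>
         (\<forall>\<epsilon>>0. \<exists>M. \<forall>m\<ge>M. \<forall>n\<ge>M. nrm S (s m - s n) < \<epsilon>)
       \<longrightarrow> (\<exists>x\<in>pts S. tends S s x sequentially))"

definition closed_subspace :: "'v::complex_vector nspace \<Rightarrow> 'v set \<Rightarrow> bool"
  where "closed_subspace S E \<longleftrightarrow> csubspace E \<and> E \<subseteq> pts S \<and>
    (\<forall>s x. (\<forall>n::nat. s n \<in> E) \<and> x \<in> pts S \<and> tends S s x sequentially \<longrightarrow> x \<in> E)"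

definition sums_in :: "'v::complex_vector nspace \<Rightarrow> (nat \<Rightarrow> 'v) \<Rightarrow> 'v \<Rightarrow> bool"
  where "sums_in S v x \<longleftrightarrow> x \<in> pts S \<and> tends S (\<lambda>N. \<Sum>n<N. v n) x sequentially"

definition schauder_basis :: "'v::complex_vector nspace \<Rightarrow> (nat \<Rightarrow> 'v) \<Rightarrow> bool"
  where "schauder_basis S e \<longleftrightarrow> banach_space S \<and> (\<forall>n. e n \<in> pts S) \<and>
    (\<forall>x\<in>pts S. \<exists>!c :: nat \<Rightarrow> complex. sums_in S (\<lambda>n. c n *\<^sub>C e n) x)"

definition schauder_decomposition :: "'v::complex_vector nspace \<Rightarrow> (nat \<Rightarrow> 'v set) \<Rightarrow> bool"
  where "schauder_decomposition S E \<longleftrightarrow> banach_space S \<and> (\<forall>n. closed_subspace S (E n)) \<and>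
    (\<forall>x\<in>pts S. \<exists>!v. (\<forall>n. v n \<in> E n) \<and> sums_in S v x)"

(* G is the fixed space and phi n its identification with the n-th summand E n.  The vector
   v_n of E n is written as phi n (g n); the vector of E (pi n) corresponding to v_n is then
   phi (pi n) (g n). *)
definition uniformly_symmetric ::
    "'v::complex_vector nspace \<Rightarrow> 'g set \<Rightarrow> (nat \<Rightarrow> 'g \<Rightarrow> 'v) \<Rightarrow> bool"
  where "uniformly_symmetric S G \<phi> \<longleftrightarrow>
    (\<exists>M. \<forall>(\<pi> :: nat \<Rightarrow> nat) (\<epsilon> :: nat \<Rightarrow> complex) g x.
       bij \<pi> \<and> (\<forall>n. \<epsilon> n \<in> {1, -1}) \<and> (\<forall>n. g n \<in> G) \<and> sums_in S (\<lambda>n. \<phi> n (g n)) x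
       \<longrightarrow> (\<exists>y. sums_in S (\<lambda>n. \<epsilon> n *\<^sub>C \<phi> (\<pi> n) (g n)) y \<and> nrm S y \<le> M * nrm S x))"

definition identification ::
    "'g::complex_vector set \<Rightarrow> 'v::complex_vector set \<Rightarrow> ('g \<Rightarrow> 'v) \<Rightarrow> bool"
  where "identification G E f \<longleftrightarrow> bij_betw f G E \<and>
    (\<forall>x\<in>G. \<forall>y\<in>G. f (x + y) = f x + f y) \<and> (\<forall>c. \<forall>x\<in>G. f (c *\<^sub>C x) = c *\<^sub>C f x)"

(* Taking the fixed space G inside the ambient type is no restriction: E 0 is available there. *)
definition symmetric_decomposition ::
    "nat \<Rightarrow> 'v::complex_vector nspace \<Rightarrow> (nat \<Rightarrow> 'v set) \<Rightarrow> bool"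
  where "symmetric_decomposition k S E \<longleftrightarrow>
    schauder_decomposition S E \<and> (\<forall>n. cdim (E n) = k) \<and>
    (\<exists>(G :: 'v set) \<phi>. csubspace G \<and> cdim G = k \<and>
       (\<forall>n. identification G (E n) (\<phi> n)) \<and> uniformly_symmetric S G \<phi>)"

(* The summands are the lines spanned by the e n, identified with the scalars by t |-> t e n. *)
definition symmetric_basis :: "'v::complex_vector nspace \<Rightarrow> (nat \<Rightarrow> 'v) \<Rightarrow> bool"
  where "symmetric_basis S e \<longleftrightarrow>
    schauder_basis S e \<and> uniformly_symmetric S (UNIV :: complex set) (\<lambda>n t. t *\<^sub>C e n)"

type_synonym cseq = "nat \<Rightarrow> complex"

definition unit_vec :: "nat \<Rightarrow> cseq"
  where "unit_vec n = (\<lambda>i. if i = n then 1 else 0)"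

definition linf :: "cseq nspace"
  where "linf = \<lparr>pts = {x. bounded (range x)}, nrm = (\<lambda>x. SUP n. cmod (x n))\<rparr>"

definition l1 :: "cseq nspace"
  where "l1 = \<lparr>pts = {x. summable (\<lambda>n. cmod (x n))}, nrm = (\<lambda>x. \<Sum>n. cmod (x n))\<rparr>"

definition sum_space :: "'v::complex_vector nspace \<Rightarrow> 'v nspace \<Rightarrow> 'v nspace"
  where "sum_space S T =
    \<lparr>pts = {x + y | x y. x \<in> pts S \<and> y \<in> pts T},
     nrm = (\<lambda>w. Inf {nrm S x + nrm T y | x y. x \<in> pts S \<and> y \<in> pts T \<and> w = x + y})\<rparr>"

definition Sigma_space :: "cseq nspace"
  where "Sigma_space = sum_space linf l1"

definition strip :: "complex set"
  where "strip = {z. 0 \<le> Re z \<and> Re z \<le> 1}"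

definition open_strip :: "complex set"
  where "open_strip = {z. 0 < Re z \<and> Re z < 1}"

definition has_cderiv ::
    "'v::complex_vector nspace \<Rightarrow> (complex \<Rightarrow> 'v) \<Rightarrow> 'v \<Rightarrow> complex \<Rightarrow> bool"
  where "has_cderiv S F D z \<longleftrightarrow>
    D \<in> pts S \<and> tends S (\<lambda>w. inverse (w - z) *\<^sub>C (F w - F z)) D (at z)"

definition cderiv :: "'v::complex_vector nspace \<Rightarrow> (complex \<Rightarrow> 'v) \<Rightarrow> complex \<Rightarrow> 'v"
  where "cderiv S F z = (THE D. has_cderiv S F D z)"

definition C0_line :: "'v::complex_vector nspace \<Rightarrow> (real \<Rightarrow> 'v) \<Rightarrow> bool"
  where "C0_line S f \<longleftrightarrow> (\<forall>t. f t \<in> pts S) \<and> (\<forall>t. tends S f (f t) (at t)) \<and>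
    tends S f 0 at_infinity"

(* Functions on the closed strip are represented by their extension by 0 to the plane. *)
definition calderon :: "(complex \<Rightarrow> cseq) set"
  where "calderon = {F.
    (\<forall>z. z \<notin> strip \<longrightarrow> F z = 0) \<and>
    (\<forall>z\<in>strip. F z \<in> pts Sigma_space) \<and>
    (\<exists>B. \<forall>z\<in>strip. nrm Sigma_space (F z) \<le> B) \<and>
    (\<forall>z\<in>strip. tends Sigma_space F (F z) (at z within strip)) \<and>
    (\<forall>z\<in>open_strip. \<exists>D. has_cderiv Sigma_space F D z) \<and>
    C0_line linf (\<lambda>t. F (Complex 0 t)) \<and>
    C0_line l1 (\<lambda>t. F (Complex 1 t))}"

definition calderon_norm :: "(complex \<Rightarrow> cseq) \<Rightarrow> real"
  where "calderon_norm F =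
    max (SUP t. nrm linf (F (Complex 0 t))) (SUP t. nrm l1 (F (Complex 1 t)))"

definition Delta :: "nat \<Rightarrow> (complex \<Rightarrow> cseq) \<Rightarrow> cseq"
  where "Delta k F = (1 / fact k) *\<^sub>C (cderiv Sigma_space ^^ k) F (1/2)"

definition ker_Delta :: "nat \<Rightarrow> (complex \<Rightarrow> cseq) set"
  where "ker_Delta k = {F \<in> calderon. Delta k F = 0}"

definition Delta2 :: "nat \<Rightarrow> nat \<Rightarrow> (complex \<Rightarrow> cseq) \<Rightarrow> cseq \<times> cseq"
  where "Delta2 a b F = (Delta a F, Delta b F)"

definition Delta3 :: "nat \<Rightarrow> nat \<Rightarrow> nat \<Rightarrow> (complex \<Rightarrow> cseq) \<Rightarrow> cseq \<times> cseq \<times> cseq"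
  where "Delta3 a b c F = (Delta a F, Delta b F, Delta c F)"

definition quotient_space ::
    "((complex \<Rightarrow> cseq) \<Rightarrow> 'v) \<Rightarrow> (complex \<Rightarrow> cseq) set \<Rightarrow> 'v nspace"
  where "quotient_space T K =
    \<lparr>pts = T ` K, nrm = (\<lambda>x. Inf {calderon_norm F | F. F \<in> K \<and> T F = x})\<rparr>"

end

theory Submission
  imports Defs "HOL-Complex_Analysis.Complex_Analysis"
begin

text \<open>
  Multiplication of the coordinates by a bounded sequence and permutation of the coordinates act on
  the Calderon space with norm at most the obvious one and commute with all \<open>\<Delta>\<^sub>k\<close>, so the only
  real issue is the density of finitely supported sequences.  For \<open>F\<close> in the Calderon space the
  tails of \<open>F(1 + it)\<close> are small in \<open>\<ell>\<^sub>1\<close> uniformly in \<open>t\<close> (by compactness), while those of \<open>F(it)\<close> are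
  merely bounded.  Put \<open>u(z) = exp (L (z - 1/2))\<close> and \<open>h = 1 - (1 - u)\<^sup>3\<close>: then \<open>h\<close> is of size
  \<open>exp (- L/2)\<close> on the left boundary, bounded on the right one, and \<open>h - 1\<close> has a triple zero at
  \<open>1/2\<close>.  Hence multiplying the tail of \<open>F\<close> by \<open>h\<close> changes none of the three coefficients
  but makes the norm arbitrarily small.
\<close>

section \<open>Sequence norms and families vanishing at infinity\<close>

text \<open>The order of the choices is essential: \<open>L\<close> comes first and depends on the
  norm of the function; only then is the cutoff chosen, late enough for the \<open>l1\<close> tails
  to absorb a factor that may be as large as \<open>7 * exp (L/2) ^ 3\<close>. Each coefficient of
  the damped tail is the truncated coefficient of the function, so vanishing coefficients stay zero
  and the same correction works inside every kernel. This is why all permutations and all six spaces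
  can be treated as instances of one construction. The sum space is \<open>linf\<close> with the
  same norm, since \<open>l1\<close> embeds into \<open>linf\<close> with norm 1. Analysis with
  values in it therefore reduces to scalar analysis of the coordinates with bounds that do not
  depend on the coordinate. Density alone gives expansions; their uniqueness comes from continuity
  of the coordinates, a Cauchy estimate at 1/2, and the unit vectors belong to each space because of
  explicit functions with prescribed coefficients.\<close>

text \<open>Both norms are of this form: take \<open>\<A>\<close> to be the singletons for \<open>\<ell>\<^sub>\<infinity>\<close> and all finite sets
  for \<open>\<ell>\<^sub>1\<close>.\<close>

definition seq_bounded :: "nat set set \<Rightarrow> cseq \<Rightarrow> real \<Rightarrow> bool"
  where "seq_bounded \<A> x B \<longleftrightarrow> (\<forall>A\<in>\<A>. (\<Sum>i\<in>A. cmod (x i)) \<le> B)"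

text \<open>Convergence is phrased with bounds and not with values of \<open>nrm\<close>, because a
  supremum or an infinite sum has no meaningful value outside the space. \<open>tends_iff\<close>
  makes the link for functions that eventually stay inside.\<close>

definition seq_tends :: "nat set set \<Rightarrow> ('i \<Rightarrow> cseq) \<Rightarrow> cseq \<Rightarrow> 'i filter \<Rightarrow> bool"
  where "seq_tends \<A> f l \<F> \<longleftrightarrow> (\<forall>\<epsilon>>0. eventually (\<lambda>s. seq_bounded \<A> (f s - l) \<epsilon>) \<F>)"

text \<open>Closure under images of bijections is what makes both norms invariant under permutations
  of the coordinates.\<close>

locale sum_family =
  fixes \<A> :: "nat set set"
  assumes finite_mem: "A \<in> \<A> \<Longrightarrow> finite A"
    and singleton_mem: "{n} \<in> \<A>"
    and image_mem: "bij \<sigma> \<Longrightarrow> A \<in> \<A> \<Longrightarrow> \<sigma> ` A \<in> \<A>"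
begin

lemma seq_bounded_coord: "cmod (x n) \<le> B" if "seq_bounded \<A> x B"
  using that singleton_mem[of n] by (force simp: seq_bounded_def)

lemma seq_bounded_nonneg: "0 \<le> B" if "seq_bounded \<A> x B"
  using seq_bounded_coord[OF that, of 0] norm_ge_zero order_trans by blast

lemma seq_bounded_mono: "seq_bounded \<A> x C" if "seq_bounded \<A> x B" "B \<le> C"
  using that by (force simp: seq_bounded_def)

lemma seq_bounded_zero: "0 \<le> B \<Longrightarrow> seq_bounded \<A> 0 B"
  by (simp add: seq_bounded_def)

lemma seq_bounded_add: "seq_bounded \<A> (x + y) (B + C)"
  if "seq_bounded \<A> x B" "seq_bounded \<A> y C"
  unfolding seq_bounded_def
proof
  fix A assume A: "A \<in> \<A>"
  have "(\<Sum>i\<in>A. cmod ((x + y) i)) \<le> (\<Sum>i\<in>A. cmod (x i) + cmod (y i))"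
    by (intro sum_mono) (simp add: norm_triangle_ineq)
  also have "\<dots> \<le> B + C"
    using that A by (auto simp: seq_bounded_def sum.distrib intro: add_mono)
  finally show "(\<Sum>i\<in>A. cmod ((x + y) i)) \<le> B + C" .
qed

text \<open>Weights and permutation are treated in one estimate: after reindexing, the sum over
  \<open>A\<close> becomes one over the image of \<open>A\<close>, which is again in the
  family.\<close>

lemma seq_bounded_weighted: "seq_bounded \<A> (\<lambda>n. m n * x (\<sigma> n)) (H * B)"
  if "seq_bounded \<A> x B" "\<And>n. cmod (m n) \<le> H" "bij \<sigma>"
  unfolding seq_bounded_def
proof
  fix A assume A: "A \<in> \<A>"
  have H: "0 \<le> H" using that(2)[of 0] norm_ge_zero order_trans by blast
  have "(\<Sum>i\<in>A. cmod (m i * x (\<sigma> i))) \<le> (\<Sum>i\<in>A. H * cmod (x (\<sigma> i)))"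
    by (intro sum_mono) (simp add: norm_mult mult_right_mono that)
  also have "\<dots> = H * (\<Sum>i\<in>\<sigma> ` A. cmod (x i))"
    using that(3) by (simp add: sum_distrib_left sum.reindex inj_on_def bij_def)
  also have "\<dots> \<le> H * B"
    using that(1) image_mem[OF that(3) A] H by (simp add: seq_bounded_def mult_left_mono)
  finally show "(\<Sum>i\<in>A. cmod (m i * x (\<sigma> i))) \<le> H * B" .
qed

lemma seq_bounded_scale: "seq_bounded \<A> (\<lambda>n. a * x n) (H * B)"
  if "seq_bounded \<A> x B" "cmod a \<le> H"
  using seq_bounded_weighted[OF that(1), of "\<lambda>_. a" H id] that(2) by simp

lemma seq_bounded_uminus: "seq_bounded \<A> (- x) B" if "seq_bounded \<A> x B"
  using that by (simp add: seq_bounded_def)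

lemma seq_bounded_diff: "seq_bounded \<A> (x - y) (B + C)"
  if "seq_bounded \<A> x B" "seq_bounded \<A> y C"
  using seq_bounded_add[OF that(1) seq_bounded_uminus[OF that(2)]] by simp

text \<open>Lower semicontinuity of the norm: each condition is about a single finite sum, so
  coordinatewise convergence is enough.\<close>

lemma seq_bounded_lim: "seq_bounded \<A> y B"
  if "\<And>n. (\<lambda>k. x k n) \<longlonglongrightarrow> y n" "eventually (\<lambda>k. seq_bounded \<A> (x k) B) sequentially"
  unfolding seq_bounded_def
proof
  fix A assume A: "A \<in> \<A>"
  have "(\<lambda>k. \<Sum>i\<in>A. cmod (x k i)) \<longlonglongrightarrow> (\<Sum>i\<in>A. cmod (y i))"
    by (intro tendsto_intros that)
  moreover have "eventually (\<lambda>k. (\<Sum>i\<in>A. cmod (x k i)) \<le> B) sequentially"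
    using that(2) by eventually_elim (use A in \<open>simp add: seq_bounded_def\<close>)
  ultimately show "(\<Sum>i\<in>A. cmod (y i)) \<le> B"
    by (rule tendsto_upperbound) simp
qed

lemma seq_bounded_unit_vec: "seq_bounded \<A> (unit_vec q) 1"
  unfolding seq_bounded_def
proof
  fix A assume "A \<in> \<A>"
  then have "finite A" by (rule finite_mem)
  have "(\<Sum>i\<in>A. cmod (unit_vec q i)) = (\<Sum>i\<in>A. if i = q then 1 else 0)"
    by (intro sum.cong) (auto simp: unit_vec_def)
  then show "(\<Sum>i\<in>A. cmod (unit_vec q i)) \<le> 1"
    using \<open>finite A\<close> by simp
qed

lemma seq_tends_add: "seq_tends \<A> (\<lambda>s. f s + g s) (l + m) \<F>"
  if "seq_tends \<A> f l \<F>" "seq_tends \<A> g m \<F>"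
  unfolding seq_tends_def
proof (intro allI impI)
  fix \<epsilon> :: real assume "0 < \<epsilon>"
  then have "eventually (\<lambda>s. seq_bounded \<A> (f s - l) (\<epsilon>/2)) \<F>"
    "eventually (\<lambda>s. seq_bounded \<A> (g s - m) (\<epsilon>/2)) \<F>"
    using that half_gt_zero[of \<epsilon>] unfolding seq_tends_def by blast+
  then show "eventually (\<lambda>s. seq_bounded \<A> (f s + g s - (l + m)) \<epsilon>) \<F>"
  proof eventually_elim
    case (elim s)
    have "f s + g s - (l + m) = (f s - l) + (g s - m)" by simp
    then show ?case using seq_bounded_add[OF elim] by (simp only: field_sum_of_halves)
  qed
qed

lemma seq_tends_coord: "((\<lambda>s. f s n) \<longlongrightarrow> l n) \<F>" if "seq_tends \<A> f l \<F>"
proof (rule tendstoI)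
  fix \<epsilon> :: real assume "0 < \<epsilon>"
  then have "eventually (\<lambda>s. seq_bounded \<A> (f s - l) (\<epsilon>/2)) \<F>"
    using that half_gt_zero unfolding seq_tends_def by blast
  then show "eventually (\<lambda>s. dist (f s n) (l n) < \<epsilon>) \<F>"
  proof eventually_elim
    case (elim s)
    then show ?case using seq_bounded_coord[OF elim, of n] \<open>0 < \<epsilon>\<close> by (simp add: dist_norm)
  qed
qed

text \<open>When the limit is 0, the scalar factor only has to be bounded. This is the situation at
  infinity on the boundary lines, along which the damping factor oscillates.\<close>

lemma seq_tends_weighted_zero:
  assumes f: "seq_tends \<A> f 0 \<F>" and h: "\<And>s. cmod (h s) \<le> H"
    and m: "\<And>n. cmod (m n) \<le> 1" and \<sigma>: "bij \<sigma>"
  shows "seq_tends \<A> (\<lambda>s n. h s * m n * f s (\<sigma> n)) 0 \<F>"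
  unfolding seq_tends_def
proof (intro allI impI)
  fix \<epsilon> :: real assume e: "0 < \<epsilon>"
  have H: "0 < \<bar>H\<bar> + 1" by simp
  have "eventually (\<lambda>s. seq_bounded \<A> (f s - 0) (\<epsilon> / (\<bar>H\<bar> + 1))) \<F>"
    using f e H unfolding seq_tends_def by simp
  then show "eventually (\<lambda>s. seq_bounded \<A> ((\<lambda>n. h s * m n * f s (\<sigma> n)) - 0) \<epsilon>) \<F>"
  proof eventually_elim
    case (elim s)
    have "cmod (h s * m n) \<le> \<bar>H\<bar> + 1" for n
    proof -
      have "cmod (h s * m n) \<le> cmod (h s) * 1"
        unfolding norm_mult by (intro mult_left_mono m) simp
      also have "\<dots> \<le> \<bar>H\<bar> + 1" using h[of s] by simp
      finally show ?thesis .
    qed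
    then have "seq_bounded \<A> (\<lambda>n. h s * m n * (f s - 0) (\<sigma> n)) ((\<bar>H\<bar> + 1) * (\<epsilon> / (\<bar>H\<bar> + 1)))"
      by (rule seq_bounded_weighted[OF elim _ \<sigma>])
    then show ?case using H by simp
  qed
qed

lemma seq_tends_weighted:
  assumes f: "seq_tends \<A> f l \<F>" and h: "(h \<longlongrightarrow> c) \<F>" and l: "seq_bounded \<A> l B"
    and m: "\<And>n. cmod (m n) \<le> 1" and \<sigma>: "bij \<sigma>"
  shows "seq_tends \<A> (\<lambda>s n. h s * m n * f s (\<sigma> n)) (\<lambda>n. c * m n * l (\<sigma> n)) \<F>"
  unfolding seq_tends_def
proof (intro allI impI)
  fix \<epsilon> :: real assume e: "0 < \<epsilon>"
  define H where "H = cmod c + 1"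
  have H: "0 < H" by (simp add: H_def add_nonneg_pos)
  have B: "0 \<le> B" by (rule seq_bounded_nonneg[OF l])
  have "eventually (\<lambda>s. seq_bounded \<A> (f s - l) (\<epsilon> / (2 * H))) \<F>"
    using f e H unfolding seq_tends_def by simp
  moreover have "eventually (\<lambda>s. dist (h s) c < min 1 (\<epsilon> / (2 * (B + 1)))) \<F>"
    using h e B by (intro tendstoD) auto
  ultimately show "eventually (\<lambda>s. seq_bounded \<A> ((\<lambda>n. h s * m n * f s (\<sigma> n)) - (\<lambda>n. c * m n * l (\<sigma> n))) \<epsilon>) \<F>"
  proof eventually_elim
    case (elim s)
    have d: "cmod (h s - c) \<le> 1" "cmod (h s - c) \<le> \<epsilon> / (2 * (B + 1))"
      using elim(2) by (auto simp: dist_norm)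
    have "cmod (h s) \<le> H"
      using norm_triangle_ineq2[of "h s" c] d(1) unfolding H_def by linarith
    then have 1: "cmod (h s * m n) \<le> H" for n
      using mult_mono[of "cmod (h s)" H "cmod (m n)" 1] m[of n] H by (simp add: norm_mult)
    have 2: "cmod ((h s - c) * m n) \<le> \<epsilon> / (2 * (B + 1))" for n
      using mult_mono[OF d(2) m[of n]] e B by (simp add: norm_mult)
    \<comment> \<open>The usual product splitting; each summand receives half of \<epsilon>, and
      \<open>B + 1\<close> in the denominator covers the case \<open>B = 0\<close>.\<close>
    have *: "(\<lambda>n. h s * m n * f s (\<sigma> n)) - (\<lambda>n. c * m n * l (\<sigma> n)) =
      (\<lambda>n. (h s * m n) * (f s - l) (\<sigma> n)) + (\<lambda>n. ((h s - c) * m n) * l (\<sigma> n))"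
      by (simp add: fun_eq_iff algebra_simps)
    have "seq_bounded \<A> ((\<lambda>n. h s * m n * f s (\<sigma> n)) - (\<lambda>n. c * m n * l (\<sigma> n)))
        (H * (\<epsilon> / (2 * H)) + \<epsilon> / (2 * (B + 1)) * B)"
      unfolding * by (intro seq_bounded_add seq_bounded_weighted elim l \<sigma> 1 2)
    moreover have "H * (\<epsilon> / (2 * H)) = \<epsilon> / 2" using H by simp
    moreover have "\<epsilon> / (2 * (B + 1)) * B \<le> \<epsilon> / 2"
      using e B by (simp add: field_simps)
    ultimately show ?case by (elim seq_bounded_mono) linarith
  qed
qed

lemma seq_tends_uniform_limit:
  assumes f: "\<And>k. seq_tends \<A> (f k) (f k z) \<F>"
    and lim: "\<And>\<epsilon>. 0 < \<epsilon> \<Longrightarrow> \<exists>k. seq_bounded \<A> (f k z - g z) \<epsilon> \<and> eventually (\<lambda>s. seq_bounded \<A> (f k s - g s) \<epsilon>) \<F>"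
  shows "seq_tends \<A> g (g z) \<F>"
  unfolding seq_tends_def
proof (intro allI impI)
  fix \<epsilon> :: real assume e: "0 < \<epsilon>"
  then obtain k where k: "seq_bounded \<A> (f k z - g z) (\<epsilon>/3)"
      "eventually (\<lambda>s. seq_bounded \<A> (f k s - g s) (\<epsilon>/3)) \<F>"
    using lim[of "\<epsilon>/3"] by auto
  have "eventually (\<lambda>s. seq_bounded \<A> (f k s - f k z) (\<epsilon>/3)) \<F>"
    using f e unfolding seq_tends_def by simp
  with k(2) show "eventually (\<lambda>s. seq_bounded \<A> (g s - g z) \<epsilon>) \<F>"
  proof eventually_elim
    case (elim s)
    have "g s - g z = (f k s - f k z) - (f k s - g s) + (f k z - g z)" by simp
    then have "seq_bounded \<A> (g s - g z) (\<epsilon>/3 + \<epsilon>/3 + \<epsilon>/3)"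
      using seq_bounded_add[OF seq_bounded_diff[OF elim(2,1)] k(1)] by simp
    then show ?case by simp
  qed
qed

end

text \<open>One equivalence fixes both data of the space: its points are the sequences with some
  bound, and the norm is the least bound.\<close>

locale sum_norm = sum_family \<A> for \<A> +
  fixes S :: "cseq nspace"
  assumes norm_iff: "x \<in> pts S \<and> nrm S x \<le> B \<longleftrightarrow> seq_bounded \<A> x B"
begin

lemma mem_pts_iff: "x \<in> pts S \<longleftrightarrow> (\<exists>B. seq_bounded \<A> x B)"
  using norm_iff by blast

lemma nrm_le_iff: "x \<in> pts S \<Longrightarrow> nrm S x \<le> B \<longleftrightarrow> seq_bounded \<A> x B"
  using norm_iff by blast

lemma nrm_nonneg: "x \<in> pts S \<Longrightarrow> 0 \<le> nrm S x"
  using norm_iff seq_bounded_nonneg by blast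

lemma diff_mem: "x \<in> pts S \<Longrightarrow> y \<in> pts S \<Longrightarrow> x - y \<in> pts S"
  using seq_bounded_diff unfolding mem_pts_iff by blast

lemma tends_iff:
  assumes "eventually (\<lambda>s. f s \<in> pts S) \<F>" "l \<in> pts S"
  shows "tends S f l \<F> \<longleftrightarrow> seq_tends \<A> f l \<F>"
proof -
  have *: "eventually (\<lambda>s. f s - l \<in> pts S) \<F>"
    using assms(1) by eventually_elim (intro diff_mem assms(2))
  show ?thesis unfolding tends_def seq_tends_def
  proof
    assume R: "((\<lambda>i. nrm S (f i - l)) \<longlongrightarrow> 0) \<F>"
    show "\<forall>\<epsilon>>0. eventually (\<lambda>s. seq_bounded \<A> (f s - l) \<epsilon>) \<F>"
    proof (intro allI impI)
      fix \<epsilon> :: real assume "0 < \<epsilon>"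
      with R have "eventually (\<lambda>s. nrm S (f s - l) < \<epsilon>) \<F>" by (rule order_tendstoD)
      with * show "eventually (\<lambda>s. seq_bounded \<A> (f s - l) \<epsilon>) \<F>"
        by eventually_elim (simp flip: nrm_le_iff)
    qed
  next
    assume R: "\<forall>\<epsilon>>0. eventually (\<lambda>s. seq_bounded \<A> (f s - l) \<epsilon>) \<F>"
    show "((\<lambda>i. nrm S (f i - l)) \<longlongrightarrow> 0) \<F>"
    proof (rule tendstoI)
      fix \<epsilon> :: real assume "0 < \<epsilon>"
      then have "eventually (\<lambda>s. seq_bounded \<A> (f s - l) (\<epsilon>/2)) \<F>" using R half_gt_zero by blast
      with * show "eventually (\<lambda>s. dist (nrm S (f s - l)) 0 < \<epsilon>) \<F>"
      proof eventually_elim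
        case (elim s)
        then have "nrm S (f s - l) \<le> \<epsilon>/2" using nrm_le_iff by blast
        then show ?case using nrm_nonneg[OF elim(1)] \<open>0 < \<epsilon>\<close> by simp
      qed
    qed
  qed
qed

end

section \<open>The sup norm, the \<open>l1\<close> norm and the norm of the sum space\<close>

definition singletons :: "nat set set"
  where "singletons = range (\<lambda>n. {n})"

lemma seq_bounded_singletons: "seq_bounded singletons x B \<longleftrightarrow> (\<forall>n. cmod (x n) \<le> B)"
  by (simp add: seq_bounded_def singletons_def)

interpretation linf: sum_norm singletons linf
proof
  show "x \<in> pts linf \<and> nrm linf x \<le> B \<longleftrightarrow> seq_bounded singletons x B" for x B
  proof
    assume x: "x \<in> pts linf \<and> nrm linf x \<le> B"
    then have "bdd_above (range (\<lambda>n. cmod (x n)))"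
      by (auto simp: linf_def bounded_iff bdd_above_def)
    with x show "seq_bounded singletons x B"
      unfolding seq_bounded_singletons linf_def nspace.simps
      by (meson UNIV_I cSUP_upper order_trans)
  next
    assume x: "seq_bounded singletons x B"
    then show "x \<in> pts linf \<and> nrm linf x \<le> B"
      unfolding seq_bounded_singletons linf_def nspace.simps
      by (auto simp: bounded_iff intro!: cSUP_least)
  qed
qed (auto simp: singletons_def)

interpretation l1: sum_norm "Collect finite" l1
proof
  show "x \<in> pts l1 \<and> nrm l1 x \<le> B \<longleftrightarrow> seq_bounded (Collect finite) x B" for x B
  proof
    assume x: "x \<in> pts l1 \<and> nrm l1 x \<le> B"
    have "(\<Sum>i\<in>A. cmod (x i)) \<le> B" if "finite A" for A
      using sum_le_suminf[of "\<lambda>n. cmod (x n)" A] x that by (force simp: l1_def)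
    then show "seq_bounded (Collect finite) x B" by (simp add: seq_bounded_def)
  next
    assume x: "seq_bounded (Collect finite) x B"
    then have b: "(\<Sum>i<n. cmod (x i)) \<le> B" for n by (simp add: seq_bounded_def)
    then have "summable (\<lambda>n. cmod (x n))"
      by (intro summableI_nonneg_bounded[where x = B]) auto
    then show "x \<in> pts l1 \<and> nrm l1 x \<le> B"
      using b by (auto simp: l1_def intro!: suminf_le_const)
  qed
qed simp_all

lemma l1_imp_linf: "seq_bounded (Collect finite) x B \<Longrightarrow> seq_bounded singletons x B"
  unfolding seq_bounded_singletons using l1.seq_bounded_coord by blast

text \<open>In any decomposition \<open>w = x + y\<close> the cost is at least the sup norm of
  \<open>w\<close>, because the \<open>l1\<close> norm dominates the sup norm;
  \<open>w = w + 0\<close> attains it. Hence the sum space is \<open>linf\<close>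
  isometrically.\<close>

interpretation Sigma: sum_norm singletons Sigma_space
proof
  show "x \<in> pts Sigma_space \<and> nrm Sigma_space x \<le> B \<longleftrightarrow> seq_bounded singletons x B" for x B
  proof -
    let ?D = "\<lambda>w. {nrm linf x + nrm l1 y | x y. x \<in> pts linf \<and> y \<in> pts l1 \<and> w = x + y}"
    have 0: "0 \<in> pts l1" "nrm l1 0 = 0" by (auto simp: l1_def)
    have sub: "w \<in> pts linf \<and> nrm linf w \<le> d" if "d \<in> ?D w" for w d
    proof -
      obtain x y where xy: "x \<in> pts linf" "y \<in> pts l1" "w = x + y" "d = nrm linf x + nrm l1 y"
        using \<open>d \<in> ?D w\<close> by blast
      have "seq_bounded singletons x (nrm linf x)" "seq_bounded singletons y (nrm l1 y)"
        using xy linf.norm_iff l1.norm_iff l1_imp_linf by blast+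
      then have "seq_bounded singletons w d" unfolding xy by (rule linf.seq_bounded_add)
      then show ?thesis by (simp add: linf.norm_iff)
    qed
    have mem: "nrm linf w \<in> ?D w" if "w \<in> pts linf" for w
    proof -
      have "nrm linf w = nrm linf w + nrm l1 0" "w = w + 0" using 0 by simp_all
      then show ?thesis using that 0(1) by blast
    qed
    have pts: "pts Sigma_space = pts linf"
    proof
      show "pts Sigma_space \<subseteq> pts linf" using sub by (fastforce simp: Sigma_space_def sum_space_def)
      show "pts linf \<subseteq> pts Sigma_space"
      proof
        fix w assume "w \<in> pts linf"
        moreover have "w = w + 0" by simp
        ultimately show "w \<in> pts Sigma_space"
          using 0(1) unfolding Sigma_space_def sum_space_def nspace.simps by blast
      qed
    qed
    have "nrm Sigma_space w = nrm linf w" if "w \<in> pts linf" for w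
    proof -
      have "Inf (?D w) = nrm linf w"
        by (intro cInf_eq_minimum mem that) (use sub in blast)
      then show ?thesis by (simp add: Sigma_space_def sum_space_def)
    qed
    then show ?thesis using pts linf.norm_iff[of x B] by auto
  qed
qed

section \<open>Tails, and compactness of the boundary lines\<close>

definition cutoff :: "nat \<Rightarrow> nat \<Rightarrow> complex"
  where "cutoff N n = (if n < N then 0 else 1)"

lemma norm_cutoff_le: "cmod (cutoff N n) \<le> 1"
  by (simp add: cutoff_def)

lemma l1_cutoff:
  assumes "seq_bounded (Collect finite) x B" "0 < \<epsilon>"
  shows "\<exists>N. \<forall>n\<ge>N. seq_bounded (Collect finite) (\<lambda>i. cutoff n i * x i) \<epsilon>"
proof -
  have "summable (\<lambda>n. cmod (x n))" using assms(1) l1.norm_iff by (auto simp: l1_def)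
  then obtain N where N: "\<And>m n. N \<le> m \<Longrightarrow> norm (\<Sum>i=m..<n. cmod (x i)) < \<epsilon>"
    using assms(2) unfolding summable_Cauchy by blast
  have "(\<Sum>i\<in>A. cmod (cutoff n i * x i)) \<le> \<epsilon>" if n: "N \<le> n" and A: "finite A" for n A
  proof -
    have "(\<Sum>i\<in>A. cmod (cutoff n i * x i)) = (\<Sum>i\<in>A \<inter> {n..}. cmod (x i))"
      using A by (intro sum.mono_neutral_cong_right) (auto simp: cutoff_def)
    \<comment> \<open>The Cauchy criterion speaks about intervals, so the set is enlarged to one.
      Inserting \<open>n\<close> keeps \<open>Max\<close> meaningful when \<open>A\<close> is
      empty.\<close>
    also have "\<dots> \<le> (\<Sum>i\<in>{n..<Suc (Max (insert n A))}. cmod (x i))"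
    proof (rule sum_mono2)
      show "A \<inter> {n..} \<subseteq> {n..<Suc (Max (insert n A))}"
      proof
        fix i assume i: "i \<in> A \<inter> {n..}"
        then have "i \<le> Max (insert n A)" using A by (intro Max_ge) auto
        then show "i \<in> {n..<Suc (Max (insert n A))}" using i by simp
      qed
    qed auto
    also have "\<dots> \<le> \<epsilon>" using N[OF n, of "Suc (Max (insert n A))"] by (simp add: sum_nonneg)
    finally show ?thesis .
  qed
  then show ?thesis unfolding seq_bounded_def by blast
qed

text \<open>Compactness of the line with a point at infinity added: finitely many neighbourhoods and
  one neighbourhood of infinity suffice, and the largest of their thresholds works
  everywhere.\<close>

lemma real_line_uniform:
  fixes Q :: "nat \<Rightarrow> real \<Rightarrow> bool"
  assumes local: "\<And>t. \<exists>N. eventually (\<lambda>s. \<forall>n\<ge>N. Q n s) (nhds t)"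
    and infinity: "\<exists>N. eventually (\<lambda>s. \<forall>n\<ge>N. Q n s) at_infinity"
  shows "\<exists>N. \<forall>n\<ge>N. \<forall>s. Q n s"
proof -
  obtain N0 R where R: "\<And>s n. R \<le> \<bar>s\<bar> \<Longrightarrow> N0 \<le> n \<Longrightarrow> Q n s"
    using infinity by (auto simp: eventually_at_infinity)
  from local have "\<forall>t. \<exists>N U. open U \<and> t \<in> U \<and> (\<forall>s\<in>U. \<forall>n\<ge>N. Q n s)"
    unfolding eventually_nhds by blast
  then obtain M U where U: "\<And>t. open (U t)" "\<And>t. t \<in> U t" "\<And>t s n. s \<in> U t \<Longrightarrow> M t \<le> n \<Longrightarrow> Q n s"
    by metis
  have "compact {-R..R}" by simp
  then obtain D where D: "finite D" "{-R..R} \<subseteq> (\<Union>t\<in>D. U t)"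
  proof (rule compactE_image[of _ UNIV U])
    show "{-R..R} \<subseteq> (\<Union>t. U t)" using U(2) by blast
  qed (use U(1) in auto)
  define N where "N = Max (insert N0 (M ` D))"
  have N: "N0 \<le> N" "\<And>t. t \<in> D \<Longrightarrow> M t \<le> N" using D(1) by (auto simp: N_def)
  have "Q n s" if "N \<le> n" for n s
  proof (cases "R \<le> \<bar>s\<bar>")
    case True
    then show ?thesis using R N that by auto
  next
    case False
    then have "s \<in> {-R..R}" by auto
    then obtain t where "t \<in> D" "s \<in> U t" using D(2) by blast
    then show ?thesis using U(3) N(2) that order_trans by blast
  qed
  then show ?thesis by blast
qed

definition vanishing_line :: "nat set set \<Rightarrow> (real \<Rightarrow> cseq) \<Rightarrow> bool"
  where "vanishing_line \<A> f \<longleftrightarrow> (\<forall>t. \<exists>B. seq_bounded \<A> (f t) B) \<and>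
    (\<forall>t. seq_tends \<A> f (f t) (at t)) \<and> seq_tends \<A> f 0 at_infinity"

lemma (in sum_norm) C0_line_iff: "C0_line S f \<longleftrightarrow> vanishing_line \<A> f"
proof -
  have "0 \<in> pts S" using seq_bounded_zero[of 0] by (auto simp: mem_pts_iff)
  then show ?thesis
    unfolding C0_line_def vanishing_line_def mem_pts_iff[symmetric]
    by (intro conj_cong refl) (simp_all add: tends_iff)
qed

context sum_family
begin

lemma vanishing_line_near:
  assumes "vanishing_line \<A> f" "0 < \<epsilon>"
  shows "eventually (\<lambda>s. seq_bounded \<A> (f s - f t) \<epsilon>) (nhds t)"
proof -
  have "eventually (\<lambda>s. seq_bounded \<A> (f s - f t) \<epsilon>) (at t)"
    using assms unfolding vanishing_line_def seq_tends_def by blast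
  moreover have "seq_bounded \<A> (f t - f t) \<epsilon>" using assms(2) seq_bounded_zero by simp
  ultimately show ?thesis by (simp add: eventually_nhds_conv_at)
qed

text \<open>The compactness principle is applied with the bound itself, a natural number, in the
  role of the index.\<close>

lemma vanishing_line_bounded:
  assumes f: "vanishing_line \<A> f"
  shows "\<exists>B. \<forall>t. seq_bounded \<A> (f t) B"
proof -
  have "\<exists>N. \<forall>n\<ge>N. \<forall>s. seq_bounded \<A> (f s) (real n)"
  proof (rule real_line_uniform)
    fix t
    obtain B where B: "seq_bounded \<A> (f t) B" using f by (auto simp: vanishing_line_def)
    have "eventually (\<lambda>s. \<forall>n\<ge>nat \<lceil>1 + B\<rceil>. seq_bounded \<A> (f s) (real n)) (nhds t)"
      using vanishing_line_near[OF f zero_less_one, of t]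
    proof eventually_elim
      case (elim s)
      have "seq_bounded \<A> (f s) (1 + B)"
        using seq_bounded_add[OF elim B] by simp
      then show ?case by (metis seq_bounded_mono nat_ceiling_le_eq)
    qed
    then show "\<exists>N. eventually (\<lambda>s. \<forall>n\<ge>N. seq_bounded \<A> (f s) (real n)) (nhds t)" ..
  next
    have "eventually (\<lambda>s. seq_bounded \<A> (f s - 0) 1) at_infinity"
      using f zero_less_one unfolding vanishing_line_def seq_tends_def by blast
    then have "eventually (\<lambda>s. \<forall>n\<ge>1. seq_bounded \<A> (f s) (real n)) at_infinity"
      by eventually_elim (auto intro: seq_bounded_mono)
    then show "\<exists>N. eventually (\<lambda>s. \<forall>n\<ge>N. seq_bounded \<A> (f s) (real n)) at_infinity" ..
  qed
  then show ?thesis by blast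
qed

lemma vanishing_line_add:
  assumes "vanishing_line \<A> f" "vanishing_line \<A> g"
  shows "vanishing_line \<A> (\<lambda>t. f t + g t)"
  unfolding vanishing_line_def
proof (intro conjI allI)
  show "seq_tends \<A> (\<lambda>t. f t + g t) 0 at_infinity"
    using seq_tends_add[of f 0 at_infinity g 0] assms by (simp add: vanishing_line_def)
  fix t
  show "seq_tends \<A> (\<lambda>t. f t + g t) (f t + g t) (at t)"
    using assms by (intro seq_tends_add) (auto simp: vanishing_line_def)
  obtain B C where "seq_bounded \<A> (f t) B" "seq_bounded \<A> (g t) C"
    using assms unfolding vanishing_line_def by blast
  then show "\<exists>B. seq_bounded \<A> (f t + g t) B" using seq_bounded_add by blast
qed

lemma vanishing_line_weighted:
  assumes f: "vanishing_line \<A> f" and h: "\<And>t. isCont h t" "\<And>t. cmod (h t) \<le> H"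
    and m: "\<And>n. cmod (m n) \<le> 1" and \<sigma>: "bij \<sigma>"
  shows "vanishing_line \<A> (\<lambda>t n. h t * m n * f t (\<sigma> n))"
  unfolding vanishing_line_def
proof (intro conjI allI)
  fix t
  obtain B where B: "seq_bounded \<A> (f t) B" using f by (auto simp: vanishing_line_def)
  have "cmod (h t * m n) \<le> cmod (h t)" for n
    using mult_left_mono[OF m[of n], of "cmod (h t)"] by (simp add: norm_mult)
  then have "seq_bounded \<A> (\<lambda>n. (h t * m n) * f t (\<sigma> n)) (cmod (h t) * B)"
    using \<sigma> by (intro seq_bounded_weighted B)
  then show "\<exists>B. seq_bounded \<A> (\<lambda>n. h t * m n * f t (\<sigma> n)) B" by blast
  show "seq_tends \<A> (\<lambda>t n. h t * m n * f t (\<sigma> n)) (\<lambda>n. h t * m n * f t (\<sigma> n)) (at t)"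
    using f h(1) by (intro seq_tends_weighted[OF _ _ B m \<sigma>]) (auto simp: vanishing_line_def isCont_def)
  show "seq_tends \<A> (\<lambda>t n. h t * m n * f t (\<sigma> n)) 0 at_infinity"
    using f h(2) m \<sigma> by (intro seq_tends_weighted_zero) (auto simp: vanishing_line_def)
qed

lemma seq_tends_scalar:
  assumes "(h \<longlongrightarrow> c) \<F>" "seq_bounded \<A> v B"
  shows "seq_tends \<A> (\<lambda>s n. h s * v n) (\<lambda>n. c * v n) \<F>"
proof -
  have "seq_tends \<A> (\<lambda>_. v) v \<F>" by (auto simp: seq_tends_def seq_bounded_zero)
  then show ?thesis
    using seq_tends_weighted[OF _ assms(1,2), of "\<lambda>_. v" "\<lambda>_. 1" id] by simp
qed

lemma vanishing_line_scalar:
  assumes "\<And>t. isCont h t" "(h \<longlongrightarrow> 0) at_infinity" "seq_bounded \<A> v B"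
  shows "vanishing_line \<A> (\<lambda>t n. h t * v n)"
  unfolding vanishing_line_def
proof (intro conjI allI)
  fix t
  show "\<exists>B. seq_bounded \<A> (\<lambda>n. h t * v n) B"
    using seq_bounded_scale[OF assms(3) order_refl] by blast
  show "seq_tends \<A> (\<lambda>t n. h t * v n) (\<lambda>n. h t * v n) (at t)"
    using assms by (intro seq_tends_scalar) (auto simp: isCont_def)
  show "seq_tends \<A> (\<lambda>t n. h t * v n) 0 at_infinity"
    using seq_tends_scalar[OF assms(2,3)] by (simp add: zero_fun_def)
qed

lemma vanishing_line_uniform_limit:
  assumes f: "\<And>k. vanishing_line \<A> (f k)"
    and lim: "\<And>\<epsilon>. 0 < \<epsilon> \<Longrightarrow> \<exists>k. \<forall>t. seq_bounded \<A> (f k t - g t) \<epsilon>"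
  shows "vanishing_line \<A> g"
  unfolding vanishing_line_def
proof (intro conjI allI)
  fix t
  obtain k B where "seq_bounded \<A> (f k t - g t) 1" "seq_bounded \<A> (f k t) B"
    using lim[OF zero_less_one] f unfolding vanishing_line_def by blast
  then have "seq_bounded \<A> (f k t - (f k t - g t)) (B + 1)" using seq_bounded_diff by blast
  then show "\<exists>B. seq_bounded \<A> (g t) B" by auto
  show "seq_tends \<A> g (g t) (at t)"
  proof (rule seq_tends_uniform_limit)
    show "seq_tends \<A> (f k) (f k t) (at t)" for k using f by (simp add: vanishing_line_def)
    show "\<exists>k. seq_bounded \<A> (f k t - g t) \<epsilon> \<and> eventually (\<lambda>s. seq_bounded \<A> (f k s - g s) \<epsilon>) (at t)"
      if "0 < \<epsilon>" for \<epsilon> using lim[OF that] always_eventually by blast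
  qed
  show "seq_tends \<A> g 0 at_infinity"
    unfolding seq_tends_def
  proof (intro allI impI)
    fix \<epsilon> :: real assume "0 < \<epsilon>"
    then obtain k where k: "\<And>t. seq_bounded \<A> (f k t - g t) (\<epsilon>/2)" using lim[of "\<epsilon>/2"] by auto
    have "eventually (\<lambda>t. seq_bounded \<A> (f k t - 0) (\<epsilon>/2)) at_infinity"
      using f \<open>0 < \<epsilon>\<close> half_gt_zero unfolding vanishing_line_def seq_tends_def by blast
    then show "eventually (\<lambda>t. seq_bounded \<A> (g t - 0) \<epsilon>) at_infinity"
    proof eventually_elim
      case (elim t)
      show ?case using seq_bounded_diff[OF elim k[of t]] by simp
    qed
  qed
qed

end

text \<open>Near \<open>t\<close>, half of \<epsilon> pays for replacing \<open>f s\<close> by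
  \<open>f t\<close> and the other half for the tail of the single sequence \<open>f t\<close>. The
  analogue for the sup norm fails: one bounded sequence may have tails that never shrink.\<close>

lemma vanishing_line_cutoff:
  fixes f :: "real \<Rightarrow> cseq"
  assumes f: "vanishing_line (Collect finite) f" and e: "0 < \<epsilon>"
  shows "\<exists>N. \<forall>n\<ge>N. \<forall>t. seq_bounded (Collect finite) (\<lambda>i. cutoff n i * f t i) \<epsilon>"
proof -
  have cutoff_le: "seq_bounded (Collect finite) (\<lambda>i. cutoff n i * x i) B"
    if "seq_bounded (Collect finite) x B" for n x B
    using l1.seq_bounded_weighted[OF that norm_cutoff_le[of n] bij_id] by simp
  show ?thesis
  proof (rule real_line_uniform)
    fix t
    obtain B where "seq_bounded (Collect finite) (f t) B" using f by (auto simp: vanishing_line_def)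
    then obtain N where N: "\<And>n. N \<le> n \<Longrightarrow> seq_bounded (Collect finite) (\<lambda>i. cutoff n i * f t i) (\<epsilon>/2)"
      using l1_cutoff[of "f t" B "\<epsilon>/2"] e by auto
    have "eventually (\<lambda>s. \<forall>n\<ge>N. seq_bounded (Collect finite) (\<lambda>i. cutoff n i * f s i) \<epsilon>) (nhds t)"
      using l1.vanishing_line_near[OF f half_gt_zero[OF e], of t]
    proof eventually_elim
      case (elim s)
      show ?case
      proof (intro allI impI)
        fix n assume "N \<le> n"
        have "(\<lambda>i. cutoff n i * f s i) = (\<lambda>i. cutoff n i * (f s - f t) i) + (\<lambda>i. cutoff n i * f t i)"
          by (simp add: fun_eq_iff algebra_simps)
        then show "seq_bounded (Collect finite) (\<lambda>i. cutoff n i * f s i) \<epsilon>"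
          using l1.seq_bounded_add[OF cutoff_le[OF elim] N[OF \<open>N \<le> n\<close>]] by simp
      qed
    qed
    then show "\<exists>N. eventually (\<lambda>s. \<forall>n\<ge>N. seq_bounded (Collect finite) (\<lambda>i. cutoff n i * f s i) \<epsilon>) (nhds t)" ..
  next
    have "eventually (\<lambda>s. seq_bounded (Collect finite) (f s - 0) \<epsilon>) at_infinity"
      using f e unfolding vanishing_line_def seq_tends_def by blast
    then have "eventually (\<lambda>s. \<forall>n\<ge>0. seq_bounded (Collect finite) (\<lambda>i. cutoff n i * f s i) \<epsilon>) at_infinity"
    proof eventually_elim
      case (elim s)
      show ?case using cutoff_le[OF elim] by simp
    qed
    then show "\<exists>N. eventually (\<lambda>s. \<forall>n\<ge>N. seq_bounded (Collect finite) (\<lambda>i. cutoff n i * f s i) \<epsilon>) at_infinity" ..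
  qed
qed

section \<open>Families of holomorphic functions on the strip\<close>

lemma open_open_strip: "open open_strip"
proof -
  have "open_strip = {z. 0 < Re z} \<inter> {z. Re z < 1}" by (auto simp: open_strip_def)
  then show ?thesis by (metis open_Int open_halfspace_Re_gt open_halfspace_Re_lt)
qed

lemma open_strip_subset: "open_strip \<subseteq> strip"
  by (auto simp: open_strip_def strip_def)

lemma half_mem_open_strip: "1/2 \<in> open_strip"
  by (simp add: open_strip_def)

lemma Complex_mem_strip: "Complex 0 t \<in> strip" "Complex 1 t \<in> strip"
  by (simp_all add: strip_def)

text \<open>Phragmen--Lindelof: multiply by \<open>exp (\<delta> z\<^sup>2)\<close> and let \<open>\<delta>\<close> tend to 0.\<close>

lemma strip_maximum_principle:
  assumes cont: "continuous_on strip f" and hol: "f holomorphic_on open_strip"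
    and bdd: "\<And>z. z \<in> strip \<Longrightarrow> cmod (f z) \<le> B"
    and left: "\<And>t. cmod (f (Complex 0 t)) \<le> M" and right: "\<And>t. cmod (f (Complex 1 t)) \<le> M"
    and z: "z \<in> strip"
  shows "cmod (f z) \<le> M"
proof -
  \<comment> \<open>Positive bounds come first, because the radius chosen below divides by
    \<open>M\<close>; a bound 0 is reached at the end through \<open>M + \<epsilon>\<close>.\<close>
  have pos: "cmod (f z) \<le> M" if M: "0 < M"
      and left: "\<And>t. cmod (f (Complex 0 t)) \<le> M" and right: "\<And>t. cmod (f (Complex 1 t)) \<le> M" for M
  proof -
    have B: "0 \<le> B" using bdd[OF z] norm_ge_zero order_trans by blast
    have *: "cmod (f z) * exp (\<delta> * ((Re z)\<^sup>2 - (Im z)\<^sup>2)) \<le> M * exp \<delta>" if d: "0 < \<delta>" for \<delta>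
    proof -
      \<comment> \<open>The rectangle must contain \<open>z\<close>, and on its horizontal edges the
        Gaussian factor has to bring \<open>B\<close> below \<open>M\<close>. With \<open>R\<close>
        at least 1 one has \<delta> \<open>R\<^sup>2\<close> \<ge> \<delta> \<open>R\<close> \<ge>
        \<open>B / M\<close>, which is enough.\<close>
      define R where "R = \<bar>Im z\<bar> + B / (M * \<delta>) + 1"
      define g where "g = (\<lambda>w. f w * exp (of_real \<delta> * w\<^sup>2))"
      have normg: "cmod (g w) = cmod (f w) * exp (\<delta> * ((Re w)\<^sup>2 - (Im w)\<^sup>2))" for w
        by (simp add: g_def norm_mult power2_eq_square)
      have R1: "1 \<le> R" "B / (M * \<delta>) \<le> R" "\<bar>Im z\<bar> \<le> R" using B M d by (auto simp: R_def)
      have "R \<le> R\<^sup>2" using R1(1) by (simp add: power2_eq_square)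
      then have "B / M \<le> \<delta> * R\<^sup>2" using R1(2) M d
        by (smt (verit) divide_divide_eq_left' mult.commute pos_divide_le_eq)
      also have "\<dots> \<le> exp (\<delta> * R\<^sup>2)" using exp_ge_add_one_self[of "\<delta> * R\<^sup>2"] by linarith
      finally have BR: "B \<le> M * exp (\<delta> * R\<^sup>2)" using M by (simp add: field_simps)
      define S where "S = cbox (Complex 0 (-R)) (Complex 1 R)"
      have S: "w \<in> S \<longleftrightarrow> 0 \<le> Re w \<and> Re w \<le> 1 \<and> - R \<le> Im w \<and> Im w \<le> R" for w
        by (auto simp: S_def in_cbox_complex_iff)
      have int: "w \<in> interior S \<longleftrightarrow> 0 < Re w \<and> Re w < 1 \<and> - R < Im w \<and> Im w < R" for w
        by (auto simp: S_def in_box_complex_iff)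
      have "cmod (g z) \<le> M * exp \<delta>"
      proof (rule maximum_modulus_frontier[where f = g and S = S])
        show "g holomorphic_on interior S" unfolding g_def
          by (intro holomorphic_intros holomorphic_on_subset[OF hol]) (use int in \<open>auto simp: open_strip_def\<close>)
        show "continuous_on (closure S) g" unfolding g_def
          by (intro continuous_intros continuous_on_subset[OF cont])
            (use S in \<open>auto simp: strip_def S_def\<close>)
        show "bounded S" by (simp add: S_def)
        show "z \<in> S" using z R1 by (auto simp: S strip_def)
        show "cmod (g w) \<le> M * exp \<delta>" if w: "w \<in> frontier S" for w
        proof -
          have wS: "w \<in> S" "w \<notin> interior S" using w by (auto simp: frontier_def S_def)
          then have Re: "(Re w)\<^sup>2 \<le> 1" by (simp add: S power_le_one)
          have "Re w = 0 \<or> Re w = 1 \<or> Im w = R \<or> Im w = - R"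
            using wS unfolding S int by linarith
          then consider "Re w = 0" | "Re w = 1" | "(Im w)\<^sup>2 = R\<^sup>2" by fastforce
          then show ?thesis
          proof cases
            case 3
            have "cmod (g w) \<le> B * exp (\<delta> * (1 - R\<^sup>2))"
              unfolding normg using 3 Re d wS(1) B by (intro mult_mono bdd) (auto simp: S strip_def)
            also have "\<dots> = exp \<delta> * (B / exp (\<delta> * R\<^sup>2))"
              by (simp add: right_diff_distrib exp_diff)
            also have "\<dots> \<le> exp \<delta> * M"
              using BR by (intro mult_left_mono) (simp_all add: field_simps)
            finally show ?thesis by (simp add: mult.commute)
          next
            case 1
            then have w: "w = Complex 0 (Im w)" by (simp add: complex_eq_iff)
            have "\<delta> * ((Re w)\<^sup>2 - (Im w)\<^sup>2) \<le> \<delta> * 1" using Re d zero_le_power2[of "Im w"] by (intro mult_left_mono) linarith+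
            moreover have "cmod (f w) \<le> M" using left[of "Im w"] w by simp
            ultimately show ?thesis unfolding normg using M by (intro mult_mono) auto
          next
            case 2
            then have w: "w = Complex 1 (Im w)" by (simp add: complex_eq_iff)
            have "\<delta> * ((Re w)\<^sup>2 - (Im w)\<^sup>2) \<le> \<delta> * 1" using Re d zero_le_power2[of "Im w"] by (intro mult_left_mono) linarith+
            moreover have "cmod (f w) \<le> M" using right[of "Im w"] w by simp
            ultimately show ?thesis unfolding normg using M by (intro mult_mono) auto
          qed
        qed
      qed
      then show ?thesis by (simp add: normg)
    qed
    \<comment> \<open>For fixed \<open>z\<close> both sides of the inequality are continuous in
      \<delta>, so the factors disappear as \<delta> decreases to 0.\<close>
    define c where "c = (Re z)\<^sup>2 - (Im z)\<^sup>2"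
    have "((\<lambda>\<delta>. cmod (f z) * exp (\<delta> * c)) \<longlongrightarrow> cmod (f z) * exp (0 * c)) (at_right 0)"
      by (intro tendsto_intros)
    moreover have "((\<lambda>\<delta>. M * exp \<delta>) \<longlongrightarrow> M * exp 0) (at_right 0)"
      by (intro tendsto_intros)
    moreover have "eventually (\<lambda>\<delta>. cmod (f z) * exp (\<delta> * c) \<le> M * exp \<delta>) (at_right (0::real))"
      using * by (simp add: eventually_at_filter c_def)
    ultimately show ?thesis
      using tendsto_le[of "at_right (0::real)"] by fastforce
  qed
  have "0 \<le> M" using left[of 0] norm_ge_zero order_trans by blast
  show ?thesis
  proof (rule field_le_epsilon)
    fix \<epsilon> :: real assume "0 < \<epsilon>"
    then show "cmod (f z) \<le> M + \<epsilon>"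
      using left right \<open>0 \<le> M\<close> by (intro pos) (auto intro: add_increasing2)
  qed
qed

section \<open>Cauchy estimates and derivatives with values in the sum space\<close>

text \<open>Halving the radius leaves around each \<open>w\<close> a disc of radius
  \<open>r/2\<close> inside the original disc, so one Cauchy estimate holds uniformly in
  \<open>w\<close>.\<close>

lemma higher_deriv_cball_bound:
  assumes hol: "f holomorphic_on S" "open S" "cball z r \<subseteq> S" and r: "0 < r"
    and B: "\<And>w. w \<in> cball z r \<Longrightarrow> cmod (f w) \<le> B" and w: "w \<in> cball z (r/2)"
  shows "cmod ((deriv ^^ k) f w) \<le> fact k * B / (r/2) ^ k"
proof (rule Cauchy_inequality)
  have sub: "cball w (r/2) \<subseteq> cball z r"
  proof
    fix u assume "u \<in> cball w (r/2)"
    then show "u \<in> cball z r" using w dist_triangle[of z u w] by (auto simp: dist_commute)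
  qed
  have "f holomorphic_on cball w (r/2)" using sub hol(1,3) holomorphic_on_subset by blast
  then show "f holomorphic_on ball w (r/2)" "continuous_on (cball w (r/2)) f"
    using holomorphic_on_subset ball_subset_cball holomorphic_on_imp_continuous_on by blast+
  show "0 < r/2" using r by simp
  show "cmod (f x) \<le> B" if "cmod (w - x) = r/2" for x
    using sub that by (intro B) (auto simp: dist_norm)
qed

text \<open>First-order Taylor expansion; the constant is the Cauchy bound
  \<open>2 * B / (r/2)\<^sup>2\<close> for the second derivative. The rate depends on
  \<open>f\<close> only through \<open>B\<close>, so the difference quotients of all coordinates
  converge simultaneously.\<close>

lemma difference_quotient_bound:
  assumes hol: "f holomorphic_on S" "open S" "cball z r \<subseteq> S" and r: "0 < r"
    and B: "\<And>w. w \<in> cball z r \<Longrightarrow> cmod (f w) \<le> B" and w: "w \<in> cball z (r/2)" "w \<noteq> z"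
  shows "cmod (inverse (w - z) * (f w - f z) - deriv f z) \<le> 8 * B / r\<^sup>2 * cmod (w - z)"
proof -
  have sub: "u \<in> S" if "u \<in> cball z (r/2)" for u
    using that hol(3) r by (auto simp: subset_iff)
  have "cmod ((deriv ^^ 0) f w - (\<Sum>i\<le>1. (deriv ^^ i) f z * (w - z) ^ i / fact i))
      \<le> (fact 2 * B / (r/2) ^ 2) * cmod (w - z) ^ Suc 1 / fact 1"
  proof (rule complex_Taylor)
    show "convex (cball z (r/2))" by simp
    show "((deriv ^^ i) f has_field_derivative (deriv ^^ Suc i) f x) (at x within cball z (r/2))"
      if "x \<in> cball z (r/2)" "i \<le> 1" for i x
      using holomorphic_derivI[OF holomorphic_higher_deriv[OF hol(1,2), of i] hol(2) sub[OF that(1)]]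
      by (simp add: has_field_derivative_at_within)
    show "cmod ((deriv ^^ Suc 1) f x) \<le> fact 2 * B / (r/2) ^ 2" if "x \<in> cball z (r/2)" for x
      using higher_deriv_cball_bound[OF hol r B that, of 2] by (simp add: numeral_2_eq_2)
  qed (use w r in auto)
  then have *: "cmod (f w - f z - deriv f z * (w - z)) \<le> 8 * B / r\<^sup>2 * (cmod (w - z))\<^sup>2"
    by (simp add: power_divide field_simps power2_eq_square)
  have "inverse (w - z) * (f w - f z) - deriv f z = (f w - f z - deriv f z * (w - z)) / (w - z)"
    using w(2) by (simp add: field_simps)
  then have "cmod (inverse (w - z) * (f w - f z) - deriv f z)
      = cmod (f w - f z - deriv f z * (w - z)) / cmod (w - z)" by (simp add: norm_divide)
  also have "\<dots> \<le> (8 * B / r\<^sup>2 * (cmod (w - z))\<^sup>2) / cmod (w - z)"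
    using * by (intro divide_right_mono) auto
  also have "\<dots> = 8 * B / r\<^sup>2 * cmod (w - z)" using w(2) by (simp add: power2_eq_square)
  finally show ?thesis .
qed

text \<open>A coordinatewise form of holomorphy with values in the sum space. The bound is only
  local because derivatives of a bounded function may blow up towards the boundary of the strip; in
  this form the class is stable under differentiation.\<close>

definition uniformly_holomorphic :: "(complex \<Rightarrow> cseq) \<Rightarrow> bool"
  where "uniformly_holomorphic G \<longleftrightarrow> (\<forall>n. (\<lambda>z. G z n) holomorphic_on open_strip) \<and>
    (\<forall>z\<in>open_strip. \<exists>r>0. \<exists>B. cball z r \<subseteq> open_strip \<and> (\<forall>w\<in>cball z r. \<forall>n. cmod (G w n) \<le> B))"

text \<open>Coordinates are continuous for the norm, so a derivative in norm is a derivative in each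
  coordinate. This gives uniqueness of the derivative as well as holomorphy of the
  coordinates.\<close>

lemma has_cderiv_coord:
  assumes "has_cderiv Sigma_space G D z" "eventually (\<lambda>w. G w \<in> pts Sigma_space) (nhds z)"
  shows "((\<lambda>w. G w n) has_field_derivative D n) (at z)"
proof -
  have Gz: "G z \<in> pts Sigma_space" using assms(2) by (rule eventually_nhds_x_imp_x)
  have "eventually (\<lambda>w. inverse (w - z) *\<^sub>C (G w - G z) \<in> pts Sigma_space) (at z)"
  proof -
    have "eventually (\<lambda>w. G w \<in> pts Sigma_space) (at z)"
      using assms(2) by (auto simp: eventually_nhds_conv_at)
    then show ?thesis
    proof eventually_elim
      case (elim w)
      then obtain B where "seq_bounded singletons (G w - G z) B"
        using Sigma.diff_mem[OF elim Gz] Sigma.mem_pts_iff by blast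
      then show ?case
        using linf.seq_bounded_scale[OF _ order_refl] Sigma.mem_pts_iff
        unfolding scaleC_fun_def scaleC_complex_def by blast
    qed
  qed
  then have "seq_tends singletons (\<lambda>w. inverse (w - z) *\<^sub>C (G w - G z)) D (at z)"
    using assms(1) Sigma.tends_iff[of "\<lambda>w. inverse (w - z) *\<^sub>C (G w - G z)" "at z" D]
    by (simp add: has_cderiv_def)
  from linf.seq_tends_coord[OF this, of n] show ?thesis
    by (simp add: has_field_derivative_iff scaleC_fun_def scaleC_complex_def divide_inverse mult.commute)
qed

text \<open>The estimate for difference quotients has the same constant in every coordinate, hence
  it is an estimate in the sup norm.\<close>

lemma uniformly_holomorphic_has_cderiv:
  assumes G: "uniformly_holomorphic G" and z: "z \<in> open_strip"
  shows "has_cderiv Sigma_space G (\<lambda>n. deriv (\<lambda>w. G w n) z) z"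
proof -
  obtain r B where r: "0 < r" "cball z r \<subseteq> open_strip"
    and B: "\<And>w n. w \<in> cball z r \<Longrightarrow> cmod (G w n) \<le> B"
    using G z unfolding uniformly_holomorphic_def by blast
  have hol: "(\<lambda>z. G z n) holomorphic_on open_strip" for n
    using G by (simp add: uniformly_holomorphic_def)
  have "cmod (G z 0) \<le> B" using B[of z 0] r by simp
  then have B0: "0 \<le> B" using norm_ge_zero order_trans by blast
  define D where "D = (\<lambda>n. deriv (\<lambda>w. G w n) z)"
  define Q where "Q = (\<lambda>w. inverse (w - z) *\<^sub>C (G w - G z))"
  have D: "D \<in> pts Sigma_space"
  proof -
    have "cmod (D n) \<le> B / (r/2)" for n
      using higher_deriv_cball_bound[OF hol[of n] open_open_strip r(2,1) B, where k = 1 and w = z] r(1) by (simp add: D_def)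
    then show ?thesis unfolding Sigma.mem_pts_iff seq_bounded_singletons by blast
  qed
  have near: "eventually (\<lambda>w. w \<in> cball z (r/2) \<and> w \<noteq> z \<and> cmod (w - z) < d) (at z)" if "0 < d" for d
    unfolding eventually_at using that r(1)
    by (intro exI[of _ "min d (r/2)"]) (auto simp: dist_norm norm_minus_commute)
  have bound: "seq_bounded singletons (Q w - D) (8 * B / r\<^sup>2 * cmod (w - z))"
    if "w \<in> cball z (r/2)" "w \<noteq> z" for w
    unfolding seq_bounded_singletons
  proof
    fix n
    show "cmod ((Q w - D) n) \<le> 8 * B / r\<^sup>2 * cmod (w - z)"
      using difference_quotient_bound[OF hol[of n] open_open_strip r(2,1) B that]
      by (simp add: Q_def D_def scaleC_fun_def scaleC_complex_def)
  qed
  have "seq_tends singletons Q D (at z)"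
    unfolding seq_tends_def
  proof (intro allI impI)
    fix \<epsilon> :: real assume e: "0 < \<epsilon>"
    define C where "C = 8 * B / r\<^sup>2 + 1"
    have C: "0 < C" using B0 r(1) by (simp add: C_def add_nonneg_pos)
    then have "0 < \<epsilon> / C" using e by simp
    from near[OF this] show "eventually (\<lambda>w. seq_bounded singletons (Q w - D) \<epsilon>) (at z)"
    proof eventually_elim
      case (elim w)
      have "8 * B / r\<^sup>2 * cmod (w - z) \<le> C * (\<epsilon> / C)"
        using elim C B0 by (intro mult_mono) (auto simp: C_def)
      also have "\<dots> = \<epsilon>" using C by simp
      finally show ?case using bound elim linf.seq_bounded_mono by blast
    qed
  qed
  moreover have "eventually (\<lambda>w. Q w \<in> pts Sigma_space) (at z)"
    using near[OF zero_less_one]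
  proof eventually_elim
    case (elim w)
    then obtain C where "seq_bounded singletons (Q w - D) C" using bound by blast
    moreover obtain C' where "seq_bounded singletons D C'" using D Sigma.mem_pts_iff by blast
    ultimately have "seq_bounded singletons (Q w - D + D) (C + C')" by (rule linf.seq_bounded_add)
    then show ?case unfolding Sigma.mem_pts_iff by (metis diff_add_cancel)
  qed
  ultimately show ?thesis
    using D Sigma.tends_iff[of Q "at z" D] by (simp add: has_cderiv_def Q_def[symmetric] D_def[symmetric])
qed

lemma uniformly_holomorphic_near:
  assumes "uniformly_holomorphic G" "z \<in> open_strip"
  shows "eventually (\<lambda>w. G w \<in> pts Sigma_space) (nhds z)"
proof -
  obtain r B where r: "0 < r" and B: "\<And>w n. w \<in> cball z r \<Longrightarrow> cmod (G w n) \<le> B"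
    using assms unfolding uniformly_holomorphic_def by blast
  have "eventually (\<lambda>w. w \<in> ball z r) (nhds z)" using r by (intro eventually_nhds_in_open) auto
  then show ?thesis
  proof eventually_elim
    case (elim w)
    then have "seq_bounded singletons (G w) B" using B by (auto simp: seq_bounded_singletons)
    then show ?case using Sigma.mem_pts_iff by blast
  qed
qed

lemma cderiv_eq:
  assumes "uniformly_holomorphic G" "z \<in> open_strip"
  shows "cderiv Sigma_space G z = (\<lambda>n. deriv (\<lambda>w. G w n) z)"
  unfolding cderiv_def
proof (rule the_equality)
  show "has_cderiv Sigma_space G (\<lambda>n. deriv (\<lambda>w. G w n) z) z"
    by (rule uniformly_holomorphic_has_cderiv[OF assms])
  show "D = (\<lambda>n. deriv (\<lambda>w. G w n) z)" if "has_cderiv Sigma_space G D z" for D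
    using has_cderiv_coord[OF that uniformly_holomorphic_near[OF assms]]
    by (auto simp: fun_eq_iff intro: DERIV_imp_deriv[symmetric])
qed

lemma uniformly_holomorphic_cderiv:
  assumes G: "uniformly_holomorphic G"
  shows "uniformly_holomorphic (cderiv Sigma_space G)"
  unfolding uniformly_holomorphic_def
proof (intro conjI allI ballI)
  have hol: "(\<lambda>z. G z n) holomorphic_on open_strip" for n
    using G by (simp add: uniformly_holomorphic_def)
  fix n
  have "deriv (\<lambda>z. G z n) holomorphic_on open_strip" by (intro holomorphic_deriv hol open_open_strip)
  then show "(\<lambda>z. cderiv Sigma_space G z n) holomorphic_on open_strip"
    by (rule holomorphic_transform) (simp add: cderiv_eq[OF G])
next
  have hol: "(\<lambda>z. G z n) holomorphic_on open_strip" for n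
    using G by (simp add: uniformly_holomorphic_def)
  fix z assume "z \<in> open_strip"
  then obtain r B where r: "0 < r" "cball z r \<subseteq> open_strip"
    and B: "\<And>w n. w \<in> cball z r \<Longrightarrow> cmod (G w n) \<le> B"
    using G unfolding uniformly_holomorphic_def by blast
  have sub: "cball z (r/2) \<subseteq> open_strip" using r by (auto simp: subset_iff)
  have "cmod (cderiv Sigma_space G w n) \<le> B / (r/2)" if "w \<in> cball z (r/2)" for w n
    using higher_deriv_cball_bound[OF hol[of n] open_open_strip r(2,1) B that, where k = 1] that sub
    by (auto simp: cderiv_eq[OF G])
  then show "\<exists>r>0. \<exists>B. cball z r \<subseteq> open_strip \<and> (\<forall>w\<in>cball z r. \<forall>n. cmod (cderiv Sigma_space G w n) \<le> B)"
    using sub r(1) half_gt_zero by blast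
qed

text \<open>The two claims need each other in the induction: uniform holomorphy of the
  \<open>k\<close>-th derivative lets \<open>cderiv_eq\<close> evaluate the next one. Agreement on
  the open strip is enough, since a derivative depends only on values nearby.\<close>

lemma higher_cderiv:
  assumes G: "uniformly_holomorphic G"
  shows "uniformly_holomorphic ((cderiv Sigma_space ^^ k) G) \<and>
    (\<forall>z\<in>open_strip. \<forall>n. (cderiv Sigma_space ^^ k) G z n = (deriv ^^ k) (\<lambda>w. G w n) z)"
proof (induction k)
  case 0
  then show ?case using G by simp
next
  case (Suc k)
  then have u: "uniformly_holomorphic ((cderiv Sigma_space ^^ k) G)"
    and eq: "\<And>z n. z \<in> open_strip \<Longrightarrow> (cderiv Sigma_space ^^ k) G z n = (deriv ^^ k) (\<lambda>w. G w n) z"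
    by auto
  have "(cderiv Sigma_space ^^ Suc k) G z n = (deriv ^^ Suc k) (\<lambda>w. G w n) z"
    if z: "z \<in> open_strip" for z n
  proof -
    have "eventually (\<lambda>w. w \<in> open_strip) (nhds z)"
      by (rule eventually_nhds_in_open[OF open_open_strip z])
    then have "eventually (\<lambda>w. (cderiv Sigma_space ^^ k) G w n = (deriv ^^ k) (\<lambda>w. G w n) w) (nhds z)"
      by eventually_elim (rule eq)
    then have "deriv (\<lambda>w. (cderiv Sigma_space ^^ k) G w n) z = deriv ((deriv ^^ k) (\<lambda>w. G w n)) z"
      by (intro deriv_cong_ev) auto
    then show ?thesis using cderiv_eq[OF u z] by simp
  qed
  then show ?case using uniformly_holomorphic_cderiv[OF u] by simp
qed

section \<open>The Calderon space\<close>

text \<open>Differentiability in norm becomes holomorphy of the coordinates, the boundedness on the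
  strip supplying the uniformity. The value 0 outside the strip makes \<open>F w\<close> a point of
  the sum space for every \<open>w\<close>, so norms and bounds can be exchanged without side
  conditions.\<close>

lemma calderon_iff:
  "F \<in> calderon \<longleftrightarrow> (\<forall>z. z \<notin> strip \<longrightarrow> F z = 0) \<and>
    (\<exists>B. \<forall>z\<in>strip. seq_bounded singletons (F z) B) \<and>
    (\<forall>z\<in>strip. seq_tends singletons F (F z) (at z within strip)) \<and>
    (\<forall>n. (\<lambda>z. F z n) holomorphic_on open_strip) \<and>
    vanishing_line singletons (\<lambda>t. F (Complex 0 t)) \<and>
    vanishing_line (Collect finite) (\<lambda>t. F (Complex 1 t))" (is "_ \<longleftrightarrow> ?R")
proof
  assume F: "F \<in> calderon"
  have pts: "F w \<in> pts Sigma_space" for w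
  proof (cases "w \<in> strip")
    case False
    then have "F w = 0" using F by (simp add: calderon_def)
    then show ?thesis using linf.seq_bounded_zero[of 0] Sigma.mem_pts_iff by auto
  qed (use F in \<open>simp add: calderon_def\<close>)
  obtain B where B: "\<And>z. z \<in> strip \<Longrightarrow> nrm Sigma_space (F z) \<le> B"
    using F unfolding calderon_def by blast
  have "(\<lambda>z. F z n) holomorphic_on open_strip" for n
  proof -
    have "\<exists>D. ((\<lambda>w. F w n) has_field_derivative D) (at z)" if z: "z \<in> open_strip" for z
    proof -
      obtain D where "has_cderiv Sigma_space F D z" using F z by (auto simp: calderon_def)
      then show ?thesis using has_cderiv_coord[OF _ always_eventually] pts by blast
    qed
    then show ?thesis using open_open_strip by (simp add: holomorphic_on_open)
  qed
  moreover have "seq_tends singletons F (F z) (at z within strip)" if "z \<in> strip" for z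
  proof -
    have "tends Sigma_space F (F z) (at z within strip)" using F that by (simp add: calderon_def)
    then show ?thesis using Sigma.tends_iff[of F "at z within strip" "F z"] pts by simp
  qed
  moreover have "seq_bounded singletons (F z) B" if "z \<in> strip" for z
    using B[OF that] pts Sigma.nrm_le_iff by blast
  ultimately show ?R
    using F by (auto simp: calderon_def linf.C0_line_iff l1.C0_line_iff)
next
  assume R: ?R
  obtain B where B: "\<And>z. z \<in> strip \<Longrightarrow> seq_bounded singletons (F z) B" using R by blast
  have pts: "F w \<in> pts Sigma_space" for w
  proof (cases "w \<in> strip")
    case False
    then have "F w = 0" using R by simp
    then show ?thesis using linf.seq_bounded_zero[of 0] Sigma.mem_pts_iff by auto
  qed (use B Sigma.mem_pts_iff in blast)
  have "uniformly_holomorphic F"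
    unfolding uniformly_holomorphic_def
  proof (intro conjI ballI)
    show "\<forall>n. (\<lambda>z. F z n) holomorphic_on open_strip" using R by blast
    fix z assume "z \<in> open_strip"
    then obtain r where r: "0 < r" "cball z r \<subseteq> open_strip"
      using open_open_strip open_contains_cball by blast
    moreover have "cmod (F w n) \<le> B" if "w \<in> cball z r" for w n
      using B[of w] that r(2) open_strip_subset unfolding seq_bounded_singletons by blast
    ultimately show "\<exists>r>0. \<exists>B. cball z r \<subseteq> open_strip \<and> (\<forall>w\<in>cball z r. \<forall>n. cmod (F w n) \<le> B)"
      by blast
  qed
  then have "\<exists>D. has_cderiv Sigma_space F D z" if "z \<in> open_strip" for z
    using uniformly_holomorphic_has_cderiv that by blast
  moreover have "nrm Sigma_space (F z) \<le> B" if "z \<in> strip" for z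
    using B[OF that] pts Sigma.nrm_le_iff by blast
  moreover have "tends Sigma_space F (F z) (at z within strip)" if "z \<in> strip" for z
    using R that Sigma.tends_iff[of F "at z within strip" "F z"] pts by simp
  ultimately show "F \<in> calderon"
    using R pts unfolding calderon_def mem_Collect_eq linf.C0_line_iff l1.C0_line_iff
    by (intro conjI) blast+
qed

context
  fixes F assumes F: "F \<in> calderon"
begin

lemma calderon_coord_holomorphic: "(\<lambda>z. F z n) holomorphic_on open_strip"
  using F by (simp add: calderon_iff)

lemma calderon_coord_continuous: "continuous_on strip (\<lambda>z. F z n)"
  unfolding continuous_on using F linf.seq_tends_coord by (simp add: calderon_iff) blast

text \<open>The two suprema can be handled as least upper bounds because a continuous line that
  vanishes at infinity is bounded.\<close>

lemma calderon_norm_le_iff: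
  "calderon_norm F \<le> B \<longleftrightarrow> (\<forall>t. seq_bounded singletons (F (Complex 0 t)) B \<and>
     seq_bounded (Collect finite) (F (Complex 1 t)) B)"
proof -
  have pts: "F (Complex 0 t) \<in> pts linf" "F (Complex 1 t) \<in> pts l1" for t
    using F unfolding calderon_iff vanishing_line_def linf.mem_pts_iff l1.mem_pts_iff by blast+
  obtain B0 where B0: "\<And>t. seq_bounded singletons (F (Complex 0 t)) B0"
    using F linf.vanishing_line_bounded unfolding calderon_iff by blast
  obtain B1 where B1: "\<And>t. seq_bounded (Collect finite) (F (Complex 1 t)) B1"
    using F l1.vanishing_line_bounded unfolding calderon_iff by blast
  have "bdd_above (range (\<lambda>t. nrm linf (F (Complex 0 t))))"
    using B0 pts linf.nrm_le_iff by (intro bdd_aboveI2[where M = B0]) blast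
  moreover have "bdd_above (range (\<lambda>t. nrm l1 (F (Complex 1 t))))"
    using B1 pts l1.nrm_le_iff by (intro bdd_aboveI2[where M = B1]) blast
  ultimately show ?thesis
    using pts by (auto simp: calderon_norm_def cSUP_le_iff linf.nrm_le_iff l1.nrm_le_iff)
qed

lemma calderon_norm_bounds:
  "seq_bounded singletons (F (Complex 0 t)) (calderon_norm F)"
  "seq_bounded (Collect finite) (F (Complex 1 t)) (calderon_norm F)"
  using calderon_norm_le_iff[of "calderon_norm F"] by auto

lemma calderon_norm_nonneg: "0 \<le> calderon_norm F"
  using linf.seq_bounded_nonneg calderon_norm_bounds(1) by blast

text \<open>Each coordinate is dominated by the norm on either boundary line, so the maximum
  principle applies. The a priori bound \<open>B\<close> on the strip enters only as a growth
  condition.\<close>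

lemma calderon_coord_le:
  assumes "z \<in> strip"
  shows "cmod (F z n) \<le> calderon_norm F"
proof -
  obtain B where B: "\<And>z. z \<in> strip \<Longrightarrow> seq_bounded singletons (F z) B"
    using F unfolding calderon_iff by blast
  show ?thesis
    using calderon_norm_bounds
    by (intro strip_maximum_principle[OF calderon_coord_continuous calderon_coord_holomorphic _ _ _ assms, of _ B])
      (auto intro: linf.seq_bounded_coord l1.seq_bounded_coord B)
qed

lemma calderon_uniformly_holomorphic: "uniformly_holomorphic F"
  unfolding uniformly_holomorphic_def
proof (intro conjI ballI allI calderon_coord_holomorphic)
  fix z assume "z \<in> open_strip"
  then obtain r where "0 < r" "cball z r \<subseteq> open_strip"
    using open_open_strip open_contains_cball by blast
  then show "\<exists>r>0. \<exists>B. cball z r \<subseteq> open_strip \<and> (\<forall>w\<in>cball z r. \<forall>n. cmod (F w n) \<le> B)"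
    using calderon_coord_le open_strip_subset by blast
qed

lemma Delta_eq: "Delta k F n = (deriv ^^ k) (\<lambda>z. F z n) (1/2) / fact k"
  using higher_cderiv[OF calderon_uniformly_holomorphic, of k] half_mem_open_strip
  by (simp add: Delta_def scaleC_fun_def scaleC_complex_def)

text \<open>Cauchy's inequality on the disc of radius 1/4 about 1/2; this radius keeps the closed
  disc inside the open strip and produces the factor \<open>4 ^ k\<close>.\<close>

lemma Delta_coord_le: "cmod (Delta k F n) \<le> 4 ^ k * calderon_norm F"
proof -
  have sub: "cball (1/2) (1/4) \<subseteq> open_strip"
  proof
    fix z :: complex assume "z \<in> cball (1/2) (1/4)"
    then have "\<bar>Re (1/2 - z)\<bar> \<le> 1/4"
      using abs_Re_le_cmod[of "1/2 - z"] unfolding mem_cball dist_norm by linarith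
    then have "\<bar>1/2 - Re z\<bar> \<le> 1/4" by simp
    then have "0 < Re z" "Re z < 1" by linarith+
    then show "z \<in> open_strip" by (simp add: open_strip_def)
  qed
  have hol: "(\<lambda>z. F z n) holomorphic_on cball (1/2) (1/4)"
    using calderon_coord_holomorphic sub holomorphic_on_subset by blast
  have "cmod ((deriv ^^ k) (\<lambda>z. F z n) (1/2)) \<le> fact k * calderon_norm F / (1/4) ^ k"
  proof (rule Cauchy_inequality)
    show "(\<lambda>z. F z n) holomorphic_on ball (1/2) (1/4)" "continuous_on (cball (1/2) (1/4)) (\<lambda>z. F z n)"
      using hol holomorphic_on_subset ball_subset_cball holomorphic_on_imp_continuous_on by blast+
    show "cmod (F x n) \<le> calderon_norm F" if "cmod (1/2 - x) = 1/4" for x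
    proof -
      have "x \<in> cball (1/2) (1/4)" unfolding mem_cball dist_norm using that by simp
      then show ?thesis using sub open_strip_subset calderon_coord_le by blast
    qed
  qed simp
  then show ?thesis by (simp add: Delta_eq norm_divide field_simps power_divide)
qed

end

section \<open>Multipliers, linear structure and the coefficients\<close>

text \<open>A single operator covers scalar multiples, signed permutations of the coordinates, and
  damped tails. The case distinction restores the convention that functions are 0 off the
  strip.\<close>

definition weighted :: "(complex \<Rightarrow> complex) \<Rightarrow> (nat \<Rightarrow> complex) \<Rightarrow> (nat \<Rightarrow> nat) \<Rightarrow>
    (complex \<Rightarrow> cseq) \<Rightarrow> complex \<Rightarrow> cseq"
  where "weighted h m \<sigma> F = (\<lambda>z n. if z \<in> strip then h z * m n * F z (\<sigma> n) else 0)"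

lemma isCont_Complex: "isCont (\<lambda>t. Complex x t) t"
proof -
  have "Complex x = (\<lambda>t. of_real x + \<i> * of_real t)" by (simp add: fun_eq_iff Complex_eq)
  then show ?thesis by simp
qed

lemma weighted_mem:
  assumes F: "F \<in> calderon" and h: "h holomorphic_on UNIV" "\<And>z. z \<in> strip \<Longrightarrow> cmod (h z) \<le> H"
    and m: "\<And>n. cmod (m n) \<le> 1" and \<sigma>: "bij \<sigma>"
  shows "weighted h m \<sigma> F \<in> calderon"
proof -
  have cont: "isCont h z" for z
    using holomorphic_on_imp_continuous_on[OF h(1)] by (simp add: continuous_on_eq_continuous_at)
  have contC: "isCont (\<lambda>t. h (Complex x t)) t" for x t
    by (rule isCont_o2[OF isCont_Complex cont])
  have *: "\<And>t. weighted h m \<sigma> F (Complex 0 t) = (\<lambda>n. h (Complex 0 t) * m n * F (Complex 0 t) (\<sigma> n))"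
    "\<And>t. weighted h m \<sigma> F (Complex 1 t) = (\<lambda>n. h (Complex 1 t) * m n * F (Complex 1 t) (\<sigma> n))"
    by (simp_all add: weighted_def Complex_mem_strip)
  have bound: "cmod (h z * m n) \<le> H" if "z \<in> strip" for z n
    using mult_mono[OF h(2)[OF that] m[of n]] order_trans[OF norm_ge_zero h(2)[OF that]]
    by (simp add: norm_mult)
  show ?thesis
    unfolding calderon_iff *
  proof (intro conjI allI ballI impI)
    show "weighted h m \<sigma> F z = 0" if "z \<notin> strip" for z
      using that by (simp add: weighted_def fun_eq_iff)
    obtain B where B: "\<And>z. z \<in> strip \<Longrightarrow> seq_bounded singletons (F z) B"
      using F unfolding calderon_iff by blast
    show "\<exists>B. \<forall>z\<in>strip. seq_bounded singletons (weighted h m \<sigma> F z) B"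
    proof (intro exI ballI)
      fix z assume z: "z \<in> strip"
      show "seq_bounded singletons (weighted h m \<sigma> F z) (H * B)"
        using linf.seq_bounded_weighted[OF B[OF z] bound[OF z] \<sigma>] z by (simp add: weighted_def)
    qed
    show "seq_tends singletons (weighted h m \<sigma> F) (weighted h m \<sigma> F z) (at z within strip)"
      if z: "z \<in> strip" for z
    proof -
      have "seq_tends singletons (\<lambda>w n. h w * m n * F w (\<sigma> n)) (\<lambda>n. h z * m n * F z (\<sigma> n)) (at z within strip)"
      proof (rule linf.seq_tends_weighted[OF _ _ B[OF z] m \<sigma>])
        show "seq_tends singletons F (F z) (at z within strip)" using F z by (simp add: calderon_iff)
        show "(h \<longlongrightarrow> h z) (at z within strip)"
          using cont by (meson continuous_at_imp_continuous_at_within continuous_within)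
      qed
      moreover have "eventually (\<lambda>w. w \<in> strip) (at z within strip)"
        by (simp add: eventually_at_filter)
      ultimately show ?thesis
        unfolding seq_tends_def
      proof (intro allI impI)
        fix \<epsilon> :: real
        assume lim: "\<forall>\<epsilon>>0. eventually (\<lambda>w. seq_bounded singletons
            ((\<lambda>n. h w * m n * F w (\<sigma> n)) - (\<lambda>n. h z * m n * F z (\<sigma> n))) \<epsilon>) (at z within strip)"
          and ev: "eventually (\<lambda>w. w \<in> strip) (at z within strip)" and "0 < \<epsilon>"
        from lim \<open>0 < \<epsilon>\<close> have "eventually (\<lambda>w. seq_bounded singletons
            ((\<lambda>n. h w * m n * F w (\<sigma> n)) - (\<lambda>n. h z * m n * F z (\<sigma> n))) \<epsilon>) (at z within strip)"
          by blast
        with ev show "eventually (\<lambda>w. seq_bounded singletons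
            (weighted h m \<sigma> F w - weighted h m \<sigma> F z) \<epsilon>) (at z within strip)"
          by eventually_elim (use z in \<open>simp add: weighted_def\<close>)
      qed
    qed
    show "(\<lambda>z. weighted h m \<sigma> F z n) holomorphic_on open_strip" for n
    proof -
      have "(\<lambda>z. h z * m n * F z (\<sigma> n)) holomorphic_on open_strip"
        by (intro holomorphic_intros calderon_coord_holomorphic[OF F] holomorphic_on_subset[OF h(1)]) auto
      then show ?thesis
        by (rule holomorphic_transform) (use open_strip_subset in \<open>auto simp: weighted_def\<close>)
    qed
    show "vanishing_line singletons (\<lambda>t n. h (Complex 0 t) * m n * F (Complex 0 t) (\<sigma> n))"
      using F h(2) Complex_mem_strip
      by (intro linf.vanishing_line_weighted[OF _ contC _ m \<sigma>]) (auto simp: calderon_iff)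
    show "vanishing_line (Collect finite) (\<lambda>t n. h (Complex 1 t) * m n * F (Complex 1 t) (\<sigma> n))"
      using F h(2) Complex_mem_strip
      by (intro l1.vanishing_line_weighted[OF _ contC _ m \<sigma>]) (auto simp: calderon_iff)
  qed
qed

text \<open>In the Leibniz formula only the term with no derivative on \<open>h\<close> survives, as
  the Taylor coefficients of \<open>h\<close> at 1/2 of orders 1 to \<open>k\<close> vanish.\<close>

lemma Delta_weighted:
  assumes F: "F \<in> calderon" and W: "weighted h m \<sigma> F \<in> calderon" and h: "h holomorphic_on UNIV"
    and jet: "\<And>i. i \<le> k \<Longrightarrow> (deriv ^^ i) h (1/2) = (if i = 0 then c else 0)"
  shows "Delta k (weighted h m \<sigma> F) n = c * m n * Delta k F (\<sigma> n)"
proof -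
  have f: "(\<lambda>z. m n * F z (\<sigma> n)) holomorphic_on open_strip"
    by (intro holomorphic_intros calderon_coord_holomorphic[OF F])
  have h': "h holomorphic_on open_strip" using h holomorphic_on_subset by blast
  have "(deriv ^^ k) (\<lambda>z. weighted h m \<sigma> F z n) (1/2) = (deriv ^^ k) (\<lambda>z. h z * (m n * F z (\<sigma> n))) (1/2)"
    by (rule higher_deriv_transform_within_open[OF calderon_coord_holomorphic[OF W]
          holomorphic_on_mult[OF h' f] open_open_strip half_mem_open_strip])
      (use open_strip_subset in \<open>auto simp: weighted_def\<close>)
  also have "\<dots> = (\<Sum>i=0..k. of_nat (k choose i) * (deriv ^^ i) h (1/2) * (deriv ^^ (k - i)) (\<lambda>z. m n * F z (\<sigma> n)) (1/2))"
    by (rule higher_deriv_mult[OF h' f open_open_strip half_mem_open_strip])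
  also have "\<dots> = (\<Sum>i=0..k. if i = 0 then c * (deriv ^^ k) (\<lambda>z. m n * F z (\<sigma> n)) (1/2) else 0)"
    by (intro sum.cong) (auto simp: jet)
  also have "\<dots> = c * (deriv ^^ k) (\<lambda>z. m n * F z (\<sigma> n)) (1/2)"
    by simp
  also have "(deriv ^^ k) (\<lambda>z. m n * F z (\<sigma> n)) (1/2) = m n * (deriv ^^ k) (\<lambda>z. F z (\<sigma> n)) (1/2)"
    by (rule higher_deriv_cmult[OF calderon_coord_holomorphic[OF F] half_mem_open_strip open_open_strip])
  finally show ?thesis by (simp add: Delta_eq[OF W] Delta_eq[OF F])
qed

lemma calderon_add:
  assumes F: "F \<in> calderon" and G: "G \<in> calderon"
  shows "F + G \<in> calderon"
proof -
  have eq: "F + G = (\<lambda>z. F z + G z)" by (simp add: fun_eq_iff)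
  obtain B C where BC: "\<And>z. z \<in> strip \<Longrightarrow> seq_bounded singletons (F z) B"
    "\<And>z. z \<in> strip \<Longrightarrow> seq_bounded singletons (G z) C"
    using F G unfolding calderon_iff by metis
  have "(\<lambda>z. F z n + G z n) holomorphic_on open_strip" for n
    by (intro holomorphic_intros calderon_coord_holomorphic F G)
  then show ?thesis
    unfolding calderon_iff eq
    using F G linf.seq_bounded_add[OF BC]
    by (auto simp: calderon_iff intro: linf.seq_tends_add linf.vanishing_line_add l1.vanishing_line_add)
qed

lemma Delta_add:
  assumes F: "F \<in> calderon" and G: "G \<in> calderon"
  shows "Delta k (F + G) = Delta k F + Delta k G"
proof
  fix n
  have "(deriv ^^ k) (\<lambda>z. F z n + G z n) (1/2) = (deriv ^^ k) (\<lambda>z. F z n) (1/2) + (deriv ^^ k) (\<lambda>z. G z n) (1/2)"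
    by (rule higher_deriv_add[OF calderon_coord_holomorphic[OF F] calderon_coord_holomorphic[OF G]
          open_open_strip half_mem_open_strip])
  then show "Delta k (F + G) n = (Delta k F + Delta k G) n"
    by (simp add: Delta_eq[OF F] Delta_eq[OF G] Delta_eq[OF calderon_add[OF F G]] add_divide_distrib)
qed

lemma calderon_norm_add:
  assumes F: "F \<in> calderon" and G: "G \<in> calderon"
  shows "calderon_norm (F + G) \<le> calderon_norm F + calderon_norm G"
  unfolding calderon_norm_le_iff[OF calderon_add[OF F G]] plus_fun_apply[of F G]
  by (intro allI conjI linf.seq_bounded_add l1.seq_bounded_add calderon_norm_bounds F G)

lemma scaleC_eq_weighted:
  assumes "F \<in> calderon"
  shows "a *\<^sub>C F = weighted (\<lambda>_. a) (\<lambda>_. 1) id F"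
proof -
  have "F z = 0" if "z \<notin> strip" for z using assms that by (simp add: calderon_iff)
  then show ?thesis
    by (auto simp: weighted_def scaleC_fun_def scaleC_complex_def fun_eq_iff)
qed

lemma weighted_const_mem:
  assumes "F \<in> calderon" "\<And>n. cmod (m n) \<le> 1" "bij \<sigma>"
  shows "weighted (\<lambda>_. a) m \<sigma> F \<in> calderon"
  by (rule weighted_mem[OF assms(1) _ order_refl]) (use assms in auto)

lemma Delta_weighted_const:
  assumes "F \<in> calderon" "\<And>n. cmod (m n) \<le> 1" "bij \<sigma>"
  shows "Delta k (weighted (\<lambda>_. a) m \<sigma> F) n = a * m n * Delta k F (\<sigma> n)"
  by (rule Delta_weighted[OF assms(1) weighted_const_mem[OF assms]]) auto

lemma calderon_scaleC:
  assumes "F \<in> calderon"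
  shows "a *\<^sub>C F \<in> calderon"
  unfolding scaleC_eq_weighted[OF assms] using assms by (intro weighted_const_mem) auto

lemma Delta_scaleC:
  assumes "F \<in> calderon"
  shows "Delta k (a *\<^sub>C F) = a *\<^sub>C Delta k F"
  unfolding scaleC_eq_weighted[OF assms]
  using Delta_weighted_const[OF assms, of "\<lambda>_. 1" id k a]
  by (simp add: fun_eq_iff scaleC_fun_def scaleC_complex_def)

lemma calderon_norm_weighted_const:
  assumes F: "F \<in> calderon" and m: "\<And>n. cmod (m n) \<le> 1" and \<sigma>: "bij \<sigma>"
  shows "calderon_norm (weighted (\<lambda>_. a) m \<sigma> F) \<le> cmod a * calderon_norm F"
proof -
  have b: "cmod (a * m n) \<le> cmod a" for n
    using mult_left_mono[OF m[of n], of "cmod a"] by (simp add: norm_mult)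
  show ?thesis
    unfolding calderon_norm_le_iff[OF weighted_const_mem[OF assms]]
    using linf.seq_bounded_weighted[OF calderon_norm_bounds(1)[OF F] b \<sigma>]
      l1.seq_bounded_weighted[OF calderon_norm_bounds(2)[OF F] b \<sigma>]
    by (simp add: weighted_def Complex_mem_strip)
qed

lemma calderon_norm_scaleC:
  assumes F: "F \<in> calderon"
  shows "calderon_norm (a *\<^sub>C F) = cmod a * calderon_norm F"
proof (rule antisym)
  have le: "calderon_norm (b *\<^sub>C G) \<le> cmod b * calderon_norm G" if "G \<in> calderon" for b G
    unfolding scaleC_eq_weighted[OF that] using that by (intro calderon_norm_weighted_const) auto
  then show "calderon_norm (a *\<^sub>C F) \<le> cmod a * calderon_norm F" using F by blast
  show "cmod a * calderon_norm F \<le> calderon_norm (a *\<^sub>C F)"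
  proof (cases "a = 0")
    case True
    then show ?thesis using calderon_norm_nonneg[OF calderon_scaleC[OF F]] by simp
  next
    case False
    have "calderon_norm (inverse a *\<^sub>C a *\<^sub>C F) \<le> cmod (inverse a) * calderon_norm (a *\<^sub>C F)"
      by (intro le calderon_scaleC F)
    then have "calderon_norm F \<le> calderon_norm (a *\<^sub>C F) / cmod a"
      using False by (simp add: scaleC_scaleC scaleC_one norm_inverse divide_inverse mult.commute)
    then show ?thesis using False by (simp add: field_simps)
  qed
qed

section \<open>The Calderon space as a Banach space\<close>

interpretation cvec: vector_space "scaleC :: complex \<Rightarrow> 'a \<Rightarrow> 'a::complex_vector"
  by (rule vector_space_scaleC)

lemma subspace_calderon: "csubspace calderon"
proof (rule cvec.subspaceI)
  show "0 \<in> calderon"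
    by (auto simp: calderon_iff vanishing_line_def seq_tends_def seq_bounded_def
        intro!: exI[of _ 0] holomorphic_on_const)
qed (auto intro: calderon_add calderon_scaleC)

lemmas calderon_diff = cvec.subspace_diff[OF subspace_calderon]

text \<open>The maximum principle turns a Cauchy sequence in norm into a pointwise Cauchy sequence
  on the strip. Lower semicontinuity transfers the Cauchy estimates to the pointwise limit, and each
  defining condition survives uniform limits.\<close>

lemma calderon_complete:
  assumes s: "\<And>k. s k \<in> calderon"
    and Cauchy: "\<And>\<epsilon>. 0 < \<epsilon> \<Longrightarrow> \<exists>M. \<forall>i\<ge>M. \<forall>j\<ge>M. calderon_norm (s i - s j) < \<epsilon>"
  shows "\<exists>F\<in>calderon. (\<lambda>k. calderon_norm (s k - F)) \<longlonglongrightarrow> 0"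
proof -
  have d: "s i - s j \<in> calderon" for i j using s by (intro calderon_diff)
  define F where "F = (\<lambda>z n. lim (\<lambda>k. s k z n))"
  have lim: "(\<lambda>k. s k z n) \<longlonglongrightarrow> F z n" for z n
  proof (cases "z \<in> strip")
    case True
    have "Cauchy (\<lambda>k. s k z n)"
      unfolding Cauchy_def
    proof (intro allI impI)
      fix \<epsilon> :: real assume "0 < \<epsilon>"
      then obtain M where M: "\<And>i j. M \<le> i \<Longrightarrow> M \<le> j \<Longrightarrow> calderon_norm (s i - s j) < \<epsilon>"
        using Cauchy by blast
      have "dist (s i z n) (s j z n) < \<epsilon>" if "M \<le> i" "M \<le> j" for i j
        using calderon_coord_le[OF d[of i j] True, of n] M[OF that] by (simp add: dist_norm)
      then show "\<exists>M. \<forall>m\<ge>M. \<forall>k\<ge>M. dist (s m z n) (s k z n) < \<epsilon>" by blast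
    qed
    then have "convergent (\<lambda>k. s k z n)" by (rule Cauchy_convergent)
    then show ?thesis by (simp add: F_def convergent_LIMSEQ_iff)
  next
    case False
    then have "s k z n = 0" for k using s by (simp add: calderon_iff)
    then show ?thesis by (simp add: F_def)
  qed
  \<comment> \<open>The estimate on the whole strip already contains the one on the left line. The
    right line needs its own, in the stronger \<open>l1\<close> norm.\<close>
  have near: "\<exists>M. \<forall>k\<ge>M. (\<forall>z\<in>strip. seq_bounded singletons (s k z - F z) \<epsilon>) \<and>
      (\<forall>t. seq_bounded (Collect finite) (s k (Complex 1 t) - F (Complex 1 t)) \<epsilon>)" if e: "0 < \<epsilon>" for \<epsilon>
  proof -
    obtain M where M: "\<And>i j. M \<le> i \<Longrightarrow> M \<le> j \<Longrightarrow> calderon_norm (s i - s j) < \<epsilon>"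
      using Cauchy[OF e] by blast
    have limd: "(\<lambda>j. (s k z - s j z) n) \<longlonglongrightarrow> (s k z - F z) n" for k z n
      by (auto intro!: tendsto_intros lim)
    show ?thesis
    proof (intro exI allI impI conjI ballI)
      fix k assume k: "M \<le> k"
      show "seq_bounded singletons (s k z - F z) \<epsilon>" if z: "z \<in> strip" for z
      proof (rule linf.seq_bounded_lim[OF limd])
        show "eventually (\<lambda>j. seq_bounded singletons (s k z - s j z) \<epsilon>) sequentially"
          using eventually_ge_at_top[of M]
        proof eventually_elim
          case (elim j)
          have "cmod ((s k z - s j z) n) \<le> \<epsilon>" for n
            using calderon_coord_le[OF d[of k j] z, of n] M[OF k elim] by simp
          then show ?case by (simp add: seq_bounded_singletons)
        qed
      qed
      show "seq_bounded (Collect finite) (s k (Complex 1 t) - F (Complex 1 t)) \<epsilon>" for t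
      proof (rule l1.seq_bounded_lim[OF limd])
        show "eventually (\<lambda>j. seq_bounded (Collect finite) (s k (Complex 1 t) - s j (Complex 1 t)) \<epsilon>) sequentially"
          using eventually_ge_at_top[of M]
        proof eventually_elim
          case (elim j)
          then show ?case
            using l1.seq_bounded_mono[OF calderon_norm_bounds(2)[OF d[of k j], of t]] M[OF k elim] by simp
        qed
      qed
    qed
  qed
  have F: "F \<in> calderon"
    unfolding calderon_iff
  proof (intro conjI allI ballI impI)
    show "F z = 0" if "z \<notin> strip" for z
    proof
      fix n
      have "s k z n = 0" for k using s that by (simp add: calderon_iff)
      then show "F z n = 0 n" by (simp add: F_def)
    qed
    obtain k where k: "\<And>z. z \<in> strip \<Longrightarrow> seq_bounded singletons (s k z - F z) 1"
      using near[OF zero_less_one] by blast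
    obtain B where B: "\<And>z. z \<in> strip \<Longrightarrow> seq_bounded singletons (s k z) B"
      using s[of k] unfolding calderon_iff by blast
    have "seq_bounded singletons (F z) (B + 1)" if "z \<in> strip" for z
      using linf.seq_bounded_diff[OF B[OF that] k[OF that]] by simp
    then show "\<exists>B. \<forall>z\<in>strip. seq_bounded singletons (F z) B" by blast
    show "seq_tends singletons F (F z) (at z within strip)" if z: "z \<in> strip" for z
    proof (rule linf.seq_tends_uniform_limit[of s])
      show "seq_tends singletons (s k) (s k z) (at z within strip)" for k
        using s z by (simp add: calderon_iff)
      show "\<exists>k. seq_bounded singletons (s k z - F z) \<epsilon> \<and>
          eventually (\<lambda>w. seq_bounded singletons (s k w - F w) \<epsilon>) (at z within strip)" if e: "0 < \<epsilon>" for \<epsilon>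
      proof -
        obtain k where "\<forall>z\<in>strip. seq_bounded singletons (s k z - F z) \<epsilon>" using near[OF e] by blast
        then show ?thesis using z by (intro exI[of _ k]) (simp add: eventually_at_filter)
      qed
    qed
    show "(\<lambda>z. F z n) holomorphic_on open_strip" for n
    proof (rule holomorphic_uniform_sequence[OF open_open_strip calderon_coord_holomorphic[OF s]])
      fix x assume "x \<in> open_strip"
      then obtain r where r: "0 < r" "cball x r \<subseteq> open_strip"
        using open_open_strip open_contains_cball by blast
      have "uniform_limit (cball x r) (\<lambda>k z. s k z n) (\<lambda>z. F z n) sequentially"
        unfolding uniform_limit_iff
      proof (intro allI impI)
        fix \<epsilon> :: real assume "0 < \<epsilon>"
        then obtain M where M: "\<And>k z. M \<le> k \<Longrightarrow> z \<in> strip \<Longrightarrow> seq_bounded singletons (s k z - F z) (\<epsilon>/2)"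
          using near[of "\<epsilon>/2"] by auto
        have "dist (s k z n) (F z n) < \<epsilon>" if "M \<le> k" "z \<in> cball x r" for k z
          using linf.seq_bounded_coord[OF M[OF that(1)], of z n] that(2) r(2) open_strip_subset \<open>0 < \<epsilon>\<close>
          by (force simp: dist_norm)
        then show "eventually (\<lambda>k. \<forall>z\<in>cball x r. dist (s k z n) (F z n) < \<epsilon>) sequentially"
          unfolding eventually_sequentially by blast
      qed
      then show "\<exists>d>0. cball x d \<subseteq> open_strip \<and> uniform_limit (cball x d) (\<lambda>k z. s k z n) (\<lambda>z. F z n) sequentially"
        using r by blast
    qed
    show "vanishing_line singletons (\<lambda>t. F (Complex 0 t))"
    proof (rule linf.vanishing_line_uniform_limit)
      show "vanishing_line singletons (\<lambda>t. s k (Complex 0 t))" for k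
        using s by (simp add: calderon_iff)
      show "\<exists>k. \<forall>t. seq_bounded singletons (s k (Complex 0 t) - F (Complex 0 t)) \<epsilon>" if "0 < \<epsilon>" for \<epsilon>
        using near[OF that] Complex_mem_strip(1) by blast
    qed
    show "vanishing_line (Collect finite) (\<lambda>t. F (Complex 1 t))"
    proof (rule l1.vanishing_line_uniform_limit)
      show "vanishing_line (Collect finite) (\<lambda>t. s k (Complex 1 t))" for k
        using s by (simp add: calderon_iff)
      show "\<exists>k. \<forall>t. seq_bounded (Collect finite) (s k (Complex 1 t) - F (Complex 1 t)) \<epsilon>" if "0 < \<epsilon>" for \<epsilon>
        using near[OF that] by blast
    qed
  qed
  have dF: "s k - F \<in> calderon" for k using s F by (intro calderon_diff)
  have "(\<lambda>k. calderon_norm (s k - F)) \<longlonglongrightarrow> 0"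
  proof (rule tendstoI)
    fix \<epsilon> :: real assume "0 < \<epsilon>"
    then obtain M where M: "\<And>k z. M \<le> k \<Longrightarrow> z \<in> strip \<Longrightarrow> seq_bounded singletons (s k z - F z) (\<epsilon>/2)"
        "\<And>k t. M \<le> k \<Longrightarrow> seq_bounded (Collect finite) (s k (Complex 1 t) - F (Complex 1 t)) (\<epsilon>/2)"
      using near[of "\<epsilon>/2"] by auto
    have "calderon_norm (s k - F) \<le> \<epsilon>/2" if "M \<le> k" for k
      unfolding calderon_norm_le_iff[OF dF] using M[OF that] Complex_mem_strip by (simp add: fun_diff_def)
    then have "dist (calderon_norm (s k - F)) 0 < \<epsilon>" if "M \<le> k" for k
      using that calderon_norm_nonneg[OF dF, of k] \<open>0 < \<epsilon>\<close> by fastforce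
    then show "eventually (\<lambda>k. dist (calderon_norm (s k - F)) 0 < \<epsilon>) sequentially"
      unfolding eventually_sequentially by blast
  qed
  then show ?thesis using F by blast
qed

text \<open>Definiteness comes from the maximum principle: zero boundary values force the function
  to vanish on the strip.\<close>

lemma calderon_norm_eq_0_iff:
  assumes F: "F \<in> calderon"
  shows "calderon_norm F = 0 \<longleftrightarrow> F = 0"
proof
  assume "calderon_norm F = 0"
  then have "F z n = 0" for z n
    using calderon_coord_le[OF F, of z n] F by (cases "z \<in> strip") (auto simp: calderon_iff)
  then show "F = 0" by (simp add: fun_eq_iff)
next
  assume "F = 0"
  then show "calderon_norm F = 0" using calderon_norm_scaleC[OF F, of 0] by simp
qed

section \<open>The damping factor and small tails\<close>

lemma higher_deriv_012:
  fixes f f' f'' :: "complex \<Rightarrow> complex"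
  assumes "\<And>z. (f has_field_derivative f' z) (at z)" "\<And>z. (f' has_field_derivative f'' z) (at z)"
    and "k \<le> 2"
  shows "(deriv ^^ k) f z = (if k = 0 then f z else if k = 1 then f' z else f'' z)"
proof -
  have "deriv f = f'" "deriv f' = f''" using assms(1,2) by (auto simp: fun_eq_iff intro: DERIV_imp_deriv)
  moreover have "k = 0 \<or> k = 1 \<or> k = 2" using assms(3) by auto
  ultimately show ?thesis by (auto simp: numeral_2_eq_2)
qed

definition damping :: "real \<Rightarrow> complex \<Rightarrow> complex"
  where "damping L z = 1 - (1 - exp (of_real L * (z - 1/2))) ^ 3"

lemma damping_holomorphic: "damping L holomorphic_on UNIV"
  unfolding damping_def by (intro holomorphic_intros)

lemma damping_jet:
  assumes "k \<le> 2"
  shows "(deriv ^^ k) (damping L) (1/2) = (if k = 0 then 1 else 0)"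
proof -
  define u where "u = (\<lambda>z::complex. exp (of_real L * (z - 1/2)))"
  have u: "(u has_field_derivative of_real L * u z) (at z)" for z
    unfolding u_def by (auto intro!: derivative_eq_intros)
  have 1: "(damping L has_field_derivative 3 * (1 - u z)\<^sup>2 * (of_real L * u z)) (at z)" for z
    unfolding damping_def u_def[symmetric]
    by (rule derivative_eq_intros u refl)+ (simp add: u_def)
  have 2: "((\<lambda>z. 3 * (1 - u z)\<^sup>2 * (of_real L * u z)) has_field_derivative
      3 * (1 - u z) * (of_real L)\<^sup>2 * u z * (1 - 3 * u z)) (at z)" for z
    by (rule derivative_eq_intros u refl)+ (simp add: power2_eq_square algebra_simps)
  \<comment> \<open>Both derivatives contain the factor \<open>1 - u z\<close>, which vanishes at
    1/2.\<close>
  have "u (1/2) = 1" by (simp add: u_def)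
  moreover have "damping L (1/2) = 1" by (simp add: damping_def)
  ultimately show ?thesis using higher_deriv_012[OF 1 2 assms, of "1/2"] by simp
qed

text \<open>Expanding the cube leaves no constant term, so the damping factor becomes small together
  with the exponential.\<close>

lemma damping_bound:
  assumes u: "cmod (exp (of_real L * (z - 1/2))) \<le> r"
  shows "cmod (damping L z) \<le> 3 * r + 3 * r\<^sup>2 + r ^ 3"
proof -
  define v where "v = exp (of_real L * (z - 1/2))"
  have "damping L z = 3 * v - 3 * v\<^sup>2 + v ^ 3"
    unfolding damping_def v_def[symmetric] by (simp add: power3_eq_cube power2_eq_square algebra_simps)
  then have "cmod (damping L z) \<le> cmod (3 * v) + cmod (3 * v\<^sup>2) + cmod (v ^ 3)"
    using norm_triangle_ineq[of "3 * v - 3 * v\<^sup>2" "v ^ 3"] norm_triangle_ineq4[of "3 * v" "3 * v\<^sup>2"] by simp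
  also have "\<dots> = 3 * cmod v + 3 * (cmod v)\<^sup>2 + cmod v ^ 3" by (simp add: norm_mult norm_power)
  also have "\<dots> \<le> 3 * r + 3 * r\<^sup>2 + r ^ 3"
    using u by (intro add_mono mult_left_mono power_mono) (auto simp: v_def)
  finally show ?thesis .
qed

text \<open>On the left line the exponential has modulus \<open>exp (- L/2)\<close>, at most 1, so
  its linear power dominates the others and 7 = 3 + 3 + 1.\<close>

lemma damping_left: "0 \<le> L \<Longrightarrow> cmod (damping L (Complex 0 t)) \<le> 7 * exp (- L/2)"
proof -
  assume L: "0 \<le> L"
  define q where "q = exp (- L/2)"
  have q: "0 \<le> q" "q \<le> 1" using L by (auto simp: q_def)
  have "cmod (damping L (Complex 0 t)) \<le> 3 * q + 3 * q\<^sup>2 + q ^ 3"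
    by (rule damping_bound) (simp add: q_def)
  moreover have "q\<^sup>2 \<le> q" "q ^ 3 \<le> q"
    using q power_decreasing[of 1 2 q] power_decreasing[of 1 3 q] by simp_all
  ultimately show ?thesis unfolding q_def by linarith
qed

text \<open>Here the modulus of the exponential is at most \<open>exp (L/2)\<close>, which is at
  least 1, so now the cube dominates. The size of this bound is harmless, since it is fixed before
  the cutoff.\<close>

lemma damping_strip: "0 \<le> L \<Longrightarrow> z \<in> strip \<Longrightarrow> cmod (damping L z) \<le> 7 * exp (L/2) ^ 3"
proof -
  assume L: "0 \<le> L" and z: "z \<in> strip"
  define p where "p = exp (L/2)"
  have p: "1 \<le> p" using L by (auto simp: p_def)
  have "L * (Re z - 1/2) \<le> L * (1/2)" using L z by (intro mult_left_mono) (auto simp: strip_def)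
  then have "cmod (damping L z) \<le> 3 * p + 3 * p\<^sup>2 + p ^ 3"
    by (intro damping_bound) (simp add: p_def)
  moreover have "p \<le> p ^ 3" "p\<^sup>2 \<le> p ^ 3"
    using p power_increasing[of 1 3 p] power_increasing[of 2 3 p] by simp_all
  ultimately show ?thesis unfolding p_def by linarith
qed

lemma calderon_small_tail:
  assumes F: "F \<in> calderon" and e: "0 < \<epsilon>"
  shows "\<exists>N. \<forall>n\<ge>N. \<exists>G\<in>calderon. (\<forall>k\<le>2. \<forall>i. Delta k G i = cutoff n i * Delta k F i) \<and>
    calderon_norm G \<le> \<epsilon>"
proof -
  define M where "M = calderon_norm F + 1"
  have M: "0 < M" "calderon_norm F \<le> M" using calderon_norm_nonneg[OF F] by (auto simp: M_def)
  \<comment> \<open>This makes \<open>exp (- L/2)\<close> at most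
    \<open>\<epsilon> / (7 * M)\<close>. The absolute value keeps \<open>L\<close> nonnegative when
    \<epsilon> exceeds \<open>7 * M\<close>.\<close>
  define L where "L = 2 * \<bar>ln (\<epsilon> / (7 * M))\<bar>"
  have L: "0 \<le> L" by (simp add: L_def)
  have "exp (- L/2) \<le> exp (ln (\<epsilon> / (7 * M)))" by (simp add: L_def)
  also have "\<dots> = \<epsilon> / (7 * M)" using e M by simp
  finally have q: "7 * exp (- L/2) * M \<le> \<epsilon>" using M by (simp add: field_simps)
  define H where "H = 7 * exp (L/2) ^ 3"
  have H: "0 < H" by (simp add: H_def)
  \<comment> \<open>Dividing by \<open>H\<close> reserves room for the growth of the damping factor
    on the right line.\<close>
  obtain N where N: "\<And>n t. N \<le> n \<Longrightarrow>
      seq_bounded (Collect finite) (\<lambda>i. cutoff n i * F (Complex 1 t) i) (\<epsilon> / H)"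
    using vanishing_line_cutoff[of "\<lambda>t. F (Complex 1 t)" "\<epsilon> / H"] F e H
    by (auto simp: calderon_iff)
  have "\<exists>G\<in>calderon. (\<forall>k\<le>2. \<forall>i. Delta k G i = cutoff n i * Delta k F i) \<and> calderon_norm G \<le> \<epsilon>"
    if n: "N \<le> n" for n
  proof (intro bexI conjI allI impI)
    define G where "G = weighted (damping L) (cutoff n) id F"
    show G: "G \<in> calderon"
      unfolding G_def using damping_strip[OF L] norm_cutoff_le
      by (intro weighted_mem F damping_holomorphic bij_id)
    show "Delta k G i = cutoff n i * Delta k F i" if "k \<le> 2" for k i
      using Delta_weighted[OF F G[unfolded G_def] damping_holomorphic, of k 1 i] damping_jet that
      by (simp add: G_def)
    show "calderon_norm G \<le> \<epsilon>"
      unfolding calderon_norm_le_iff[OF G]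
    proof (intro allI conjI)
      fix t
      have "cmod (damping L (Complex 0 t) * cutoff n i) \<le> 7 * exp (- L/2)" for i
        using damping_left[OF L, of t] by (simp add: cutoff_def)
      then have "seq_bounded singletons (\<lambda>i. damping L (Complex 0 t) * cutoff n i * F (Complex 0 t) (id i))
          (7 * exp (- L/2) * calderon_norm F)"
        by (intro linf.seq_bounded_weighted calderon_norm_bounds F bij_id)
      then have "seq_bounded singletons (G (Complex 0 t)) (7 * exp (- L/2) * calderon_norm F)"
        by (simp add: G_def weighted_def Complex_mem_strip)
      moreover have "7 * exp (- L/2) * calderon_norm F \<le> \<epsilon>"
        using mult_left_mono[OF M(2), of "7 * exp (- L/2)"] by (intro order_trans[OF _ q]) simp
      ultimately show "seq_bounded singletons (G (Complex 0 t)) \<epsilon>" by (rule linf.seq_bounded_mono)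
      have "seq_bounded (Collect finite) (\<lambda>i. damping L (Complex 1 t) * (cutoff n i * F (Complex 1 t) i)) (H * (\<epsilon> / H))"
        using damping_strip[OF L Complex_mem_strip(2)]
        by (intro l1.seq_bounded_scale N n) (simp add: H_def)
      then show "seq_bounded (Collect finite) (G (Complex 1 t)) \<epsilon>"
        using H by (simp add: G_def weighted_def Complex_mem_strip mult.assoc)
    qed
  qed
  then show ?thesis by blast
qed

section \<open>Explicit functions with prescribed coefficients\<close>

text \<open>Since \<open>exp (w\<^sup>2) = 1 + w\<^sup>2 + \<dots>\<close>, the coefficients at \<open>w = z - 1/2 = 0\<close> are \<open>\<alpha>\<close>, \<open>\<beta>\<close>, \<open>\<gamma>\<close>.\<close>

definition gauss_poly :: "complex \<Rightarrow> complex \<Rightarrow> complex \<Rightarrow> complex \<Rightarrow> complex"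
  where "gauss_poly \<alpha> \<beta> \<gamma> z = (\<alpha> + \<beta> * (z - 1/2) + (\<gamma> - \<alpha>) * (z - 1/2)\<^sup>2) * exp ((z - 1/2)\<^sup>2)"

lemma gauss_poly_jet:
  assumes "k \<le> 2"
  shows "(deriv ^^ k) (gauss_poly \<alpha> \<beta> \<gamma>) (1/2) / fact k = (if k = 0 then \<alpha> else if k = 1 then \<beta> else \<gamma>)"
proof -
  define g where "g = (\<lambda>z::complex. exp ((z - 1/2)\<^sup>2))"
  define p where "p = (\<lambda>z. \<alpha> + \<beta> * (z - 1/2) + (\<gamma> - \<alpha>) * (z - 1/2)\<^sup>2)"
  define p' where "p' = (\<lambda>z::complex. \<beta> + 2 * (\<gamma> - \<alpha>) * (z - 1/2))"
  have gp: "gauss_poly \<alpha> \<beta> \<gamma> = (\<lambda>z. p z * g z)"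
    by (simp add: fun_eq_iff gauss_poly_def p_def g_def)
  have g: "(g has_field_derivative 2 * (z - 1/2) * g z) (at z)" for z
    unfolding g_def by (auto intro!: derivative_eq_intros)
  have p: "(p has_field_derivative p' z) (at z)" for z
    unfolding p_def p'_def by (auto intro!: derivative_eq_intros simp: power2_eq_square algebra_simps)
  have p': "(p' has_field_derivative 2 * (\<gamma> - \<alpha>)) (at z)" for z
    unfolding p'_def by (auto intro!: derivative_eq_intros)
  have 1: "(gauss_poly \<alpha> \<beta> \<gamma> has_field_derivative (p' z + p z * (2 * (z - 1/2))) * g z) (at z)" for z
    unfolding gp by (rule derivative_eq_intros p g refl)+ (simp add: algebra_simps)
  have 2: "((\<lambda>z. (p' z + p z * (2 * (z - 1/2))) * g z) has_field_derivative
      (2 * (\<gamma> - \<alpha>) + p' z * (2 * (z - 1/2)) + p z * 2) * g z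
      + (p' z + p z * (2 * (z - 1/2))) * (2 * (z - 1/2) * g z)) (at z)" for z
    by (rule derivative_eq_intros p p' g refl)+ (simp add: algebra_simps)
  have "k = 0 \<or> k = 1 \<or> k = 2" using assms by auto
  then show ?thesis
    using higher_deriv_012[OF 1 2 assms, of "1/2"]
    by (auto simp: p_def p'_def g_def gauss_poly_def)
qed

text \<open>With \<open>y = \<bar>Im z\<bar>\<close> the polynomial is at most a constant times
  \<open>exp (2 * y)\<close> and the Gaussian at most \<open>exp (1 - y\<^sup>2)\<close>. The stated
  exponent then follows from \<open>(y - 2)\<^sup>2\<close> being nonnegative.\<close>

lemma gauss_poly_decay:
  "\<exists>C. \<forall>z\<in>strip. cmod (gauss_poly \<alpha> \<beta> \<gamma> z) \<le> C * exp (5 - 2 * \<bar>Im z\<bar>)"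
proof (intro exI ballI)
  fix z assume z: "z \<in> strip"
  define w where "w = z - 1/2"
  define y where "y = \<bar>Im z\<bar>"
  define C where "C = cmod \<alpha> + cmod \<beta> + cmod (\<gamma> - \<alpha>)"
  have y: "0 \<le> y" by (simp add: y_def)
  have w: "\<bar>Re w\<bar> \<le> 1" "Im w = Im z" using z by (auto simp: w_def strip_def)
  have "cmod w \<le> 1 + y" using cmod_le[of w] w by (simp add: y_def)
  moreover have "1 + y \<le> (1 + y)\<^sup>2" using y by (simp add: power2_eq_square)
  ultimately have w2: "cmod w \<le> (1 + y)\<^sup>2" "(cmod w)\<^sup>2 \<le> (1 + y)\<^sup>2" "1 \<le> (1 + y)\<^sup>2"
    using y power_mono[of "cmod w" "1 + y" 2] by auto
  have "cmod (\<alpha> + \<beta> * w + (\<gamma> - \<alpha>) * w\<^sup>2) \<le> cmod \<alpha> * 1 + cmod \<beta> * cmod w + cmod (\<gamma> - \<alpha>) * (cmod w)\<^sup>2"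
    using norm_triangle_ineq[of "\<alpha> + \<beta> * w" "(\<gamma> - \<alpha>) * w\<^sup>2"] norm_triangle_ineq[of \<alpha> "\<beta> * w"]
    by (simp add: norm_mult norm_power)
  also have "\<dots> \<le> cmod \<alpha> * (1 + y)\<^sup>2 + cmod \<beta> * (1 + y)\<^sup>2 + cmod (\<gamma> - \<alpha>) * (1 + y)\<^sup>2"
    by (intro add_mono mult_left_mono w2) auto
  also have "\<dots> = C * (1 + y)\<^sup>2" by (simp add: C_def algebra_simps)
  also have "\<dots> \<le> C * (exp y)\<^sup>2"
    using exp_ge_add_one_self[of y] y by (intro mult_left_mono power_mono) (auto simp: C_def)
  finally have p: "cmod (\<alpha> + \<beta> * w + (\<gamma> - \<alpha>) * w\<^sup>2) \<le> C * (exp y)\<^sup>2" .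
  have "(Re w)\<^sup>2 \<le> 1" using w(1) by (simp add: abs_square_le_1)
  then have "Re (w\<^sup>2) \<le> 1 - y\<^sup>2" by (simp add: w(2) y_def power2_eq_square)
  then have "cmod (exp (w\<^sup>2)) \<le> exp (1 - y\<^sup>2)" by simp
  then have "cmod (gauss_poly \<alpha> \<beta> \<gamma> z) \<le> C * (exp y)\<^sup>2 * exp (1 - y\<^sup>2)"
    unfolding gauss_poly_def w_def[symmetric] norm_mult using p
    by (intro mult_mono) (auto simp: C_def)
  also have "\<dots> = C * exp (2 * y + (1 - y\<^sup>2))"
    by (simp only: exp_add exp_double mult.assoc)
  also have "\<dots> \<le> C * exp (5 - 2 * y)"
  proof -
    have "0 \<le> (y - 2)\<^sup>2" by simp
    then have "2 * y + (1 - y\<^sup>2) \<le> 5 - 2 * y" by (simp add: power2_eq_square algebra_simps)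
    then show ?thesis by (intro mult_left_mono) (auto simp: C_def)
  qed
  finally show "cmod (gauss_poly \<alpha> \<beta> \<gamma> z)
      \<le> (cmod \<alpha> + cmod \<beta> + cmod (\<gamma> - \<alpha>)) * exp (5 - 2 * \<bar>Im z\<bar>)"
    by (simp add: C_def y_def)
qed

text \<open>This realises any three coefficients at a single position \<open>q\<close>. A polynomial
  alone would not tend to 0 along the boundary lines; the Gaussian factor provides the
  decay.\<close>

definition unit_lift :: "complex \<Rightarrow> complex \<Rightarrow> complex \<Rightarrow> nat \<Rightarrow> complex \<Rightarrow> cseq"
  where "unit_lift \<alpha> \<beta> \<gamma> q = (\<lambda>z n. if z \<in> strip then gauss_poly \<alpha> \<beta> \<gamma> z * unit_vec q n else 0)"

lemma unit_lift_mem: "unit_lift \<alpha> \<beta> \<gamma> q \<in> calderon"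
proof -
  let ?g = "gauss_poly \<alpha> \<beta> \<gamma>"
  obtain C where C: "\<And>z. z \<in> strip \<Longrightarrow> cmod (?g z) \<le> C * exp (5 - 2 * \<bar>Im z\<bar>)"
    using gauss_poly_decay by blast
  have "0 \<in> strip" by (simp add: strip_def)
  from order_trans[OF norm_ge_zero C[OF this]] have C0: "0 \<le> C" by (simp add: zero_le_mult_iff)
  have hol: "?g holomorphic_on A" for A unfolding gauss_poly_def by (intro holomorphic_intros)
  have cont: "isCont ?g z" for z
    using holomorphic_on_imp_continuous_on[OF hol[of UNIV]] by (simp add: continuous_on_eq_continuous_at)
  have bot: "filterlim (\<lambda>x::real. 5 - 2 * x) at_bot at_top"
    unfolding filterlim_at_bot eventually_at_top_linorder
  proof
    fix Z :: real
    show "\<exists>N. \<forall>x\<ge>N. 5 - 2 * x \<le> Z" by (intro exI[of _ "(5 - Z)/2"]) (simp add: field_simps)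
  qed
  have "((\<lambda>t. C * exp (5 - 2 * norm t)) \<longlongrightarrow> C * 0) (at_infinity :: real filter)"
    by (intro tendsto_mult tendsto_const filterlim_compose[OF exp_at_bot] filterlim_compose[OF bot]
        filterlim_norm_at_top)
  then have zero: "((\<lambda>t. C * exp (5 - 2 * \<bar>t\<bar>)) \<longlongrightarrow> 0) (at_infinity :: real filter)" by simp
  have line: "((\<lambda>t. ?g (Complex x t)) \<longlongrightarrow> 0) at_infinity" "isCont (\<lambda>t. ?g (Complex x t)) t"
    if "x = 0 \<or> x = 1" for x t
  proof -
    have "cmod (?g (Complex x s)) \<le> C * exp (5 - 2 * \<bar>s\<bar>)" for s
      using C[of "Complex x s"] that by (auto simp: strip_def)
    then show "((\<lambda>t. ?g (Complex x t)) \<longlongrightarrow> 0) at_infinity"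
      by (intro Lim_null_comparison[OF _ zero] always_eventually allI)
    show "isCont (\<lambda>t. ?g (Complex x t)) t"
      by (rule isCont_o2[OF isCont_Complex cont])
  qed
  have *: "\<And>t. unit_lift \<alpha> \<beta> \<gamma> q (Complex 0 t) = (\<lambda>n. ?g (Complex 0 t) * unit_vec q n)"
    "\<And>t. unit_lift \<alpha> \<beta> \<gamma> q (Complex 1 t) = (\<lambda>n. ?g (Complex 1 t) * unit_vec q n)"
    by (simp_all add: unit_lift_def Complex_mem_strip)
  show ?thesis
    unfolding calderon_iff *
  proof (intro conjI allI impI ballI)
    show "unit_lift \<alpha> \<beta> \<gamma> q z = 0" if "z \<notin> strip" for z
      using that by (simp add: unit_lift_def fun_eq_iff)
    show "\<exists>B. \<forall>z\<in>strip. seq_bounded singletons (unit_lift \<alpha> \<beta> \<gamma> q z) B"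
    proof (intro exI ballI)
      fix z assume z: "z \<in> strip"
      have "cmod (?g z) \<le> C * exp (5 - 2 * \<bar>Im z\<bar>)" by (rule C[OF z])
      also have "\<dots> \<le> C * exp 5" using C0 by (intro mult_left_mono) auto
      finally show "seq_bounded singletons (unit_lift \<alpha> \<beta> \<gamma> q z) (C * exp 5 * 1)"
        using linf.seq_bounded_scale[OF linf.seq_bounded_unit_vec] z by (simp add: unit_lift_def)
    qed
    show "seq_tends singletons (unit_lift \<alpha> \<beta> \<gamma> q) (unit_lift \<alpha> \<beta> \<gamma> q z) (at z within strip)"
      if z: "z \<in> strip" for z
      unfolding seq_tends_def
    proof (intro allI impI)
      fix \<epsilon> :: real assume "0 < \<epsilon>"
      have "(?g \<longlongrightarrow> ?g z) (at z within strip)"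
        using cont by (meson continuous_at_imp_continuous_at_within continuous_within)
      then have "seq_tends singletons (\<lambda>w n. ?g w * unit_vec q n) (\<lambda>n. ?g z * unit_vec q n) (at z within strip)"
        by (rule linf.seq_tends_scalar[OF _ linf.seq_bounded_unit_vec])
      with \<open>0 < \<epsilon>\<close> have "eventually (\<lambda>w. seq_bounded singletons
          ((\<lambda>n. ?g w * unit_vec q n) - (\<lambda>n. ?g z * unit_vec q n)) \<epsilon>) (at z within strip)"
        unfolding seq_tends_def by blast
      moreover have "eventually (\<lambda>w. w \<in> strip) (at z within strip)"
        by (simp add: eventually_at_filter)
      ultimately show "eventually (\<lambda>w. seq_bounded singletons
          (unit_lift \<alpha> \<beta> \<gamma> q w - unit_lift \<alpha> \<beta> \<gamma> q z) \<epsilon>) (at z within strip)"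
        by eventually_elim (use z in \<open>simp add: unit_lift_def\<close>)
    qed
    show "(\<lambda>z. unit_lift \<alpha> \<beta> \<gamma> q z n) holomorphic_on open_strip" for n
    proof -
      have "(\<lambda>z. ?g z * unit_vec q n) holomorphic_on open_strip"
        by (intro holomorphic_intros hol)
      then show ?thesis
        by (rule holomorphic_transform) (use open_strip_subset in \<open>auto simp: unit_lift_def\<close>)
    qed
    show "vanishing_line singletons (\<lambda>t n. ?g (Complex 0 t) * unit_vec q n)"
      by (rule linf.vanishing_line_scalar[OF _ _ linf.seq_bounded_unit_vec]) (use line in auto)
    show "vanishing_line (Collect finite) (\<lambda>t n. ?g (Complex 1 t) * unit_vec q n)"
      by (rule l1.vanishing_line_scalar[OF _ _ l1.seq_bounded_unit_vec]) (use line in auto)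
  qed
qed

lemma Delta_unit_lift:
  assumes "k \<le> 2"
  shows "Delta k (unit_lift \<alpha> \<beta> \<gamma> q) n =
    (if k = 0 then \<alpha> else if k = 1 then \<beta> else \<gamma>) * unit_vec q n"
proof -
  let ?g = "gauss_poly \<alpha> \<beta> \<gamma>"
  have hol: "?g holomorphic_on open_strip" unfolding gauss_poly_def by (intro holomorphic_intros)
  have "(deriv ^^ k) (\<lambda>z. unit_lift \<alpha> \<beta> \<gamma> q z n) (1/2) = (deriv ^^ k) (\<lambda>z. unit_vec q n * ?g z) (1/2)"
    by (rule higher_deriv_transform_within_open[OF calderon_coord_holomorphic[OF unit_lift_mem]
          holomorphic_on_mult[OF holomorphic_on_const hol] open_open_strip half_mem_open_strip])
      (use open_strip_subset in \<open>auto simp: unit_lift_def\<close>)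
  also have "\<dots> = unit_vec q n * (deriv ^^ k) ?g (1/2)"
    by (rule higher_deriv_cmult[OF hol half_mem_open_strip open_open_strip])
  finally have "Delta k (unit_lift \<alpha> \<beta> \<gamma> q) n = unit_vec q n * ((deriv ^^ k) ?g (1/2) / fact k)"
    unfolding Delta_eq[OF unit_lift_mem] by simp
  then show ?thesis by (simp only: gauss_poly_jet[OF assms] mult.commute)
qed

section \<open>Quotient norms\<close>

text \<open>The target carries no norm beforehand, so continuity of \<open>T\<close> cannot be
  assumed. Closedness of the kernel takes its place: it is what makes the quotient seminorm
  definite.\<close>

locale quotient_setting =
  fixes K :: "'u::complex_vector set" and N :: "'u \<Rightarrow> real" and T :: "'u \<Rightarrow> 'v::complex_vector"
  assumes banach: "banach_space \<lparr>pts = K, nrm = N\<rparr>"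
    and T_add: "F \<in> K \<Longrightarrow> G \<in> K \<Longrightarrow> T (F + G) = T F + T G"
    and T_scale: "F \<in> K \<Longrightarrow> T (a *\<^sub>C F) = a *\<^sub>C T F"
    and closed_kernel: "(\<And>n::nat. s n \<in> K \<and> T (s n) = 0) \<Longrightarrow> F \<in> K \<Longrightarrow>
      (\<lambda>n. N (s n - F)) \<longlonglongrightarrow> 0 \<Longrightarrow> T F = 0"
begin

definition qnorm :: "'v \<Rightarrow> real"
  where "qnorm x = Inf {N F | F. F \<in> K \<and> T F = x}"

lemma subspace_K: "csubspace K" and N_nonneg: "F \<in> K \<Longrightarrow> 0 \<le> N F"
  and N_scale: "F \<in> K \<Longrightarrow> N (a *\<^sub>C F) = cmod a * N F"
  and N_add: "F \<in> K \<Longrightarrow> G \<in> K \<Longrightarrow> N (F + G) \<le> N F + N G"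
  using banach by (auto simp: banach_space_def)

lemma N_complete:
  assumes "\<And>n::nat. s n \<in> K" "\<And>\<epsilon>. 0 < \<epsilon> \<Longrightarrow> \<exists>M. \<forall>m\<ge>M. \<forall>n\<ge>M. N (s m - s n) < \<epsilon>"
  shows "\<exists>F\<in>K. (\<lambda>n. N (s n - F)) \<longlonglongrightarrow> 0"
  using banach assms by (auto simp: banach_space_def tends_def)

lemma K_add: "F \<in> K \<Longrightarrow> G \<in> K \<Longrightarrow> F + G \<in> K"
  and K_scale: "F \<in> K \<Longrightarrow> a *\<^sub>C F \<in> K"
  and K_diff: "F \<in> K \<Longrightarrow> G \<in> K \<Longrightarrow> F - G \<in> K"
  and K_zero: "0 \<in> K"
  using subspace_K by (simp_all add: cvec.subspace_add cvec.subspace_scale cvec.subspace_diff cvec.subspace_0)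

lemma T_zero: "T 0 = 0" and N_zero: "N 0 = 0"
  using T_scale[OF K_zero, of 0] N_scale[OF K_zero, of 0] by simp_all

lemma T_diff: "F \<in> K \<Longrightarrow> G \<in> K \<Longrightarrow> T (F - G) = T F - T G"
  using T_add[of "F - G" G] K_diff[of F G] by simp

lemma N_sum: "(\<And>i. i \<in> A \<Longrightarrow> H i \<in> K) \<Longrightarrow> sum H A \<in> K \<and> N (sum H A) \<le> (\<Sum>i\<in>A. N (H i))"
proof (induction A rule: infinite_finite_induct)
  case (insert i A)
  then have "sum H A \<in> K" "N (sum H A) \<le> (\<Sum>i\<in>A. N (H i))" "H i \<in> K" by auto
  then show ?case using insert(1,2) N_add[of "H i" "sum H A"] K_add by auto
qed (auto simp: K_zero N_zero)

lemma qnorm_bdd_below: "bdd_below {N F | F. F \<in> K \<and> T F = x}"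
  using N_nonneg by (auto intro!: bdd_belowI[of _ 0])

lemma qnorm_le: "F \<in> K \<Longrightarrow> qnorm (T F) \<le> N F"
  unfolding qnorm_def by (rule cInf_lower[OF _ qnorm_bdd_below]) blast

lemma qnorm_lift: "x \<in> T ` K \<Longrightarrow> qnorm x < B \<Longrightarrow> \<exists>F\<in>K. T F = x \<and> N F < B"
  unfolding qnorm_def by (subst (asm) cInf_less_iff[OF _ qnorm_bdd_below]) auto

lemma qnorm_greatest: "x \<in> T ` K \<Longrightarrow> (\<And>F. F \<in> K \<Longrightarrow> T F = x \<Longrightarrow> B \<le> N F) \<Longrightarrow> B \<le> qnorm x"
  unfolding qnorm_def by (rule cInf_greatest) auto

lemma qnorm_nonneg: "x \<in> T ` K \<Longrightarrow> 0 \<le> qnorm x"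
  by (intro qnorm_greatest N_nonneg)

lemma subspace_image: "csubspace (T ` K)"
proof (rule cvec.subspaceI)
  show "0 \<in> T ` K" using T_zero K_zero by force
  show "x + y \<in> T ` K" if "x \<in> T ` K" "y \<in> T ` K" for x y
    using that T_add K_add by (metis (no_types, opaque_lifting) imageE imageI)
  show "a *\<^sub>C x \<in> T ` K" if "x \<in> T ` K" for a x
    using that T_scale K_scale by (metis (no_types, opaque_lifting) imageE imageI)
qed

text \<open>If lifts \<open>F n\<close> of \<open>x\<close> tend to 0, then the differences
  \<open>F 0 - F n\<close> lie in the kernel and tend to \<open>F 0\<close>. Closedness of the
  kernel gives \<open>T (F 0) = 0\<close>.\<close>

lemma qnorm_eq_0_iff:
  assumes x: "x \<in> T ` K"
  shows "qnorm x = 0 \<longleftrightarrow> x = 0"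
proof
  assume "qnorm x = 0"
  then have "\<exists>F\<in>K. T F = x \<and> N F < inverse (real (Suc n))" for n
    using qnorm_lift[OF x, of "inverse (real (Suc n))"] by simp
  then obtain F where F: "\<And>n. F n \<in> K" "\<And>n. T (F n) = x" "\<And>n. N (F n) < inverse (real (Suc n))"
    by metis
  have "T (F 0) = 0"
  proof (rule closed_kernel)
    show "F 0 - F n \<in> K \<and> T (F 0 - F n) = 0" for n
      using F by (simp add: K_diff T_diff)
    have "N (F 0 - F n - F 0) = N (F n)" for n
      using N_scale[OF F(1)[of n], of "-1"] by simp
    moreover have "(\<lambda>n. N (F n)) \<longlonglongrightarrow> 0"
      by (rule tendsto_sandwich[OF _ _ tendsto_const LIMSEQ_inverse_real_of_nat])
        (use N_nonneg[OF F(1)] less_imp_le[OF F(3)] in \<open>auto intro!: always_eventually simp del: of_nat_Suc\<close>)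
    ultimately show "(\<lambda>n. N (F 0 - F n - F 0)) \<longlonglongrightarrow> 0" by simp
  qed (rule F)
  then show "x = 0" using F by simp
next
  assume "x = 0"
  then show "qnorm x = 0" using qnorm_le[OF K_zero] qnorm_nonneg[OF x] by (simp add: T_zero N_zero)
qed

text \<open>For nonzero scalars one inequality is enough: applied to \<open>a\<close> and to its
  inverse it yields both directions.\<close>

lemma qnorm_scale:
  assumes x: "x \<in> T ` K"
  shows "qnorm (a *\<^sub>C x) = cmod a * qnorm x"
proof (cases "a = 0")
  case True
  then show ?thesis using qnorm_eq_0_iff cvec.subspace_0[OF subspace_image] by simp
next
  case False
  have le: "cmod b * qnorm y \<le> qnorm (b *\<^sub>C y)" if y: "y \<in> T ` K" and b: "b \<noteq> 0" for y b
  proof (rule qnorm_greatest)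
    show "b *\<^sub>C y \<in> T ` K" using y by (rule cvec.subspace_scale[OF subspace_image])
    fix F assume F: "F \<in> K" "T F = b *\<^sub>C y"
    then have "T (inverse b *\<^sub>C F) = y" using b by (simp add: T_scale)
    then have "qnorm y \<le> N (inverse b *\<^sub>C F)" using qnorm_le[OF K_scale[OF F(1)]] by metis
    then have "qnorm y \<le> N F / cmod b" using F(1) by (simp add: N_scale norm_inverse divide_inverse mult.commute)
    then show "cmod b * qnorm y \<le> N F" using b by (simp add: field_simps)
  qed
  have "cmod (inverse a) * qnorm (a *\<^sub>C x) \<le> qnorm (inverse a *\<^sub>C a *\<^sub>C x)"
    using x False by (intro le cvec.subspace_scale[OF subspace_image]) auto
  then have "qnorm (a *\<^sub>C x) / cmod a \<le> qnorm x"
    using False by (simp add: norm_inverse divide_inverse mult.commute)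
  then have "qnorm (a *\<^sub>C x) \<le> cmod a * qnorm x"
    using False by (simp add: field_simps)
  then show ?thesis using le[OF x False] by simp
qed

lemma qnorm_add:
  assumes x: "x \<in> T ` K" and y: "y \<in> T ` K"
  shows "qnorm (x + y) \<le> qnorm x + qnorm y"
proof (rule field_le_epsilon)
  fix \<epsilon> :: real assume "0 < \<epsilon>"
  then obtain F G where "F \<in> K" "T F = x" "N F < qnorm x + \<epsilon>/2" "G \<in> K" "T G = y" "N G < qnorm y + \<epsilon>/2"
    using qnorm_lift[OF x, of "qnorm x + \<epsilon>/2"] qnorm_lift[OF y, of "qnorm y + \<epsilon>/2"] by auto
  then show "qnorm (x + y) \<le> qnorm x + qnorm y + \<epsilon>"
    using qnorm_le[OF K_add, of F G] T_add[of F G] N_add[of F G] by simp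
qed

text \<open>Along a subsequence with geometrically small gaps the increments have lifts of summable
  norm; the sum of these lifts converges in \<open>K\<close>, and its image is the limit.\<close>

lemma qnorm_complete:
  assumes s: "\<And>n::nat. s n \<in> T ` K"
    and Cauchy: "\<And>\<epsilon>. 0 < \<epsilon> \<Longrightarrow> \<exists>M. \<forall>m\<ge>M. \<forall>n\<ge>M. qnorm (s m - s n) < \<epsilon>"
  shows "\<exists>x\<in>T ` K. (\<lambda>n. qnorm (s n - x)) \<longlonglongrightarrow> 0"
proof -
  have "\<exists>M. \<forall>m\<ge>M. \<forall>n\<ge>M. qnorm (s m - s n) < (1/2) ^ i" for i :: nat by (rule Cauchy) simp
  then obtain M where M: "\<And>i m n. M i \<le> m \<Longrightarrow> M i \<le> n \<Longrightarrow> qnorm (s m - s n) < (1/2) ^ i"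
    by metis
  \<comment> \<open>Sums of the thresholds are nondecreasing and dominate \<open>M\<close>, so
    \<open>r i\<close> and \<open>r (Suc i)\<close> both lie beyond \<open>M i\<close>.\<close>
  define r where "r = (\<lambda>i. \<Sum>l\<le>i. M l)"
  have r: "M i \<le> r i" "r i \<le> r (Suc i)" for i
    using member_le_sum[of i "{..i}" M] by (auto simp: r_def)
  have diff: "x - y \<in> T ` K" if "x \<in> T ` K" "y \<in> T ` K" for x y
    using that by (rule cvec.subspace_diff[OF subspace_image])
  have "\<exists>H\<in>K. T H = s (r (Suc i)) - s (r i) \<and> N H < (1/2) ^ i" for i
    by (rule qnorm_lift[OF diff[OF s s] M]) (use r order_trans in blast)+
  then obtain H where H: "\<And>i. H i \<in> K" "\<And>i. T (H i) = s (r (Suc i)) - s (r i)" "\<And>i. N (H i) < (1/2) ^ i"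
    by metis
  obtain F0 where F0: "F0 \<in> K" "T F0 = s (r 0)" using s[of "r 0"] by (metis imageE)
  define F where "F = (\<lambda>i. F0 + (\<Sum>l<i. H l))"
  have FK: "F i \<in> K" for i using N_sum[of "{..<i}" H] H(1) F0 by (auto simp: F_def intro: K_add)
  have TF: "T (F i) = s (r i)" for i
  proof (induction i)
    case (Suc i)
    have "F (Suc i) = F i + H i" by (simp add: F_def add.assoc)
    then show ?case using Suc H(1,2) FK by (simp add: T_add)
  qed (use F0 in \<open>simp add: F_def\<close>)
  have tail: "N (F j - F i) \<le> 2 * (1/2) ^ i" if "i \<le> j" for i j
  proof -
    have eq: "F j - F i = (\<Sum>l\<in>{i..<j}. H l)"
      using that sum.atLeastLessThan_concat[of 0 i j H] by (simp add: F_def lessThan_atLeast0 algebra_simps)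
    have "N (F j - F i) \<le> (\<Sum>l\<in>{i..<j}. N (H l))" using N_sum[of "{i..<j}" H] H(1) by (simp add: eq)
    also have "\<dots> \<le> (\<Sum>l\<in>{i..<j}. (1/2) ^ l)" using H(3) by (intro sum_mono less_imp_le)
    also have "\<dots> \<le> 2 * (1/2) ^ i"
    proof -
      have "(\<Sum>l\<in>{i..<j}. (1/2::real) ^ l) = 2 * (1/2) ^ i - 2 * (1/2) ^ j"
        using that by (induction j rule: dec_induct) auto
      then show ?thesis by simp
    qed
    finally show ?thesis .
  qed
  have FC: "\<exists>M. \<forall>m\<ge>M. \<forall>n\<ge>M. N (F m - F n) < \<epsilon>" if e: "0 < \<epsilon>" for \<epsilon>
  proof -
    obtain p :: nat where p: "(1/2) ^ p < \<epsilon>/2" using e real_arch_pow_inv[of "\<epsilon>/2" "1/2"] by auto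
    have sym: "N (F m - F n) = N (F n - F m)" for m n
      using N_scale[OF K_diff[OF FK FK], of "-1" n m] by simp
    have small: "2 * (1/2::real) ^ i < \<epsilon>" if "p \<le> i" for i
    proof -
      have "(1/2::real) ^ i \<le> (1/2) ^ p" using that by (intro power_decreasing) auto
      then show ?thesis using p by linarith
    qed
    have "N (F m - F n) < \<epsilon>" if "p \<le> m" "p \<le> n" for m n
    proof (cases "m \<le> n")
      case True
      then show ?thesis using tail[OF True] small[OF that(1)] sym[of m n] by linarith
    next
      case False
      then show ?thesis using tail[of n m] small[OF that(2)] by linarith
    qed
    then show ?thesis by blast
  qed
  obtain G where G: "G \<in> K" "(\<lambda>n. N (F n - G)) \<longlonglongrightarrow> 0"
    using N_complete[of F] FK FC by blast
  \<comment> \<open>Only the subsequence was lifted. The other terms follow from the Cauchy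
    property, by comparing \<open>s n\<close> with \<open>s (r i)\<close> for one suitable
    \<open>i\<close>.\<close>
  have "(\<lambda>n. qnorm (s n - T G)) \<longlonglongrightarrow> 0"
  proof (rule tendstoI)
    fix \<epsilon> :: real assume e: "0 < \<epsilon>"
    obtain p :: nat where p: "(1/2) ^ p < \<epsilon>/2" using e real_arch_pow_inv[of "\<epsilon>/2" "1/2"] by auto
    have "eventually (\<lambda>i. N (F i - G) < \<epsilon>/2 \<and> p \<le> i) sequentially"
      using order_tendstoD(2)[OF G(2), of "\<epsilon>/2"] e
      by (intro eventually_conj eventually_ge_at_top) auto
    then obtain i where i: "N (F i - G) < \<epsilon>/2" "p \<le> i" by (auto simp: eventually_sequentially)
    have "qnorm (s n - T G) < \<epsilon>" if n: "M i \<le> n" for n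
    proof -
      have "qnorm (s n - s (r i)) < (1/2) ^ i" using n r(1) by (intro M)
      also have "\<dots> \<le> (1/2) ^ p" using i(2) by (intro power_decreasing) auto
      finally have 1: "qnorm (s n - s (r i)) < \<epsilon>/2" using p by simp
      have 2: "qnorm (s (r i) - T G) < \<epsilon>/2"
        using qnorm_le[OF K_diff[OF FK[of i] G(1)]] i(1) by (simp add: T_diff FK G TF)
      have "s n - T G = (s n - s (r i)) + (s (r i) - T G)" by simp
      then have "qnorm (s n - T G) \<le> qnorm (s n - s (r i)) + qnorm (s (r i) - T G)"
        using qnorm_add[OF diff[OF s s] diff[OF s]] G(1) by (metis imageI)
      then show ?thesis using 1 2 by simp
    qed
    then show "eventually (\<lambda>n. dist (qnorm (s n - T G)) 0 < \<epsilon>) sequentially"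
      unfolding eventually_sequentially
    proof (intro exI allI impI)
      fix n assume "M i \<le> n"
      moreover have "0 \<le> qnorm (s n - T G)" using s G(1) by (intro qnorm_nonneg diff) auto
      ultimately show "dist (qnorm (s n - T G)) 0 < \<epsilon>" using \<open>\<And>n. M i \<le> n \<Longrightarrow> qnorm (s n - T G) < \<epsilon>\<close> by simp
    qed
  qed
  then show ?thesis using G(1) by blast
qed

lemma banach_quotient: "banach_space \<lparr>pts = T ` K, nrm = qnorm\<rparr>"
  unfolding banach_space_def tends_def nspace.simps
  using subspace_image qnorm_nonneg qnorm_eq_0_iff qnorm_scale qnorm_add qnorm_complete
  by (intro conjI ballI allI impI) blast+

end

section \<open>Kernels of the coefficient maps\<close>

lemma Delta_coord_le_16:
  assumes "F \<in> calderon" "k \<le> 2"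
  shows "cmod (Delta k F n) \<le> 16 * calderon_norm F"
proof -
  have "(4::real) ^ k \<le> 4 ^ 2" using assms(2) by (intro power_increasing) auto
  then have "4 ^ k * calderon_norm F \<le> 16 * calderon_norm F"
    using calderon_norm_nonneg[OF assms(1)] by (intro mult_right_mono) auto
  then show ?thesis using Delta_coord_le[OF assms(1), of k n] by linarith
qed

text \<open>\<open>J\<close> collects the orders whose coefficients must vanish, so the whole space,
  a kernel and an intersection of two kernels become one family.\<close>

definition calderon_kernel :: "nat set \<Rightarrow> (complex \<Rightarrow> cseq) set"
  where "calderon_kernel J = {F \<in> calderon. \<forall>i\<in>J. Delta i F = 0}"

lemma Delta_limit:
  assumes s: "\<And>n. s n \<in> calderon" and F: "F \<in> calderon" and k: "k \<le> 2"
    and lim: "(\<lambda>n. calderon_norm (s n - F)) \<longlonglongrightarrow> 0"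
  shows "(\<lambda>n. Delta k (s n) i) \<longlonglongrightarrow> Delta k F i"
proof -
  have "Delta k (s n) = Delta k (s n - F) + Delta k F" for n
    using Delta_add[OF calderon_diff[OF s F] F] by simp
  then have bound: "cmod (Delta k (s n) i - Delta k F i) \<le> 16 * calderon_norm (s n - F)" for n
    using Delta_coord_le_16[OF calderon_diff[OF s F] k, of n i] by simp
  have "(\<lambda>n. Delta k (s n) i - Delta k F i) \<longlonglongrightarrow> 0"
    by (rule Lim_null_comparison[OF always_eventually[OF allI[OF bound]] tendsto_mult_right_zero[OF lim]])
  then show ?thesis by (simp add: LIM_zero_iff)
qed

lemma subspace_calderon_kernel: "csubspace (calderon_kernel J)"
proof (rule cvec.subspaceI)
  have "Delta i 0 = 0" for i
    using Delta_scaleC[OF cvec.subspace_0[OF subspace_calderon], of i 0] by simp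
  then show "0 \<in> calderon_kernel J"
    using cvec.subspace_0[OF subspace_calderon] by (simp add: calderon_kernel_def)
qed (auto simp: calderon_kernel_def calderon_add calderon_scaleC Delta_add Delta_scaleC)

lemma banach_calderon_kernel:
  assumes J: "J \<subseteq> {..2}"
  shows "banach_space \<lparr>pts = calderon_kernel J, nrm = calderon_norm\<rparr>"
proof -
  have "\<exists>F\<in>calderon_kernel J. (\<lambda>n. calderon_norm (s n - F)) \<longlonglongrightarrow> 0"
    if s: "\<forall>n. s n \<in> calderon_kernel J" and Cauchy: "\<forall>\<epsilon>>0. \<exists>M. \<forall>m\<ge>M. \<forall>n\<ge>M. calderon_norm (s m - s n) < \<epsilon>"
    for s :: "nat \<Rightarrow> complex \<Rightarrow> cseq"
  proof -
    have sc: "s n \<in> calderon" for n using s by (simp add: calderon_kernel_def)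
    then obtain F where F: "F \<in> calderon" "(\<lambda>n. calderon_norm (s n - F)) \<longlonglongrightarrow> 0"
      using calderon_complete[of s] Cauchy by blast
    have "Delta i F = 0" if i: "i \<in> J" for i
    proof
      fix l
      have "i \<le> 2" using i J by auto
      have "(\<lambda>n. Delta i (s n) l) \<longlonglongrightarrow> Delta i F l" by (rule Delta_limit[OF sc F(1) \<open>i \<le> 2\<close> F(2)])
      moreover have "Delta i (s n) l = 0" for n using s i by (simp add: calderon_kernel_def)
      ultimately show "Delta i F l = 0 l" by (simp add: LIMSEQ_const_iff)
    qed
    then show ?thesis using F by (auto simp: calderon_kernel_def)
  qed
  note complete = this
  have sub: "F \<in> calderon" if "F \<in> calderon_kernel J" for F
    using that by (simp add: calderon_kernel_def)
  show ?thesis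
    unfolding banach_space_def tends_def nspace.simps
  proof (intro conjI ballI allI impI)
    show "csubspace (calderon_kernel J)" by (rule subspace_calderon_kernel)
    show "\<exists>F\<in>calderon_kernel J. (\<lambda>n. calderon_norm (s n - F)) \<longlonglongrightarrow> 0"
      if "(\<forall>n. s n \<in> calderon_kernel J) \<and> (\<forall>\<epsilon>>0. \<exists>M. \<forall>m\<ge>M. \<forall>n\<ge>M. calderon_norm (s m - s n) < \<epsilon>)"
      for s :: "nat \<Rightarrow> complex \<Rightarrow> cseq"
      using that by (intro complete) auto
  qed (use sub calderon_norm_nonneg calderon_norm_eq_0_iff calderon_norm_scaleC calderon_norm_add in auto)
qed

section \<open>Jet spaces\<close>

lemma scaleC_cseq: "(a *\<^sub>C (x :: cseq)) n = a * x n"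
  by (simp add: scaleC_fun_def scaleC_complex_def)

text \<open>An abstract form of \<open>k\<close>-tuples of sequences, independent of how the product
  type is nested. Slot \<open>j\<close> records the coefficient of order \<open>\<iota> j\<close>.
  As \<iota> is injective with values outside \<open>J\<close>, each slot can be prescribed freely
  within the kernel.\<close>

locale jet_space =
  fixes k :: nat and coord :: "nat \<Rightarrow> nat \<Rightarrow> 'v::complex_vector \<Rightarrow> complex"
    and join :: "(nat \<Rightarrow> cseq) \<Rightarrow> 'v" and \<iota> :: "nat \<Rightarrow> nat" and J :: "nat set"
  assumes k_pos: "0 < k"
    and coord_add: "coord j n (x + y) = coord j n x + coord j n y"
    and coord_scaleC: "coord j n (a *\<^sub>C x) = a * coord j n x"
    and coord_join: "j < k \<Longrightarrow> coord j n (join u) = u j n"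
    and coord_ext: "(\<And>j n. j < k \<Longrightarrow> coord j n x = coord j n y) \<Longrightarrow> x = y"
    and inj_\<iota>: "inj_on \<iota> {..<k}" and \<iota>_le: "j < k \<Longrightarrow> \<iota> j \<le> 2"
    and J_le: "J \<subseteq> {..2}" and \<iota>_notin: "j < k \<Longrightarrow> \<iota> j \<notin> J"
begin

definition jet :: "(complex \<Rightarrow> cseq) \<Rightarrow> 'v"
  where "jet F = join (\<lambda>j. Delta (\<iota> j) F)"

abbreviation "K \<equiv> calderon_kernel J"

abbreviation "S \<equiv> quotient_space jet K"

lemma coord_zero: "coord j n 0 = 0"
  using coord_scaleC[of j n 0 0] by simp

lemma coord_uminus: "coord j n (- x) = - coord j n x"
  using coord_scaleC[of j n "-1" x] by simp

lemma coord_diff: "coord j n (x - y) = coord j n x - coord j n y"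
  using coord_add[of j n "x - y" y] by simp

lemma coord_sum: "coord j n (sum f A) = (\<Sum>a\<in>A. coord j n (f a))"
  by (induction A rule: infinite_finite_induct) (simp_all add: coord_zero coord_add)

lemma coord_jet: "j < k \<Longrightarrow> coord j n (jet F) = Delta (\<iota> j) F n"
  by (simp add: jet_def coord_join)

lemma K_calderon: "F \<in> K \<Longrightarrow> F \<in> calderon"
  by (simp add: calderon_kernel_def)

sublocale quotient_setting K calderon_norm jet
proof
  show "banach_space \<lparr>pts = K, nrm = calderon_norm\<rparr>" by (rule banach_calderon_kernel[OF J_le])
  show "jet (F + G) = jet F + jet G" if "F \<in> K" "G \<in> K" for F G
    by (rule coord_ext) (simp add: coord_jet coord_add Delta_add K_calderon that)
  show "jet (a *\<^sub>C F) = a *\<^sub>C jet F" if "F \<in> K" for a F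
    by (rule coord_ext)
      (simp add: coord_jet coord_scaleC Delta_scaleC K_calderon that scaleC_cseq)
  show "jet F = 0" if s: "\<And>n. s n \<in> K \<and> jet (s n) = 0" and F: "F \<in> K"
    and lim: "(\<lambda>n. calderon_norm (s n - F)) \<longlonglongrightarrow> 0" for s :: "nat \<Rightarrow> _" and F
  proof (rule coord_ext)
    fix j n assume j: "j < k"
    have "(\<lambda>m. Delta (\<iota> j) (s m) n) \<longlonglongrightarrow> Delta (\<iota> j) F n"
      using s F by (intro Delta_limit K_calderon \<iota>_le j lim) auto
    moreover have "Delta (\<iota> j) (s m) n = 0" for m
      using s[of m] coord_jet[OF j, of n "s m"] by (simp add: coord_zero)
    ultimately show "coord j n (jet F) = coord j n 0"
      by (simp add: coord_jet[OF j] coord_zero LIMSEQ_const_iff)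
  qed
qed

lemma S_eq: "S = \<lparr>pts = jet ` K, nrm = qnorm\<rparr>"
  by (simp add: quotient_space_def qnorm_def fun_eq_iff)

lemma pts_S [simp]: "pts S = jet ` K" and nrm_S [simp]: "nrm S = qnorm"
  by (simp_all add: S_eq)

lemma banach_S: "banach_space S"
  unfolding S_eq by (rule banach_quotient)

text \<open>The Cauchy bound holds for every lift and therefore for the infimum. The resulting
  continuity of coordinates is the source of uniqueness of expansions and of closedness of the
  blocks.\<close>

lemma coord_le:
  assumes x: "x \<in> jet ` K" and j: "j < k"
  shows "cmod (coord j n x) \<le> 16 * qnorm x"
proof -
  have "cmod (coord j n x) / 16 \<le> qnorm x"
  proof (rule qnorm_greatest[OF x])
    fix F assume "F \<in> K" "jet F = x"
    then show "cmod (coord j n x) / 16 \<le> calderon_norm F"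
      using Delta_coord_le_16[OF K_calderon \<iota>_le[OF j], of F n] coord_jet[OF j, of n F] by simp
  qed
  then show ?thesis by simp
qed

lemma coord_limit:
  assumes s: "\<And>N. s N \<in> jet ` K" and x: "x \<in> jet ` K" and lim: "tends S s x sequentially" and j: "j < k"
  shows "(\<lambda>N. coord j n (s N)) \<longlonglongrightarrow> coord j n x"
proof -
  have bound: "norm (coord j n (s N) - coord j n x) \<le> 16 * qnorm (s N - x)" for N
    using coord_le[OF cvec.subspace_diff[OF subspace_image s x] j, of n N] by (simp add: coord_diff)
  have lim': "(\<lambda>N. qnorm (s N - x)) \<longlonglongrightarrow> 0" using lim by (simp add: tends_def)
  have "(\<lambda>N. coord j n (s N) - coord j n x) \<longlonglongrightarrow> 0"
    by (rule Lim_null_comparison[OF always_eventually[OF allI[OF bound]] tendsto_mult_right_zero[OF lim']])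
  then show ?thesis by (simp add: LIM_zero_iff)
qed

definition place :: "nat \<Rightarrow> (nat \<Rightarrow> complex) \<Rightarrow> 'v"
  where "place i c = join (\<lambda>j l. if l = i then c j else 0)"

lemma coord_place: "j < k \<Longrightarrow> coord j l (place i c) = (if l = i then c j else 0)"
  by (simp add: place_def coord_join)

definition basis :: "nat \<Rightarrow> nat \<Rightarrow> 'v"
  where "basis j q = place q (\<lambda>i. if i = j then 1 else 0)"

lemma coord_basis: "i < k \<Longrightarrow> coord i l (basis j q) = (if l = q \<and> i = j then 1 else 0)"
  by (simp add: basis_def coord_place)

text \<open>The lift has coefficient 1 at order \<open>\<iota> j\<close> and 0 at the other two
  orders, in particular at those in \<open>J\<close>.\<close>

lemma basis_mem:
  assumes j: "j < k"
  shows "basis j q \<in> jet ` K"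
proof -
  define F where "F = unit_lift (if \<iota> j = 0 then 1 else 0) (if \<iota> j = 1 then 1 else 0) (if \<iota> j = 2 then 1 else 0) q"
  have D: "Delta i F n = (if i = \<iota> j \<and> n = q then 1 else 0)" if "i \<le> 2" for i n
  proof -
    have "i = 0 \<or> i = 1 \<or> i = 2" using that by auto
    then show ?thesis unfolding F_def Delta_unit_lift[OF that]
      by (auto simp: unit_vec_def)
  qed
  have "F \<in> calderon" by (simp add: F_def unit_lift_mem)
  moreover have "Delta i F = 0" if "i \<in> J" for i
  proof
    fix n
    have "i \<noteq> \<iota> j" "i \<le> 2" using that \<iota>_notin[OF j] J_le by auto
    then show "Delta i F n = 0 n" by (simp add: D)
  qed
  ultimately have "F \<in> K" by (simp add: calderon_kernel_def)
  moreover have "jet F = basis j q"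
  proof (rule coord_ext)
    fix i n assume i: "i < k"
    have "\<iota> i = \<iota> j \<longleftrightarrow> i = j" using inj_\<iota> i j by (auto simp: inj_on_def)
    then show "coord i n (jet F) = coord i n (basis j q)"
      using i by (simp add: coord_jet coord_basis D \<iota>_le conj_commute)
  qed
  ultimately show ?thesis by (metis imageI)
qed

lemma place_eq: "place i c = (\<Sum>j<k. c j *\<^sub>C basis j i)"
proof (rule coord_ext)
  fix j n assume j: "j < k"
  have "coord j n (\<Sum>j'<k. c j' *\<^sub>C basis j' i) = (\<Sum>j'<k. if j' = j then (if n = i then c j else 0) else 0)"
    unfolding coord_sum using j by (intro sum.cong) (auto simp: coord_scaleC coord_basis)
  then show "coord j n (place i c) = coord j n (\<Sum>j<k. c j *\<^sub>C basis j i)"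
    using j by (simp add: coord_place)
qed

lemma place_mem: "place i c \<in> jet ` K"
  unfolding place_eq using basis_mem
  by (intro cvec.subspace_sum[OF subspace_image] cvec.subspace_scale[OF subspace_image]) auto

text \<open>The operator that \<open>weighted\<close> with factor 1 induces on the quotient.
  Position \<open>n\<close> of the result is read from position \<open>\<sigma> n\<close>, so
  entries travel along the inverse of \<sigma>.\<close>

definition wop :: "(nat \<Rightarrow> complex) \<Rightarrow> (nat \<Rightarrow> nat) \<Rightarrow> 'v \<Rightarrow> 'v"
  where "wop m \<sigma> x = join (\<lambda>j n. m n * coord j (\<sigma> n) x)"

lemma coord_wop: "j < k \<Longrightarrow> coord j n (wop m \<sigma> x) = m n * coord j (\<sigma> n) x"
  by (simp add: wop_def coord_join)

text \<open>Every lift of \<open>x\<close> is turned into a lift of the image without increasing the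
  norm; the infimum over lifts gives the contraction.\<close>

lemma wop_bounded:
  assumes x: "x \<in> jet ` K" and m: "\<And>n. cmod (m n) \<le> 1" and \<sigma>: "bij \<sigma>"
  shows "wop m \<sigma> x \<in> jet ` K" "qnorm (wop m \<sigma> x) \<le> qnorm x"
proof -
  have *: "wop m \<sigma> x \<in> jet ` K \<and> qnorm (wop m \<sigma> x) \<le> calderon_norm F" if F: "F \<in> K" "jet F = x" for F
  proof -
    note Fc = K_calderon[OF F(1)]
    define G where "G = weighted (\<lambda>_. 1) m \<sigma> F"
    have D: "Delta i G n = m n * Delta i F (\<sigma> n)" for i n
      using Delta_weighted_const[OF Fc m \<sigma>, where k = i and a = 1 and n = n] by (simp add: G_def)
    have "Delta i G = 0" if "i \<in> J" for i
      using F(1) that by (simp add: fun_eq_iff D calderon_kernel_def)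
    moreover have "G \<in> calderon" unfolding G_def by (rule weighted_const_mem[OF Fc m \<sigma>])
    ultimately have G: "G \<in> K" by (simp add: calderon_kernel_def)
    have "jet G = wop m \<sigma> x"
      by (rule coord_ext) (simp add: coord_jet coord_wop D flip: F(2))
    moreover have "calderon_norm G \<le> calderon_norm F"
      using calderon_norm_weighted_const[OF Fc m \<sigma>, where a = 1] by (simp add: G_def)
    ultimately show ?thesis using imageI[OF G, of jet] qnorm_le[OF G] by simp
  qed
  obtain F where "F \<in> K" "jet F = x" using x by blast
  then show "wop m \<sigma> x \<in> jet ` K" using * by blast
  show "qnorm (wop m \<sigma> x) \<le> qnorm x" using * by (intro qnorm_greatest[OF x]) blast
qed

abbreviation tail_part :: "nat \<Rightarrow> 'v \<Rightarrow> 'v"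
  where "tail_part n \<equiv> wop (cutoff n) id"

lemma tail_part_mem: "x \<in> jet ` K \<Longrightarrow> tail_part n x \<in> jet ` K"
  using norm_cutoff_le by (intro wop_bounded) auto

text \<open>The plain tail of a lift need not become small. What becomes small is the damped tail,
  another lift of the same element, and the quotient norm sees the best one.\<close>

lemma tail_part_tendsto:
  assumes x: "x \<in> jet ` K"
  shows "(\<lambda>n. qnorm (tail_part n x)) \<longlonglongrightarrow> 0"
proof (rule tendstoI)
  fix \<epsilon> :: real assume e: "0 < \<epsilon>"
  obtain F where F: "F \<in> K" "jet F = x" using x by blast
  obtain N where N: "\<And>n. N \<le> n \<Longrightarrow> \<exists>G\<in>calderon. (\<forall>k\<le>2. \<forall>i. Delta k G i = cutoff n i * Delta k F i) \<and>
      calderon_norm G \<le> \<epsilon>/2"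
    using calderon_small_tail[OF K_calderon[OF F(1)], of "\<epsilon>/2"] e by auto
  have "dist (qnorm (tail_part n x)) 0 < \<epsilon>" if n: "N \<le> n" for n
  proof -
    obtain G where G: "G \<in> calderon" "\<And>i l. i \<le> 2 \<Longrightarrow> Delta i G l = cutoff n l * Delta i F l"
      "calderon_norm G \<le> \<epsilon>/2" using N[OF n] by blast
    have "Delta i G = 0" if "i \<in> J" for i
    proof
      fix l
      have "i \<le> 2" using that J_le by auto
      then show "Delta i G l = 0 l" using F(1) that G(2) by (simp add: calderon_kernel_def)
    qed
    then have GK: "G \<in> K" using G(1) by (simp add: calderon_kernel_def)
    have "jet G = tail_part n x"
      by (rule coord_ext) (simp add: coord_jet coord_wop G(2) \<iota>_le flip: F(2))
    then have "qnorm (tail_part n x) \<le> \<epsilon>/2" using qnorm_le[OF GK] G(3) by simp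
    then show ?thesis using qnorm_nonneg[OF tail_part_mem[OF x], of n] e by simp
  qed
  then show "eventually (\<lambda>n. dist (qnorm (tail_part n x)) 0 < \<epsilon>) sequentially"
    unfolding eventually_sequentially by blast
qed

lemma sums_place:
  assumes x: "x \<in> jet ` K"
  shows "sums_in S (\<lambda>n. place n (\<lambda>j. coord j n x)) x"
proof -
  have "(\<Sum>n<N. place n (\<lambda>j. coord j n x)) - x = - tail_part N x" for N
  proof (rule coord_ext)
    fix j l assume j: "j < k"
    have "(\<Sum>n<N. coord j l (place n (\<lambda>j. coord j n x))) = (\<Sum>n<N. if n = l then coord j l x else 0)"
      using j by (intro sum.cong) (auto simp: coord_place)
    then show "coord j l ((\<Sum>n<N. place n (\<lambda>j. coord j n x)) - x) = coord j l (- tail_part N x)"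
      using j by (simp add: coord_diff coord_sum coord_uminus coord_wop cutoff_def)
  qed
  moreover have "qnorm (- y) = qnorm y" if "y \<in> jet ` K" for y
    using qnorm_scale[OF that, of "-1"] by simp
  ultimately show ?thesis
    using x tail_part_tendsto[OF x] tail_part_mem[OF x] by (simp add: sums_in_def tends_def)
qed

text \<open>In such a coordinate the partial sums are eventually constant, and coordinates are
  continuous.\<close>

lemma coord_sums:
  assumes v: "\<And>n. v n \<in> jet ` K" and x: "sums_in S v x" and j: "j < k"
    and supp: "\<And>m. m \<noteq> n \<Longrightarrow> coord j l (v m) = 0"
  shows "coord j l x = coord j l (v n)"
proof -
  have "(\<lambda>N. coord j l (\<Sum>m<N. v m)) \<longlonglongrightarrow> coord j l x"
    using x v by (intro coord_limit[OF _ _ _ j] cvec.subspace_sum[OF subspace_image]) (auto simp: sums_in_def)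
  moreover have "eventually (\<lambda>N. coord j l (\<Sum>m<N. v m) = coord j l (v n)) sequentially"
    using eventually_gt_at_top[of n]
  proof eventually_elim
    case (elim N)
    have "coord j l (\<Sum>m<N. v m) = (\<Sum>m<N. if m = n then coord j l (v n) else 0)"
      unfolding coord_sum using supp by (intro sum.cong) auto
    then show ?case using elim by simp
  qed
  then have "(\<lambda>N. coord j l (\<Sum>m<N. v m)) \<longlonglongrightarrow> coord j l (v n)" by (rule tendsto_eventually)
  ultimately show ?thesis by (rule LIMSEQ_unique)
qed

section \<open>The decomposition into blocks, its symmetry, and the interlaced basis\<close>

text \<open>Membership in the space is automatic: an element supported at one position is a
  combination of the attained vectors \<open>basis j n\<close>.\<close>

definition block :: "nat \<Rightarrow> 'v set"
  where "block n = {x. \<forall>j<k. \<forall>l. l \<noteq> n \<longrightarrow> coord j l x = 0}"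

lemma block_eq: "x \<in> block n \<Longrightarrow> x = place n (\<lambda>j. coord j n x)"
  by (rule coord_ext) (simp add: block_def coord_place)

lemma place_block: "place n c \<in> block n"
  by (simp add: block_def coord_place)

lemma block_subset: "block n \<subseteq> jet ` K"
  using block_eq place_mem by (metis subsetI)

lemma subspace_block: "csubspace (block n)"
  by (rule cvec.subspaceI) (simp_all add: block_def coord_zero coord_add coord_scaleC)

lemma closed_block: "closed_subspace S (block n)"
  unfolding closed_subspace_def pts_S
proof (intro conjI allI impI subspace_block block_subset)
  fix s x assume A: "(\<forall>m::nat. s m \<in> block n) \<and> x \<in> jet ` K \<and> tends S s x sequentially"
  have "coord j l x = 0" if j: "j < k" and l: "l \<noteq> n" for j l
  proof -
    have "(\<lambda>N. coord j l (s N)) \<longlonglongrightarrow> coord j l x"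
      using A block_subset by (intro coord_limit[OF _ _ _ j]) auto
    moreover have "coord j l (s N) = 0" for N using A j l by (simp add: block_def)
    ultimately show ?thesis by (simp add: LIMSEQ_const_iff)
  qed
  then show "x \<in> block n" by (simp add: block_def)
qed

lemma schauder_decomposition_block: "schauder_decomposition S block"
  unfolding schauder_decomposition_def pts_S
proof (intro conjI allI ballI banach_S closed_block)
  fix x assume x: "x \<in> jet ` K"
  show "\<exists>!v. (\<forall>n. v n \<in> block n) \<and> sums_in S v x"
  proof (rule ex1I)
    show "(\<forall>n. place n (\<lambda>j. coord j n x) \<in> block n) \<and> sums_in S (\<lambda>n. place n (\<lambda>j. coord j n x)) x"
      using sums_place[OF x] place_block by simp
    show "v = (\<lambda>n. place n (\<lambda>j. coord j n x))" if v: "(\<forall>n. v n \<in> block n) \<and> sums_in S v x" for v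
    proof
      fix n
      have "coord j n x = coord j n (v n)" if "j < k" for j
      proof (rule coord_sums[OF _ _ that])
        show "v n \<in> jet ` K" for n using v block_subset by blast
        show "sums_in S v x" using v by blast
        show "coord j n (v m) = 0" if "m \<noteq> n" for m
          using v that \<open>j < k\<close> by (simp add: block_def)
      qed
      then have "place n (\<lambda>j. coord j n (v n)) = place n (\<lambda>j. coord j n x)"
        by (intro coord_ext) (simp add: coord_place)
      then show "v n = place n (\<lambda>j. coord j n x)" using v block_eq by metis
    qed
  qed
qed

lemma dim_block: "cdim (block n) = k"
proof (rule cvec.dim_unique)
  let ?B = "(\<lambda>j. basis j n) ` {..<k}"
  have inj: "inj_on (\<lambda>j. basis j n) {..<k}"
  proof (rule inj_onI)
    fix i j assume "i \<in> {..<k}" "j \<in> {..<k}" "basis i n = basis j n"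
    then show "i = j" using coord_basis[of i n i n] coord_basis[of i n j n] by (auto split: if_splits)
  qed
  then show "card ?B = k" by (simp add: card_image)
  show "?B \<subseteq> block n" by (auto simp: basis_def place_block)
  show "block n \<subseteq> cvec.span ?B"
  proof
    fix x assume "x \<in> block n"
    then have "x = (\<Sum>j<k. coord j n x *\<^sub>C basis j n)" using block_eq place_eq by metis
    moreover have "\<dots> \<in> cvec.span ?B"
      by (intro cvec.span_sum cvec.span_scale cvec.span_base) auto
    ultimately show "x \<in> cvec.span ?B" by simp
  qed
  show "cvec.independent ?B"
  proof
    assume "cvec.dependent ?B"
    then obtain u where u: "\<exists>v\<in>?B. u v \<noteq> 0" "(\<Sum>v\<in>?B. u v *\<^sub>C v) = 0"
      by (auto simp: cvec.dependent_finite)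
    have "place n (\<lambda>j. u (basis j n)) = 0" using u(2) inj by (simp add: place_eq sum.reindex)
    then have "u (basis j n) = 0" if "j < k" for j
      using coord_place[OF that, of n n "\<lambda>j. u (basis j n)"] by (simp add: coord_zero)
    then show False using u(1) by auto
  qed
qed

text \<open>The rearranged series is the image of the given one under a single contraction, which
  also carries remainder to remainder. This yields convergence together with the symmetry constant
  1.\<close>

lemma symmetric_rearrangement:
  assumes \<pi>: "bij \<pi>" and \<epsilon>: "\<And>n. \<epsilon> n \<in> {1, -1::complex}"
    and x: "sums_in S (\<lambda>n. place n (c n)) x"
  shows "\<exists>y. sums_in S (\<lambda>n. \<epsilon> n *\<^sub>C place (\<pi> n) (c n)) y \<and> nrm S y \<le> nrm S x"
proof -
  have xS: "x \<in> jet ` K" using x by (simp add: sums_in_def)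
  have c: "coord j n x = c n j" if "j < k" for j n
    using coord_sums[OF place_mem x that, of n n] that by (simp add: coord_place)
  \<comment> \<open>Since \<open>wop\<close> reads its entries from \<open>\<sigma> n\<close>,
    moving position \<open>n\<close> to \<open>\<pi> n\<close> calls for the inverse; accordingly
    the sign below is taken at the source position.\<close>
  define \<sigma> where "\<sigma> = inv \<pi>"
  have \<sigma>: "bij \<sigma>" "\<And>n. \<sigma> (\<pi> n) = n" "\<And>n. \<pi> (\<sigma> n) = n"
    using \<pi> by (simp_all add: \<sigma>_def bij_imp_bij_inv bij_is_inj bij_is_surj surj_f_inv_f)
  define m where "m = (\<lambda>i. \<epsilon> (\<sigma> i))"
  have m: "cmod (m n) \<le> 1" for n using \<epsilon>[of "\<sigma> n"] by (auto simp: m_def)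
  have "(\<Sum>n<N. \<epsilon> n *\<^sub>C place (\<pi> n) (c n)) - wop m \<sigma> x = - wop m \<sigma> (tail_part N x)" for N
  proof (rule coord_ext)
    fix j l assume j: "j < k"
    have "coord j l (\<Sum>n<N. \<epsilon> n *\<^sub>C place (\<pi> n) (c n)) = (\<Sum>n<N. if n = \<sigma> l then m l * coord j (\<sigma> l) x else 0)"
      unfolding coord_sum using j \<sigma> by (intro sum.cong) (auto simp: coord_scaleC coord_place m_def c)
    then show "coord j l ((\<Sum>n<N. \<epsilon> n *\<^sub>C place (\<pi> n) (c n)) - wop m \<sigma> x) = coord j l (- wop m \<sigma> (tail_part N x))"
      using j by (simp add: coord_diff coord_uminus coord_wop cutoff_def)
  qed
  moreover have "qnorm (- y) = qnorm y" if "y \<in> jet ` K" for y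
    using qnorm_scale[OF that, of "-1"] by simp
  moreover have tm: "wop m \<sigma> (tail_part N x) \<in> jet ` K" "qnorm (wop m \<sigma> (tail_part N x)) \<le> qnorm (tail_part N x)" for N
    by (intro wop_bounded tail_part_mem xS m \<sigma>)+
  moreover have "(\<lambda>N. qnorm (wop m \<sigma> (tail_part N x))) \<longlonglongrightarrow> 0"
    by (rule tendsto_sandwich[OF _ _ tendsto_const tail_part_tendsto[OF xS]])
      (use tm qnorm_nonneg in \<open>auto intro!: always_eventually\<close>)
  ultimately have "sums_in S (\<lambda>n. \<epsilon> n *\<^sub>C place (\<pi> n) (c n)) (wop m \<sigma> x)"
    using wop_bounded(1)[OF xS m \<sigma>(1)] by (simp add: sums_in_def tends_def)
  then show ?thesis using wop_bounded(2)[OF xS m \<sigma>(1)] by auto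
qed

text \<open>The function \<open>f\<close> encodes an arbitrary model space by its \<open>k\<close>
  scalars. Thus the statement covers scalars for a symmetric basis and the zeroth block for a
  decomposition.\<close>

lemma uniformly_symmetric_place:
  fixes f :: "'g \<Rightarrow> nat \<Rightarrow> complex"
  shows "uniformly_symmetric S G (\<lambda>n g. place n (f g))"
  unfolding uniformly_symmetric_def
proof (intro exI[of _ 1] allI impI)
  fix \<pi> :: "nat \<Rightarrow> nat" and \<epsilon> :: "nat \<Rightarrow> complex" and g :: "nat \<Rightarrow> 'g" and x
  assume "bij \<pi> \<and> (\<forall>n. \<epsilon> n \<in> {1, -1::complex}) \<and> (\<forall>n. g n \<in> G) \<and> sums_in S (\<lambda>n. place n (f (g n))) x"
  then show "\<exists>y. sums_in S (\<lambda>n. \<epsilon> n *\<^sub>C place (\<pi> n) (f (g n))) y \<and> nrm S y \<le> 1 * nrm S x"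
    using symmetric_rearrangement[where \<pi> = \<pi> and \<epsilon> = \<epsilon> and c = "\<lambda>n. f (g n)"] by simp
qed

lemma symmetric_decomposition_block: "symmetric_decomposition k S block"
  unfolding symmetric_decomposition_def
proof (intro conjI allI schauder_decomposition_block dim_block exI[of _ "block 0"]
    exI[of _ "\<lambda>n g. place n (\<lambda>j. coord j 0 g)"] subspace_block)
  fix n
  have inv: "place b (\<lambda>j. coord j a (place a (\<lambda>j. coord j b x))) = x" if "x \<in> block b" for a b x
  proof -
    have "place b (\<lambda>j. coord j a (place a (\<lambda>j. coord j b x))) = place b (\<lambda>j. coord j b x)"
      by (rule coord_ext) (simp add: coord_place)
    then show ?thesis using block_eq[OF that] by simp
  qed
  show "identification (block 0) (block n) (\<lambda>g. place n (\<lambda>j. coord j 0 g))"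
    unfolding identification_def
  proof (intro conjI ballI allI)
    show "bij_betw (\<lambda>g. place n (\<lambda>j. coord j 0 g)) (block 0) (block n)"
      by (rule bij_betwI[where g = "\<lambda>x. place 0 (\<lambda>j. coord j n x)"]) (auto simp: place_block inv)
    show "place n (\<lambda>j. coord j 0 (x + y)) = place n (\<lambda>j. coord j 0 x) + place n (\<lambda>j. coord j 0 y)" for x y
      by (rule coord_ext) (simp add: coord_place coord_add)
    show "place n (\<lambda>j. coord j 0 (a *\<^sub>C x)) = a *\<^sub>C place n (\<lambda>j. coord j 0 x)" for a x
      by (rule coord_ext) (simp add: coord_place coord_scaleC)
  qed
next
  show "uniformly_symmetric S (block 0) (\<lambda>n g. place n (\<lambda>j. coord j 0 g))"
    by (rule uniformly_symmetric_place)
qed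

text \<open>The interlaced partial sums differ from the block partial sums by at most \<open>k\<close> terms of
  the next block.\<close>

lemma schauder_basis_interlaced: "schauder_basis S (\<lambda>m. basis (m mod k) (m div k))"
  unfolding schauder_basis_def pts_S
proof (intro conjI allI ballI banach_S)
  let ?b = "\<lambda>m. basis (m mod k) (m div k)"
  show mem: "?b m \<in> jet ` K" for m using k_pos by (intro basis_mem) simp
  fix x assume x: "x \<in> jet ` K"
  have coord_b: "coord j l (?b m) = (if m = l * k + j then 1 else 0)" if "j < k" for j l m
  proof -
    have "m = l * k + j \<longleftrightarrow> l = m div k \<and> j = m mod k" using that by auto
    then show ?thesis using that by (simp add: coord_basis)
  qed
  show "\<exists>!c. sums_in S (\<lambda>m. c m *\<^sub>C ?b m) x"
  proof (rule ex1I)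
    let ?c = "\<lambda>m. coord (m mod k) (m div k) x"
    \<comment> \<open>Exchanging positions 0 and \<open>q\<close> is a contraction, so the norms of
      all basis vectors are controlled by the \<open>k\<close> vectors at position 0.\<close>
    obtain C where C: "\<And>j q. j < k \<Longrightarrow> qnorm (basis j q) \<le> C"
    proof
      fix j q assume j: "j < k"
      have "basis j q = wop (\<lambda>_. 1) (Transposition.transpose 0 q) (basis j 0)"
        by (rule coord_ext) (auto simp: coord_wop coord_basis Transposition.transpose_def)
      then have "qnorm (basis j q) \<le> qnorm (basis j 0)"
        using wop_bounded(2)[OF basis_mem[OF j], of "\<lambda>_. 1" "Transposition.transpose 0 q" 0] by simp
      also have "\<dots> \<le> (\<Sum>j<k. qnorm (basis j 0))"
        using j qnorm_nonneg basis_mem by (intro member_le_sum) auto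
      finally show "qnorm (basis j q) \<le> (\<Sum>j<k. qnorm (basis j 0))" .
    qed
    have C0: "0 \<le> C" using C[OF k_pos, of 0] qnorm_nonneg[OF basis_mem[OF k_pos, of 0]] by simp
    \<comment> \<open>The first \<open>N div k\<close> blocks are complete and leave the tail as
      error. Each of the fewer than \<open>k\<close> further terms costs at most
      \<open>16 * C\<close> times the norm of that same tail.\<close>
    have bound: "qnorm ((\<Sum>m<N. ?c m *\<^sub>C ?b m) - x) \<le> (1 + real k * 16 * C) * qnorm (tail_part (N div k) x)" for N
    proof -
      define q r where "q = N div k" and "r = N mod k"
      have N: "N = q * k + r" and r: "r < k" using k_pos by (simp_all add: q_def r_def)
      note tm = tail_part_mem[OF x, of q]
      define \<tau> where "\<tau> = qnorm (tail_part q x)"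
      have \<tau>: "0 \<le> \<tau>" using qnorm_nonneg[OF tm] by (simp only: \<tau>_def)
      define R where "R = (\<Sum>j<r. coord j q x *\<^sub>C basis j q)"
      have eq: "(\<Sum>m<N. ?c m *\<^sub>C ?b m) - x = R + (-1) *\<^sub>C tail_part q x"
      proof (rule coord_ext)
        fix j l assume j: "j < k"
        have "coord j l (\<Sum>m<N. ?c m *\<^sub>C ?b m) = (\<Sum>m<N. if m = l * k + j then coord j l x else 0)"
          unfolding coord_sum using j by (intro sum.cong) (auto simp: coord_scaleC coord_b)
        also have "\<dots> = (if l * k + j < N then coord j l x else 0)" by simp
        \<comment> \<open>With \<open>N = q * k + r\<close>, comparing indices is comparing the
          pairs \<open>(l, j)\<close> and \<open>(q, r)\<close> lexicographically.\<close>
        also have "l * k + j < N \<longleftrightarrow> l < q \<or> (l = q \<and> j < r)"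
        proof -
          consider "l < q" | "l = q" | "q < l" by linarith
          then show ?thesis
          proof cases
            case 1
            then have "Suc l * k \<le> q * k" by (intro mult_right_mono) auto
            then show ?thesis using 1 j N by simp
          next
            case 3
            then have "Suc q * k \<le> l * k" by (intro mult_right_mono) auto
            then show ?thesis using 3 r N by simp
          qed (use N in auto)
        qed
        finally have 1: "coord j l (\<Sum>m<N. ?c m *\<^sub>C ?b m) = (if l < q \<or> (l = q \<and> j < r) then coord j l x else 0)" .
        have "coord j l R = (\<Sum>i<r. if i = j then (if l = q then coord j l x else 0) else 0)"
          unfolding R_def coord_sum using j by (intro sum.cong) (auto simp: coord_scaleC coord_basis)
        then have 2: "coord j l R = (if l = q \<and> j < r then coord j l x else 0)" by simp
        show "coord j l ((\<Sum>m<N. ?c m *\<^sub>C ?b m) - x) = coord j l (R + (-1) *\<^sub>C tail_part q x)"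
          unfolding coord_diff coord_add coord_scaleC coord_wop[OF j] 1 2 by (auto simp: cutoff_def)
      qed
      have summand: "coord j q x *\<^sub>C basis j q \<in> jet ` K \<and>
          qnorm (coord j q x *\<^sub>C basis j q) \<le> 16 * C * \<tau>" if "j < k" for j
      proof -
        \<comment> \<open>\<open>cutoff q\<close> keeps position \<open>q\<close> itself, so the
          coefficients of the unfinished block are coordinates of the tail and small with
          it.\<close>
        have "coord j q (tail_part q x) = coord j q x" using that by (simp add: coord_wop cutoff_def)
        then have "cmod (coord j q x) \<le> 16 * \<tau>" using coord_le[OF tm that, of q] by (simp only: \<tau>_def)
        then have "cmod (coord j q x) * qnorm (basis j q) \<le> 16 * \<tau> * C"
          using C[OF that] qnorm_nonneg[OF basis_mem[OF that]] \<tau> by (intro mult_mono) auto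
        then show ?thesis
          using qnorm_scale[OF basis_mem[OF that]] cvec.subspace_scale[OF subspace_image basis_mem[OF that]]
          by (simp add: mult_ac)
      qed
      have sum: "(\<Sum>j<i. coord j q x *\<^sub>C basis j q) \<in> jet ` K \<and>
          qnorm (\<Sum>j<i. coord j q x *\<^sub>C basis j q) \<le> real i * (16 * C * \<tau>)" if "i \<le> k" for i
        using that
      proof (induction i)
        case 0
        show ?case
          using cvec.subspace_0[OF subspace_image] qnorm_eq_0_iff[OF cvec.subspace_0[OF subspace_image]] by simp
      next
        case (Suc i)
        then have IH: "(\<Sum>j<i. coord j q x *\<^sub>C basis j q) \<in> jet ` K"
          "qnorm (\<Sum>j<i. coord j q x *\<^sub>C basis j q) \<le> real i * (16 * C * \<tau>)"
          using Suc_leD by blast+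
        have "i < k" using Suc.prems by simp
        note t = summand[OF this]
        show ?case
          using qnorm_add[OF IH(1) conjunct1[OF t]] IH(2) conjunct2[OF t]
            cvec.subspace_add[OF subspace_image IH(1) conjunct1[OF t]]
          by (simp add: algebra_simps)
      qed
      have RK: "R \<in> jet ` K" using sum[of r] r by (simp add: R_def)
      have "qnorm R \<le> real r * (16 * C * \<tau>)"
        using sum[of r] r by (auto simp: R_def)
      also have "\<dots> \<le> real k * (16 * C * \<tau>)"
        using r C0 \<tau> by (intro mult_right_mono) auto
      finally have R: "qnorm R \<le> real k * (16 * C * \<tau>)" .
      have "qnorm (R + (-1) *\<^sub>C tail_part q x) \<le> qnorm R + qnorm ((-1) *\<^sub>C tail_part q x)"
        by (intro qnorm_add RK cvec.subspace_scale[OF subspace_image tm])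
      also have "qnorm ((-1) *\<^sub>C tail_part q x) = \<tau>"
        by (simp only: qnorm_scale[OF tm] \<tau>_def) simp
      finally have "qnorm (R + (-1) *\<^sub>C tail_part q x) \<le> qnorm R + \<tau>" .
      moreover have "(1 + real k * 16 * C) * \<tau> = real k * (16 * C * \<tau>) + \<tau>"
        by (simp add: algebra_simps)
      ultimately show ?thesis unfolding eq q_def[symmetric] \<tau>_def[symmetric] using R by linarith
    qed
    have div: "filterlim (\<lambda>N. N div k) at_top sequentially"
      unfolding filterlim_at_top eventually_sequentially
    proof
      fix Z
      have "Z \<le> N div k" if "Z * k \<le> N" for N
        using div_le_mono[OF that, of k] k_pos by simp
      then show "\<exists>N. \<forall>n\<ge>N. Z \<le> n div k" by blast
    qed
    have lim: "(\<lambda>N. (1 + real k * 16 * C) * qnorm (tail_part (N div k) x)) \<longlonglongrightarrow> 0"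
      by (rule tendsto_mult_right_zero[OF filterlim_compose[OF tail_part_tendsto[OF x] div]])
    have partial: "(\<Sum>m<N. c m *\<^sub>C ?b m) \<in> jet ` K" for c N
      by (intro cvec.subspace_sum[OF subspace_image] cvec.subspace_scale[OF subspace_image] mem)
    have "0 \<le> qnorm ((\<Sum>m<N. ?c m *\<^sub>C ?b m) - x)" for N
      using partial x by (intro qnorm_nonneg cvec.subspace_diff[OF subspace_image])
    then have "(\<lambda>N. qnorm ((\<Sum>m<N. ?c m *\<^sub>C ?b m) - x)) \<longlonglongrightarrow> 0"
      by (intro tendsto_sandwich[OF always_eventually always_eventually tendsto_const lim] allI bound)
    then show "sums_in S (\<lambda>m. ?c m *\<^sub>C ?b m) x" using x by (simp add: sums_in_def tends_def)
    show "c = ?c" if c: "sums_in S (\<lambda>m. c m *\<^sub>C ?b m) x" for c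
    proof
      fix m
      have j: "m mod k < k" using k_pos by simp
      have "coord (m mod k) (m div k) x = coord (m mod k) (m div k) (c m *\<^sub>C ?b m)"
        by (rule coord_sums[OF cvec.subspace_scale[OF subspace_image mem] c j])
          (use j in \<open>simp add: coord_scaleC coord_b\<close>)
      then show "c m = coord (m mod k) (m div k) x" using j by (simp add: coord_scaleC coord_b)
    qed
  qed
qed

end

section \<open>The spaces of the theorem as instances\<close>

text \<open>For \<open>k = 1\<close> the interlaced system is the sequence of unit vectors itself,
  as \<open>m mod 1 = 0\<close> and \<open>m div 1 = m\<close>.\<close>

lemma symmetric_basis_Delta:
  assumes "i \<le> 2" "J \<subseteq> {..2}" "i \<notin> J"
  shows "symmetric_basis (quotient_space (Delta i) (calderon_kernel J)) unit_vec"
proof -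
  interpret jet_space 1 "\<lambda>j n x. x n" "\<lambda>u. u 0" "\<lambda>_. i" J
    using assms by unfold_locales (auto simp: scaleC_cseq inj_on_def)
  have jet: "jet = Delta i" by (simp add: fun_eq_iff jet_def)
  have basis: "basis 0 n = unit_vec n" for n
    by (auto simp: basis_def place_def unit_vec_def)
  have place: "place n (\<lambda>_. t) = t *\<^sub>C unit_vec n" for n t
    by (auto simp: place_def unit_vec_def scaleC_fun_def scaleC_complex_def)
  have "schauder_basis S unit_vec"
    using schauder_basis_interlaced by (simp add: basis)
  moreover have "uniformly_symmetric S UNIV (\<lambda>n t. t *\<^sub>C unit_vec n)"
    unfolding place[symmetric] by (rule uniformly_symmetric_place)
  ultimately show ?thesis by (simp add: symmetric_basis_def jet)
qed

lemma two_dimensional_Delta2: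
  assumes "i \<le> 2" "j \<le> 2" "i \<noteq> j" "J \<subseteq> {..2}" "i \<notin> J" "j \<notin> J"
  shows "\<exists>E. symmetric_decomposition 2 (quotient_space (Delta2 i j) (calderon_kernel J)) E"
    "\<exists>e. schauder_basis (quotient_space (Delta2 i j) (calderon_kernel J)) e"
proof -
  interpret jet_space 2 "\<lambda>l n x. (if l = 0 then fst x else snd x) n" "\<lambda>u. (u 0, u 1)"
    "\<lambda>l. if l = 0 then i else j" J
  proof
    show "x = y" if "\<And>(l::nat) n. l < 2 \<Longrightarrow> (if l = 0 then fst x else snd x) n = (if l = 0 then fst y else snd y) n"
      for x y :: "cseq \<times> cseq"
      using that[of 0] that[of 1] by (auto simp: prod_eq_iff fun_eq_iff)
  qed (use assms in \<open>auto simp: scaleC_cseq scaleC_prod_def inj_on_def less_2_cases_iff\<close>)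
  have "jet = Delta2 i j" by (rule ext) (simp only: jet_def Delta2_def, simp)
  then show "\<exists>E. symmetric_decomposition 2 (quotient_space (Delta2 i j) (calderon_kernel J)) E"
    "\<exists>e. schauder_basis (quotient_space (Delta2 i j) (calderon_kernel J)) e"
    using symmetric_decomposition_block schauder_basis_interlaced by auto
qed

lemma three_dimensional_Delta3:
  assumes "h \<le> 2" "i \<le> 2" "j \<le> 2" "h \<noteq> i" "h \<noteq> j" "i \<noteq> j"
  shows "\<exists>E. symmetric_decomposition 3 (quotient_space (Delta3 h i j) (calderon_kernel {})) E"
    "\<exists>e. schauder_basis (quotient_space (Delta3 h i j) (calderon_kernel {})) e"
proof -
  have less3: "l < 3 \<longleftrightarrow> l = 0 \<or> l = 1 \<or> l = 2" for l :: nat by auto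
  interpret jet_space 3 "\<lambda>l n x. (if l = 0 then fst x else if l = 1 then fst (snd x) else snd (snd x)) n"
    "\<lambda>u. (u 0, u 1, u 2)" "\<lambda>l. if l = 0 then h else if l = 1 then i else j" "{}"
  proof
    show "x = y" if "\<And>(l::nat) n. l < 3 \<Longrightarrow>
        (if l = 0 then fst x else if l = 1 then fst (snd x) else snd (snd x)) n =
        (if l = 0 then fst y else if l = 1 then fst (snd y) else snd (snd y)) n"
      for x y :: "cseq \<times> cseq \<times> cseq"
      using that[of 0] that[of 1] that[of 2] by (auto simp: prod_eq_iff fun_eq_iff)
  qed (use assms in \<open>auto simp: scaleC_cseq scaleC_prod_def inj_on_def less3\<close>)
  have "jet = Delta3 h i j" by (rule ext) (simp only: jet_def Delta3_def, simp)
  then show "\<exists>E. symmetric_decomposition 3 (quotient_space (Delta3 h i j) (calderon_kernel {})) E"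
    "\<exists>e. schauder_basis (quotient_space (Delta3 h i j) (calderon_kernel {})) e"
    using symmetric_decomposition_block schauder_basis_interlaced by auto
qed

theorem proposition5p1:
  fixes a b c :: nat
  assumes "{a, b, c} = {2, 1, 0}"
  shows
    "symmetric_basis (quotient_space (Delta c) calderon) unit_vec \<and>
     symmetric_basis (quotient_space (Delta b) (ker_Delta c)) unit_vec \<and>
     symmetric_basis (quotient_space (Delta a) (ker_Delta b \<inter> ker_Delta c)) unit_vec \<and>
     (\<exists>E. symmetric_decomposition 2 (quotient_space (Delta2 a b) (ker_Delta c)) E) \<and>
     (\<exists>E. symmetric_decomposition 2 (quotient_space (Delta2 a b) calderon) E) \<and>
     (\<exists>E. symmetric_decomposition 3 (quotient_space (Delta3 a b c) calderon) E) \<and>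
     (\<exists>e. schauder_basis (quotient_space (Delta c) calderon) e) \<and>
     (\<exists>e. schauder_basis (quotient_space (Delta b) (ker_Delta c)) e) \<and>
     (\<exists>e. schauder_basis (quotient_space (Delta a) (ker_Delta b \<inter> ker_Delta c)) e) \<and>
     (\<exists>e. schauder_basis (quotient_space (Delta2 a b) (ker_Delta c)) e) \<and>
     (\<exists>e. schauder_basis (quotient_space (Delta2 a b) calderon) e) \<and>
     (\<exists>e. schauder_basis (quotient_space (Delta3 a b c) calderon) e)"
proof -
  \<comment> \<open>Equality of sets encodes a permutation: three values filling a set of three
    elements must be distinct.\<close>
  have "card {a, b, c} = 3" using assms by simp
  then have distinct: "a \<noteq> b" "a \<noteq> c" "b \<noteq> c" by (auto simp: card_insert_if split: if_splits)
  have "{a, b, c} \<subseteq> {..2}" unfolding assms by simp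
  then have le: "a \<le> 2" "b \<le> 2" "c \<le> 2" by simp_all
  have ker: "calderon = calderon_kernel {}" "ker_Delta c = calderon_kernel {c}"
    "ker_Delta b \<inter> ker_Delta c = calderon_kernel {b, c}"
    by (auto simp: calderon_kernel_def ker_Delta_def)
  have 1: "symmetric_basis (quotient_space (Delta c) calderon) unit_vec"
    "symmetric_basis (quotient_space (Delta b) (ker_Delta c)) unit_vec"
    "symmetric_basis (quotient_space (Delta a) (ker_Delta b \<inter> ker_Delta c)) unit_vec"
    unfolding ker(3) unfolding ker(1,2) by (rule symmetric_basis_Delta; use le distinct in auto)+
  have 2: "\<exists>E. symmetric_decomposition 2 (quotient_space (Delta2 a b) (ker_Delta c)) E"
    "\<exists>E. symmetric_decomposition 2 (quotient_space (Delta2 a b) calderon) E"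
    "\<exists>e. schauder_basis (quotient_space (Delta2 a b) (ker_Delta c)) e"
    "\<exists>e. schauder_basis (quotient_space (Delta2 a b) calderon) e"
    unfolding ker by (rule two_dimensional_Delta2; use le distinct in auto)+
  have 3: "\<exists>E. symmetric_decomposition 3 (quotient_space (Delta3 a b c) calderon) E"
    "\<exists>e. schauder_basis (quotient_space (Delta3 a b c) calderon) e"
    unfolding ker by (rule three_dimensional_Delta3; use le distinct in auto)+
  show ?thesis using 1 2 3 by (auto simp: symmetric_basis_def)
qed

end
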